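(* Let $f:(0,\infty)\to(0,\infty)$ be a continuous function such that $f^2$ is operator concave on $(0,\infty)$. Then for every unital positive linear map $\Phi:\mathbb{B}(\mathscr{H})\to\mathbb{B}(\mathscr{K})$ and every positive invertible operator $A\in\mathbb{B}(\mathscr{H})$, $$|\Phi(f(A))\Phi(A)|\leq \Phi(Af(A))$$ and $$\left|\Phi(f(A))^{-1}\Phi(A)\right|\geq \Phi\left(Af(A)^{-1}\right).$$ In addition, if $f(t)\geq 1$ for all $t>0$, then $$\Phi\left(Af(A)^{-1}\right)\leq \left|\Phi(f(A))^{-1}\Phi(A)\right|\leq |\Phi(f(A))\Phi(A)|\leq \Phi(Af(A)).$$
   Context: $\mathbb{B}(\mathscr{H})$ is the $C^*$-algebra of bounded linear operators on a Hilbert space $\mathscr{H}$, and $\leq$ is the usual (Löwner) order on self-adjoint operators. A linear map $\Phi$ between such algebras is positive if it maps positive operators to positive operators, and unital if $\Phi(I)=I$. $|X|=(X^*X)^{1/2}$. Functions of positive invertible operators are defined by the continuous functional calculus; $f^2$ denotes the pointwise square $t\mapsto f(t)^2$. A continuous function $f:J\to\mathbb{R}$ on an interval $J$ is operator convex if $f(\lambda A+(1-\lambda)B)\leq\lambda f(A)+(1-\lambda)f(B)$ for all self-adjoint operators $A,B$ with spectra in $J$ and all $\lambda\in[0,1]$; $f$ is operator concave if $-f$ is operator convex. *)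

theory Defs
  imports "HOL-Analysis.Analysis"
begin

class complex_vector = ab_group_add +
  fixes scaleC :: "complex \<Rightarrow> 'a \<Rightarrow> 'a"  (infixr \<open>*\<^sub>C\<close> 75)
  assumes scaleC_add_right: "c *\<^sub>C (x + y) = c *\<^sub>C x + c *\<^sub>C y"
    and scaleC_add_left: "(c + d) *\<^sub>C x = c *\<^sub>C x + d *\<^sub>C x"
    and scaleC_scaleC: "c *\<^sub>C d *\<^sub>C x = (c * d) *\<^sub>C x"
    and scaleC_one: "1 *\<^sub>C x = x"

text \<open>Complex Hilbert spaces, the zero space included. Completeness comes from \<^class>\<open>banach\<close>;
  positive definiteness of the inner product follows from the last axiom, since
  \<^const>\<open>sqrt\<close> is odd and the norm is nonnegative and definite.\<close>

class complex_hilbert = complex_vector + banach +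
  fixes cinner :: "'a \<Rightarrow> 'a \<Rightarrow> complex"
  assumes scaleR_eq_scaleC: "r *\<^sub>R x = complex_of_real r *\<^sub>C x"
    and cinner_commute: "cinner x y = cnj (cinner y x)"
    and cinner_add_right: "cinner x (y + z) = cinner x y + cinner x z"
    and cinner_scaleC_right: "cinner x (c *\<^sub>C y) = c * cinner x y"
    and norm_eq_sqrt_cinner: "norm x = sqrt (Re (cinner x x))"

lemma scaleC_zero_right: "c *\<^sub>C (0::'a::complex_vector) = 0"
  using scaleC_add_right[of c "0::'a" 0] by simp

lemma scaleC_minus_right: "c *\<^sub>C (- x) = - (c *\<^sub>C (x::'a::complex_vector))"
  using scaleC_add_right[of c x "- x"] by (simp add: scaleC_zero_right eq_neg_iff_add_eq_0 add.commute)

lemma scaleC_bound: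
  fixes x :: "'a::complex_hilbert"
  shows "norm (c *\<^sub>C x) = cmod c * norm x"
proof -
  have "cinner (c *\<^sub>C x) (c *\<^sub>C x) = c * cnj c * cinner x x"
    by (metis cinner_commute cinner_scaleC_right complex_cnj_mult mult.assoc mult.commute)
  then have "cinner (c *\<^sub>C x) (c *\<^sub>C x) = complex_of_real ((cmod c)\<^sup>2) * cinner x x"
    by (simp only: complex_norm_square)
  then show ?thesis
    by (simp add: norm_eq_sqrt_cinner real_sqrt_mult)
qed

lemma bounded_linear_scaleC: "bounded_linear (\<lambda>x::'a::complex_hilbert. c *\<^sub>C x)"
proof (rule bounded_linear_intro[where K = "cmod c"])
  show "c *\<^sub>C (r *\<^sub>R x) = r *\<^sub>R (c *\<^sub>C x)" for r and x :: 'a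
    by (simp add: scaleR_eq_scaleC scaleC_scaleC mult.commute)
qed (simp_all add: scaleC_add_right scaleC_bound mult.commute)

text \<open>The algebra of bounded (complex-)linear operators on a complex Hilbert space. It is made a
  \<^class>\<open>ring\<close> and a \<^class>\<open>monoid_mult\<close> rather than a unital ring in the sense of
  \<^class>\<open>ring_1\<close>, because the latter would exclude the zero space.\<close>

typedef (overloaded) 'a bop =
  "{T :: 'a::complex_hilbert \<Rightarrow> 'a. bounded_linear T \<and> (\<forall>c x. T (c *\<^sub>C x) = c *\<^sub>C T x)}"
  morphisms bop_apply Bop
  by (rule exI[of _ "\<lambda>x. x"]) simp

setup_lifting type_definition_bop

instantiation bop :: (complex_hilbert) "{ring, monoid_mult, complex_vector}"
begin

lift_definition zero_bop :: "'a bop" is "\<lambda>x. 0"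
  by (simp add: scaleC_zero_right)

lift_definition one_bop :: "'a bop" is "\<lambda>x. x"
  by simp

lift_definition plus_bop :: "'a bop \<Rightarrow> 'a bop \<Rightarrow> 'a bop" is "\<lambda>S T x. S x + T x"
  by (simp add: bounded_linear_add scaleC_add_right)

lift_definition uminus_bop :: "'a bop \<Rightarrow> 'a bop" is "\<lambda>T x. - T x"
  by (simp add: bounded_linear_minus scaleC_minus_right)

lift_definition minus_bop :: "'a bop \<Rightarrow> 'a bop \<Rightarrow> 'a bop" is "\<lambda>S T x. S x - T x"
  by (simp add: bounded_linear_sub)
    (simp only: diff_conv_add_uminus scaleC_add_right scaleC_minus_right simp_thms)

lift_definition times_bop :: "'a bop \<Rightarrow> 'a bop \<Rightarrow> 'a bop" is "\<lambda>S T x. S (T x)"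
  by (simp add: bounded_linear_compose)

lift_definition scaleC_bop :: "complex \<Rightarrow> 'a bop \<Rightarrow> 'a bop" is "\<lambda>c T x. c *\<^sub>C T x"
  by (simp add: bounded_linear_compose[OF bounded_linear_scaleC] scaleC_scaleC mult.commute)

instance
  by standard
    (transfer; simp add: fun_eq_iff algebra_simps scaleC_add_right scaleC_add_left scaleC_scaleC
      scaleC_one linear_add[OF bounded_linear.linear])+

end

definition adj :: "'a::complex_hilbert bop \<Rightarrow> 'a bop" where
  "adj T = (THE S. \<forall>x y. cinner (bop_apply S x) y = cinner x (bop_apply T y))"

definition self_adjoint :: "'a::complex_hilbert bop \<Rightarrow> bool" where
  "self_adjoint T \<longleftrightarrow> adj T = T"

definition positive_op :: "'a::complex_hilbert bop \<Rightarrow> bool" where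
  "positive_op T \<longleftrightarrow> self_adjoint T \<and> (\<forall>x. 0 \<le> Re (cinner x (bop_apply T x)))"

text \<open>On operators, \<open>\<le>\<close> is the Loewner order.\<close>

instantiation bop :: (complex_hilbert) ord
begin

definition less_eq_bop :: "'a bop \<Rightarrow> 'a bop \<Rightarrow> bool" where
  "S \<le> T \<longleftrightarrow> positive_op (T - S)"

definition less_bop :: "'a bop \<Rightarrow> 'a bop \<Rightarrow> bool" where
  "S < T \<longleftrightarrow> S \<le> T \<and> S \<noteq> (T :: 'a bop)"

instance ..

end

definition invertible_op :: "'a::complex_hilbert bop \<Rightarrow> bool" where
  "invertible_op T \<longleftrightarrow> (\<exists>S. S * T = 1 \<and> T * S = 1)"

definition inv_op :: "'a::complex_hilbert bop \<Rightarrow> 'a bop" where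
  "inv_op T = (THE S. S * T = 1 \<and> T * S = 1)"

definition op_spectrum :: "'a::complex_hilbert bop \<Rightarrow> complex set" where
  "op_spectrum T = {z. \<not> invertible_op (T - z *\<^sub>C 1)}"

text \<open>\<open>functional_calculus T \<pi>\<close> says that \<open>\<pi>\<close> is a unital \<open>*\<close>-homomorphism from the
  continuous functions on the spectrum of \<open>T\<close> to the bounded operators which sends the identity
  function to \<open>T\<close>. An element of \<open>C(\<sigma>(T))\<close> is represented by any total function
  restricting to it; the first condition makes \<open>\<pi>\<close> independent of the representative, and
  nothing is required of \<open>\<pi>\<close> on functions not continuous on the spectrum.\<close>

definition functional_calculus ::
  "'a::complex_hilbert bop \<Rightarrow> ((complex \<Rightarrow> complex) \<Rightarrow> 'a bop) \<Rightarrow> bool" where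
  "functional_calculus T \<pi> \<longleftrightarrow>
     (let C = {g. continuous_on (op_spectrum T) g} in
       (\<forall>g\<in>C. \<forall>h\<in>C. (\<forall>z\<in>op_spectrum T. g z = h z) \<longrightarrow> \<pi> g = \<pi> h) \<and>
       (\<forall>g\<in>C. \<forall>h\<in>C. \<pi> (\<lambda>z. g z + h z) = \<pi> g + \<pi> h) \<and>
       (\<forall>g\<in>C. \<forall>h\<in>C. \<pi> (\<lambda>z. g z * h z) = \<pi> g * \<pi> h) \<and>
       (\<forall>g\<in>C. \<forall>c. \<pi> (\<lambda>z. c * g z) = c *\<^sub>C \<pi> g) \<and>
       (\<forall>g\<in>C. \<pi> (\<lambda>z. cnj (g z)) = adj (\<pi> g)) \<and>
       \<pi> (\<lambda>z. 1) = 1 \<and>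
       \<pi> (\<lambda>z. z) = T)"

text \<open>The continuous functional calculus for normal \<open>T\<close> and \<open>g\<close> continuous on the
  spectrum of \<open>T\<close>.\<close>

definition cfc :: "(complex \<Rightarrow> complex) \<Rightarrow> 'a::complex_hilbert bop \<Rightarrow> 'a bop" where
  "cfc g T = (THE S. \<exists>\<pi>. functional_calculus T \<pi> \<and> S = \<pi> g)"

text \<open>\<open>f(T)\<close> for a real function \<open>f\<close> and self-adjoint \<open>T\<close> (whose spectrum is real).\<close>

definition op_fun :: "(real \<Rightarrow> real) \<Rightarrow> 'a::complex_hilbert bop \<Rightarrow> 'a bop" where
  "op_fun f T = cfc (\<lambda>z. complex_of_real (f (Re z))) T"

definition abs_op :: "'a::complex_hilbert bop \<Rightarrow> 'a bop" where
  "abs_op T = op_fun sqrt (adj T * T)"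

text \<open>Operator convexity refers to operators on Hilbert spaces not otherwise present in the data.
  Since a predicate cannot quantify over types, the Hilbert space is a type argument. For an
  infinite-dimensional space the notion does not depend on the space, and it is then equivalent to
  the inequality on all Hilbert spaces; on a space of finite dimension it is weaker.\<close>

definition operator_convex_on ::
  "'l::complex_hilbert itself \<Rightarrow> real set \<Rightarrow> (real \<Rightarrow> real) \<Rightarrow> bool" where
  "operator_convex_on (_ :: 'l itself) J f \<longleftrightarrow>
     continuous_on J f \<and>
     (\<forall>(A :: 'l bop) (B :: 'l bop) t.
        self_adjoint A \<and> self_adjoint B \<and>
        op_spectrum A \<subseteq> complex_of_real ` J \<and> op_spectrum B \<subseteq> complex_of_real ` J \<and>
        0 \<le> t \<and> t \<le> 1 \<longrightarrow>
        op_fun f (complex_of_real t *\<^sub>C A + complex_of_real (1 - t) *\<^sub>C B)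
          \<le> complex_of_real t *\<^sub>C op_fun f A + complex_of_real (1 - t) *\<^sub>C op_fun f B)"

definition operator_concave_on ::
  "'l::complex_hilbert itself \<Rightarrow> real set \<Rightarrow> (real \<Rightarrow> real) \<Rightarrow> bool" where
  "operator_concave_on L J f \<longleftrightarrow> operator_convex_on L J (\<lambda>t. - f t)"

text \<open>Finite dimension over the reals and over the complex numbers are the same thing.\<close>

definition infinite_dimensional :: "'l::complex_hilbert itself \<Rightarrow> bool" where
  "infinite_dimensional (_ :: 'l itself) \<longleftrightarrow> (\<forall>S :: 'l set. finite S \<longrightarrow> span S \<noteq> UNIV)"

definition unital_positive_map ::
  "('h::complex_hilbert bop \<Rightarrow> 'k::complex_hilbert bop) \<Rightarrow> bool" where
  "unital_positive_map \<Phi> \<longleftrightarrow>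
     Vector_Spaces.linear scaleC scaleC \<Phi> \<and>
     (\<forall>T. positive_op T \<longrightarrow> positive_op (\<Phi> T)) \<and>
     \<Phi> 1 = 1"

end

theory Submission
  imports Defs "HOL-Computational_Algebra.Fundamental_Theorem_Algebra"
begin

text \<open>Put \<open>S = \<Phi>(A)\<close> and \<open>F = \<Phi>(f(A))\<close>. Kadison's inequality and Jensen's inequality for \<open>f\<^sup>2\<close> give
  \<open>F\<^sup>2 \<le> \<Phi>(f(A)\<^sup>2) \<le> f(S)\<^sup>2\<close>. Hence \<open>S F\<^sup>2 S \<le> (S f(S))\<^sup>2\<close> and \<open>(S f(S)\<^sup>-\<^sup>1)\<^sup>2 \<le> S F\<^sup>-\<^sup>2 S\<close>, and since the
  square root is operator monotone it remains to apply Jensen's inequality to \<open>t f(t)\<close> and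
  \<open>t / f(t)\<close>. A positive operator concave function on the half-line is operator monotone, so \<open>f\<close> and
  \<open>- 1 / f\<close> are operator monotone, whence by Hansen and Pedersen \<open>t f(t)\<close> is operator convex and
  \<open>t / f(t)\<close> operator concave. As \<open>\<Phi>\<close> acts on the commutative algebra generated by \<open>A\<close>, Jensen's
  inequality reduces to finite positive resolutions of the identity, and only finitely many vectors
  are involved at a time; this transports operator concavity from the given
  infinite-dimensional space to all others.\<close>

section \<open>Hilbert spaces and adjoints\<close>

text \<open>Concavity is given on one space, while \<open>\<Phi>\<close> acts between two others,
  possibly larger or zero. What can be transported is an inequality tested on vectors in the range
  of a projection \<open>P\<close>, comparing \<open>D\<close> with its block-diagonal part.
  \<open>pinching_concave\<close> also has two unlike sources: f^2 reaches it by averaging over the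
  reflection 2 P - 1, whereas - t f(t) and t / f(t) reach it directly from operator monotonicity,
  without their convexity or concavity ever being stated on the given space. As
  \<open>\<Phi>\<close> is merely positive, it can neither be dilated on the whole algebra nor be
  evaluated at spectral projections. Bernstein polynomials in \<open>A\<close> replace the spectral
  measure, and each finite resolution so obtained has a Naimark dilation to a diagonal operator. In
  the given space only the powers of the compressed operator on a single vector are reproduced, up
  to the degree of an approximating polynomial. A compression P D P may have 0 in its spectrum, so t
  f(t) and t / f(t) must extend continuously to 0, although f is controlled only on the open
  half-line.\<close>

lemma cinner_scaleC_left: "cinner (c *\<^sub>C x) y = cnj c * cinner x y"
  by (metis cinner_commute cinner_scaleC_right complex_cnj_mult)

lemma Re_cinner_self: "Re (cinner x x) = (norm x)\<^sup>2"
proof -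
  have "0 \<le> Re (cinner x x)"
    using norm_ge_zero[of x] unfolding norm_eq_sqrt_cinner by simp
  then show ?thesis by (simp add: norm_eq_sqrt_cinner)
qed

lemma cinner_self: "cinner x x = complex_of_real ((norm x)\<^sup>2)"
proof (rule complex_eqI)
  show "Im (cinner x x) = Im (complex_of_real ((norm x)\<^sup>2))"
    using arg_cong[OF cinner_commute[of x x], of Im] by simp
qed (simp add: Re_cinner_self)

lemma cinner_add_left: "cinner (x + y) z = cinner x z + cinner y z"
  by (metis cinner_add_right cinner_commute complex_cnj_add)

lemma norm_add_sq: "(norm (x + y))\<^sup>2 = (norm x)\<^sup>2 + (norm y)\<^sup>2 + 2 * Re (cinner x y)"
  for x y :: "'a::complex_hilbert"
proof -
  have "Re (cinner y x) = Re (cinner x y)"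
    by (subst cinner_commute) simp
  then show ?thesis
    by (simp add: Re_cinner_self[symmetric] cinner_add_left cinner_add_right)
qed

lemma cauchy_schwarz: "cmod (cinner x y) \<le> norm x * norm y"
proof (cases "y = 0")
  case True
  have "cinner x 0 = 0"
    using cinner_add_right[of x 0 0] by simp
  then show ?thesis by (simp add: True)
next
  case False
  define G where "G = (cmod (cinner x y))\<^sup>2"
  define t where "t = 1 / (norm y)\<^sup>2"
  \<comment> \<open>With this \<open>c\<close>, the vector x + c y is the component of
    \<open>x\<close> orthogonal to \<open>y\<close>; the conjugate appears because
    \<open>cinner\<close> is linear in its second argument.\<close>
  define c where "c = - complex_of_real t * cnj (cinner x y)"
  have "0 \<le> (norm (x + c *\<^sub>C y))\<^sup>2" by simp
  also have "\<dots> = (norm x)\<^sup>2 + (cmod c * norm y)\<^sup>2 + 2 * Re (c * cinner x y)"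
    by (simp add: norm_add_sq scaleC_bound cinner_scaleC_right)
  also have "c * cinner x y = complex_of_real (- t * G)"
    unfolding c_def G_def using complex_norm_square[of "cinner x y"]
    by (simp add: mult.commute mult.left_commute)
  also have "(cmod c * norm y)\<^sup>2 = t * G"
    using False by (simp add: c_def G_def t_def norm_mult norm_divide power_mult_distrib power_divide
        field_simps power2_eq_square)
  finally have "t * G \<le> (norm x)\<^sup>2" by (simp add: mult.commute)
  then have "G \<le> (norm x * norm y)\<^sup>2"
    using False by (simp add: t_def field_simps power_mult_distrib)
  then show ?thesis
    unfolding G_def by (rule power2_le_imp_le) simp
qed

text \<open>Bilinearity is meant over the reals, where conjugate linearity in the first argument is
  no obstacle. The interpretation supplies limits and finite sums in both arguments.\<close>

interpretation cinner: bounded_bilinear cinner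
proof
  show "cinner (a + a') b = cinner a b + cinner a' b" for a a' b :: 'a
    by (rule cinner_add_left)
  show "cinner a (b + b') = cinner a b + cinner a b'" for a b b' :: 'a
    by (rule cinner_add_right)
  show "cinner (r *\<^sub>R a) b = r *\<^sub>R cinner a b" for r and a b :: 'a
    by (simp add: scaleR_eq_scaleC cinner_scaleC_left scaleR_conv_of_real)
  show "cinner a (r *\<^sub>R b) = r *\<^sub>R cinner a b" for r and a b :: 'a
    by (simp add: scaleR_eq_scaleC cinner_scaleC_right scaleR_conv_of_real)
  show "\<exists>K. \<forall>a b. cmod (cinner (a::'a) b) \<le> norm a * norm b * K"
    by (rule exI[of _ 1]) (simp add: cauchy_schwarz)
qed

lemma Re_cinner_commute: "Re (cinner x y) = Re (cinner y x)"
  by (subst cinner_commute) simp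

lemma Re_cinner_le: "Re (cinner x y) \<le> norm x * norm y"
  using cauchy_schwarz[of x y] complex_Re_le_cmod order_trans by blast

lemma cinner_ext: "(\<And>y. cinner x y = cinner x' y) \<Longrightarrow> x = x'"
  using cinner_self[of "x - x'"] by (simp add: cinner.diff_left)

lemma bounded_linear_bop_apply: "bounded_linear (bop_apply T)"
  using bop_apply by blast

lemma bop_scaleC: "bop_apply T (c *\<^sub>C x) = c *\<^sub>C bop_apply T x"
  using bop_apply by blast

lemmas bop_linear = bounded_linear.linear[OF bounded_linear_bop_apply]
lemmas bop_add = linear_add[OF bop_linear]
  and bop_diff = linear_diff[OF bop_linear]
  and bop_zero = linear_0[OF bop_linear]
  and bop_minus = linear_neg[OF bop_linear]
  and bop_sum = linear_sum[OF bop_linear]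

lemma bop_simps [simp]:
  "bop_apply 0 x = 0" "bop_apply 1 x = x" "bop_apply (S + T) x = bop_apply S x + bop_apply T x"
  "bop_apply (- T) x = - bop_apply T x" "bop_apply (S - T) x = bop_apply S x - bop_apply T x"
  "bop_apply (S * T) x = bop_apply S (bop_apply T x)" "bop_apply (c *\<^sub>C T) x = c *\<^sub>C bop_apply T x"
  by (transfer; simp)+

lemma bop_ext: "(\<And>x. bop_apply S x = bop_apply T x) \<Longrightarrow> S = T"
  by (simp add: bop_apply_inject[symmetric] fun_eq_iff)

lemma bop_apply_sum: "bop_apply (sum T I) x = (\<Sum>i\<in>I. bop_apply (T i) x)"
  by (induction I rule: infinite_finite_induct) auto

lemma bop_apply_Bop:
  assumes "\<And>x y. T (x + y) = T x + T y" "\<And>c x. T (c *\<^sub>C x) = c *\<^sub>C T x"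
    and "\<And>x. norm (T x) \<le> K * norm x"
  shows "bop_apply (Bop T) = T"
proof -
  have "bounded_linear T"
    using assms by (intro bounded_linear_intro[where K = K]) (auto simp: scaleR_eq_scaleC mult.commute)
  then show ?thesis using assms by (intro Bop_inverse) auto
qed

text \<open>The representing vector is the minimum of \<open>norm x ^ 2 - 2 * Re (\<phi> x)\<close>; by the parallelogram
  identity every minimising sequence is Cauchy.\<close>

lemma riesz_representation:
  fixes \<phi> :: "'a::complex_hilbert \<Rightarrow> complex"
  assumes bl: "bounded_linear \<phi>" and sc: "\<And>c x. \<phi> (c *\<^sub>C x) = c * \<phi> x"
  shows "\<exists>y. \<forall>x. \<phi> x = cinner y x"
proof -
  interpret bounded_linear \<phi> by fact
  define J where "J x = (norm x)\<^sup>2 - 2 * Re (\<phi> x)" for x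
  obtain K where K: "\<And>x. cmod (\<phi> x) \<le> norm x * K" using bounded by blast
  have "- K\<^sup>2 \<le> J x" for x
  proof -
    have "Re (\<phi> x) \<le> norm x * K" using K[of x] complex_Re_le_cmod[of "\<phi> x"] by linarith
    moreover have "0 \<le> (norm x - K)\<^sup>2" by simp
    ultimately show ?thesis by (simp add: J_def power2_diff)
  qed
  then have bdd: "bdd_below (range J)" by (meson bdd_belowI2)
  define I where "I = (INF x. J x)"
  have I: "I \<le> J x" for x unfolding I_def using bdd by (simp add: cINF_lower)
  have "\<exists>x. J x < I + 1 / real (Suc n)" for n
  proof -
    have "Inf (range J) < I + 1 / real (Suc n)" unfolding I_def by simp
    from cInf_lessD[OF _ this] show ?thesis by auto
  qed
  then obtain a where a: "\<And>n. J (a n) < I + 1 / real (Suc n)" by metis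
  have par: "(norm (x - y))\<^sup>2 \<le> 2 * (J x - I) + 2 * (J y - I)" for x y
  proof -
    have "J ((1/2) *\<^sub>R (x + y)) = (norm (x + y))\<^sup>2 / 4 - Re (\<phi> x) - Re (\<phi> y)"
      proof -
      have "norm ((1/2) *\<^sub>R (x + y)) = norm (x + y) / 2" by (simp only: norm_scaleR, simp?)
      moreover have "Re (\<phi> ((1/2) *\<^sub>R (x + y))) = (Re (\<phi> x) + Re (\<phi> y)) / 2" by (simp only: scaleR add, simp?)
      ultimately show ?thesis unfolding J_def by (simp only: power_divide) (simp add: field_simps)
    qed
    moreover have "(norm (x + y))\<^sup>2 + (norm (x - y))\<^sup>2 = 2 * (norm x)\<^sup>2 + 2 * (norm y)\<^sup>2"
      using norm_add_sq[of x y] norm_add_sq[of x "- y"] by (simp add: cinner.minus_right)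
    ultimately have "(norm (x - y))\<^sup>2 = 2 * J x + 2 * J y - 4 * J ((1/2) *\<^sub>R (x + y))"
      unfolding J_def by (simp add: algebra_simps)
    also have "\<dots> \<le> 2 * J x + 2 * J y - 4 * I"
      by (intro diff_left_mono mult_left_mono I) simp
    finally show ?thesis by simp
  qed
  have "Cauchy a"
  proof (rule metric_CauchyI)
    fix e :: real assume "0 < e"
    then obtain N where N: "1 / real (Suc N) < e\<^sup>2 / 4"
      using reals_Archimedean[of "e\<^sup>2 / 4"] by (auto simp: inverse_eq_divide)
    have small: "J (a n) - I < e\<^sup>2 / 4" if "N \<le> n" for n
    proof -
      have "1 / real (Suc n) \<le> 1 / real (Suc N)" using that by (intro divide_left_mono) auto
      with a[of n] N show ?thesis by linarith
    qed
    have "dist (a m) (a n) < e" if "N \<le> m" "N \<le> n" for m n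
    proof (rule power2_less_imp_less)
      show "(dist (a m) (a n))\<^sup>2 < e\<^sup>2"
      proof -
        have "(dist (a m) (a n))\<^sup>2 \<le> 2 * (J (a m) - I) + 2 * (J (a n) - I)"
          unfolding dist_norm by (rule par)
        also have "\<dots> < 2 * (e\<^sup>2 / 4) + 2 * (e\<^sup>2 / 4)"
          by (intro add_strict_mono mult_strict_left_mono small that) auto
        finally show ?thesis by simp
      qed
    qed (use \<open>0 < e\<close> in simp)
    then show "\<exists>M. \<forall>m\<ge>M. \<forall>n\<ge>M. dist (a m) (a n) < e" by blast
  qed
  then obtain y where y: "a \<longlonglongrightarrow> y" by (meson Cauchy_convergent convergent_def)
  have "(\<lambda>n. J (a n)) \<longlonglongrightarrow> J y"
    unfolding J_def by (intro tendsto_intros y tendsto)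
  moreover have "(\<lambda>n. I + 1 / real (Suc n)) \<longlonglongrightarrow> I + 0"
    by (intro tendsto_add tendsto_const LIMSEQ_Suc lim_1_over_n)
  ultimately have "J y \<le> I + 0"
    by (rule LIMSEQ_le) (use a less_imp_le in blast)
  then have min: "J y \<le> J x" for x using I[of x] by simp
  have "Re (\<phi> x) = Re (cinner y x)" for x
  proof -
    define d where "d = Re (cinner y x) - Re (\<phi> x)"
    have "0 \<le> t * (t * (norm x)\<^sup>2 + 2 * d)" for t :: real
      using min[of "y + t *\<^sub>R x"] norm_add_sq[of y "t *\<^sub>R x"]
      by (simp add: J_def add scaleR cinner.scaleR_right d_def algebra_simps power_mult_distrib power2_eq_square)
    note q = this
    have "d = 0"
    proof (rule ccontr)
      assume "d \<noteq> 0"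
      \<comment> \<open>The minimiser of the quadratic is - d / (norm x)^2; the added 1 keeps the
        denominator positive when \<open>x\<close> is zero and still leaves a negative
        value.\<close>
      define t where "t = - d / ((norm x)\<^sup>2 + 1)"
      have "t * (t * (norm x)\<^sup>2 + 2 * d) = - (d\<^sup>2 * ((norm x)\<^sup>2 + 2)) / ((norm x)\<^sup>2 + 1)\<^sup>2"
      proof -
        have p: "(norm x)\<^sup>2 + 1 > 0" by (simp add: add_nonneg_pos)
        define s where "s = (norm x)\<^sup>2 + 1"
        have sx: "(norm x)\<^sup>2 = s - 1" by (simp add: s_def)
        have "s \<noteq> 0" using p s_def by simp
        then show ?thesis unfolding t_def sx
          by (simp add: field_simps power2_eq_square)
      qed
      also have "\<dots> < 0"
        using \<open>d \<noteq> 0\<close> less_imp_neq[OF add_nonneg_pos[OF zero_le_power2[of "norm x"] zero_less_one]]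
        by (intro divide_neg_pos) (auto simp: add_nonneg_pos intro!: mult_pos_pos)
      finally show False using q[of t] by simp
    qed
    then show ?thesis by (simp add: d_def)
  qed
  note re = this
  have "\<phi> x = cinner y x" for x
  proof (rule complex_eqI)
    show "Re (\<phi> x) = Re (cinner y x)" by (rule re)
    show "Im (\<phi> x) = Im (cinner y x)"
      using re[of "\<i> *\<^sub>C x"] by (simp add: sc cinner_scaleC_right)
  qed
  then show ?thesis by blast
qed

section \<open>Adjoints\<close>

lemma bop_bounded: "\<exists>K\<ge>0. \<forall>x. norm (bop_apply T x) \<le> K * norm x"
  using bounded_linear.nonneg_bounded[OF bounded_linear_bop_apply[of T]] by (metis mult.commute)

text \<open>Riesz representation is applied to y \<mapsto> <x, T y> for each \<open>x\<close>. The
  representing map is bounded since |S x|^2 = <x, T (S x)> \<le> K |x| |S x|. Together with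
  uniqueness this gives the description in \<open>adj\<close> a meaning.\<close>

lemma adj_exists: "\<exists>S. \<forall>x y. cinner (bop_apply S x) y = cinner x (bop_apply T y)"
proof -
  have "\<exists>z. \<forall>y. cinner x (bop_apply T y) = cinner z y" for x
  proof (rule riesz_representation)
    show "bounded_linear (\<lambda>y. cinner x (bop_apply T y))"
      by (rule bounded_linear_compose[OF cinner.bounded_linear_right bounded_linear_bop_apply])
  qed (simp add: bop_scaleC cinner_scaleC_right)
  then obtain S where S: "\<And>x y. cinner x (bop_apply T y) = cinner (S x) y" by metis
  obtain K where K: "0 \<le> K" "\<And>x. norm (bop_apply T x) \<le> K * norm x" using bop_bounded by blast
  have "bop_apply (Bop S) = S"
  proof (rule bop_apply_Bop)
    show "S (x + y) = S x + S y" for x y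
      by (rule cinner_ext) (simp add: S[symmetric] cinner_add_left)
    show "S (c *\<^sub>C x) = c *\<^sub>C S x" for c x
      by (rule cinner_ext) (simp add: S[symmetric] cinner_scaleC_left)
    show "norm (S x) \<le> K * norm x" for x
    proof (cases "norm (S x) = 0")
      case False
      have "(norm (S x))\<^sup>2 = Re (cinner x (bop_apply T (S x)))" by (simp add: S Re_cinner_self)
      also have "\<dots> \<le> norm x * norm (bop_apply T (S x))" by (rule Re_cinner_le)
      also have "\<dots> \<le> norm x * (K * norm (S x))" using K by (simp add: mult_left_mono)
      finally show ?thesis using False by (simp add: power2_eq_square mult.commute mult.left_commute)
    qed (use K in simp)
  qed
  then show ?thesis by (intro exI[of _ "Bop S"]) (simp add: S)
qed

lemma adj_eqI: "(\<And>x y. cinner (bop_apply S x) y = cinner x (bop_apply T y)) \<Longrightarrow> adj T = S"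
  unfolding adj_def
proof (rule the_equality)
  fix S' assume S: "\<And>x y. cinner (bop_apply S x) y = cinner x (bop_apply T y)"
    and S': "\<forall>x y. cinner (bop_apply S' x) y = cinner x (bop_apply T y)"
  show "S' = S"
    by (rule bop_ext, rule cinner_ext) (simp add: S S')
qed simp

lemma cinner_adj_left: "cinner (bop_apply (adj T) x) y = cinner x (bop_apply T y)"
proof -
  obtain S where S: "\<And>x y. cinner (bop_apply S x) y = cinner x (bop_apply T y)"
    using adj_exists by blast
  show ?thesis by (simp add: adj_eqI[of S T, OF S] S)
qed

lemma cinner_adj_right: "cinner x (bop_apply (adj T) y) = cinner (bop_apply T x) y"
  by (metis cinner_adj_left cinner_commute)

lemma adj_simps [simp]:
  "adj (adj T) = T" "adj 0 = 0" "adj 1 = 1" "adj (S + T) = adj S + adj T" "adj (S - T) = adj S - adj T"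
  "adj (- T) = - adj T" "adj (S * T) = adj T * adj S" "adj (c *\<^sub>C T) = cnj c *\<^sub>C adj T"
  by (rule adj_eqI; simp add: cinner_adj_left cinner_adj_right cinner_add_left cinner_add_right
      cinner.diff_left cinner.diff_right cinner.minus_left cinner.minus_right cinner.zero_left cinner.zero_right
      cinner_scaleC_left cinner_scaleC_right)+

lemma self_adjoint_iff:
  "self_adjoint T \<longleftrightarrow> (\<forall>x y. cinner (bop_apply T x) y = cinner x (bop_apply T y))"
  unfolding self_adjoint_def by (metis adj_eqI cinner_adj_left)

lemma self_adjointD: "self_adjoint T \<Longrightarrow> cinner (bop_apply T x) y = cinner x (bop_apply T y)"
  by (simp add: self_adjoint_iff)

lemma self_adjoint_intros [intro, simp]:
  "self_adjoint 0" "self_adjoint 1" "self_adjoint S \<Longrightarrow> self_adjoint T \<Longrightarrow> self_adjoint (S + T)"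
  "self_adjoint S \<Longrightarrow> self_adjoint T \<Longrightarrow> self_adjoint (S - T)" "self_adjoint T \<Longrightarrow> self_adjoint (- T)"
  "self_adjoint T \<Longrightarrow> self_adjoint (complex_of_real r *\<^sub>C T)"
  by (simp_all add: self_adjoint_def)

lemma self_adjoint_adj_mult: "self_adjoint (adj T * T)"
  by (simp add: self_adjoint_def)

lemma self_adjoint_sandwich: "self_adjoint T \<Longrightarrow> self_adjoint (adj X * T * X)"
  by (simp add: self_adjoint_def mult.assoc)

lemma scaleC_mult_bop [simp]:
  "(c *\<^sub>C S) * T = c *\<^sub>C (S * T)" "S * (c *\<^sub>C T) = c *\<^sub>C (S * T)" for S T :: "'a::complex_hilbert bop"
  by (auto intro!: bop_ext simp: bop_scaleC)

lemma scaleC_simps [simp]: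
  "0 *\<^sub>C x = 0" "1 *\<^sub>C x = x" "c *\<^sub>C (0::'a::complex_vector) = 0" "c *\<^sub>C d *\<^sub>C x = (c * d) *\<^sub>C x"
  for x :: "'a::complex_vector"
  using scaleC_add_left[of 0 0 x] by (simp_all add: scaleC_one scaleC_zero_right scaleC_scaleC)

lemma scaleC_minus_left: "(- c) *\<^sub>C x = - (c *\<^sub>C x)" for x :: "'a::complex_vector"
  using scaleC_add_left[of c "- c" x] by (simp add: eq_neg_iff_add_eq_0 add.commute)

lemma scaleC_diff_left: "(c - d) *\<^sub>C x = c *\<^sub>C x - d *\<^sub>C x" for x :: "'a::complex_vector"
  using scaleC_add_left[of c "- d" x] by (simp add: scaleC_minus_left)

lemma scaleC_diff_right: "c *\<^sub>C (x - y) = c *\<^sub>C x - c *\<^sub>C y" for x :: "'a::complex_vector"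
  using scaleC_add_right[of c x "- y"] by (simp add: scaleC_minus_right)

lemma scaleC_sum_right: "c *\<^sub>C (\<Sum>i\<in>I. T i) = (\<Sum>i\<in>I. c *\<^sub>C T i)"
  for T :: "'i \<Rightarrow> 'a::complex_vector"
  by (induction I rule: infinite_finite_induct) (auto simp: scaleC_add_right)

section \<open>The normed algebra of bounded operators\<close>

instantiation bop :: (complex_hilbert) real_normed_algebra
begin

definition norm_bop :: "'a bop \<Rightarrow> real" where "norm_bop T = onorm (bop_apply T)"
definition scaleR_bop :: "real \<Rightarrow> 'a bop \<Rightarrow> 'a bop" where "scaleR_bop r T = complex_of_real r *\<^sub>C T"
definition sgn_bop :: "'a bop \<Rightarrow> 'a bop" where "sgn_bop T = inverse (norm T) *\<^sub>R T"
definition dist_bop :: "'a bop \<Rightarrow> 'a bop \<Rightarrow> real" where "dist_bop S T = norm (S - T)"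
definition uniformity_bop :: "('a bop \<times> 'a bop) filter" where
  "uniformity_bop = (INF e\<in>{0<..}. principal {(S, T). dist S T < e})"
definition open_bop :: "'a bop set \<Rightarrow> bool" where
  "open_bop U \<longleftrightarrow> (\<forall>S\<in>U. \<forall>\<^sub>F (S', T) in uniformity. S' = S \<longrightarrow> T \<in> U)"

instance
proof
  fix S T U :: "'a bop" and r s :: real
  show "r *\<^sub>R (S + T) = r *\<^sub>R S + r *\<^sub>R T" "(r + s) *\<^sub>R S = r *\<^sub>R S + s *\<^sub>R S"
    "r *\<^sub>R s *\<^sub>R S = (r * s) *\<^sub>R S" "1 *\<^sub>R S = S"
    "r *\<^sub>R S * T = r *\<^sub>R (S * T)" "S * r *\<^sub>R T = r *\<^sub>R (S * T)"
    by (simp_all add: scaleR_bop_def scaleC_add_right scaleC_add_left)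
  show "sgn S = inverse (norm S) *\<^sub>R S" by (rule sgn_bop_def)
  show "dist S T = norm (S - T)" by (rule dist_bop_def)
  show "uniformity = (INF e\<in>{0<..}. principal {(S, T::'a bop). dist S T < e})"
    by (rule uniformity_bop_def)
  show "open X \<longleftrightarrow> (\<forall>S\<in>X. \<forall>\<^sub>F (S', T) in uniformity. S' = S \<longrightarrow> T \<in> X)" for X :: "'a bop set"
    by (rule open_bop_def)
  show "norm S = 0 \<longleftrightarrow> S = 0"
    unfolding norm_bop_def onorm_eq_0[OF bounded_linear_bop_apply] by (auto intro: bop_ext)
  have "bop_apply (S + T) = (\<lambda>x. bop_apply S x + bop_apply T x)" by (simp add: fun_eq_iff)
  then show "norm (S + T) \<le> norm S + norm T"
    unfolding norm_bop_def using onorm_triangle[OF bounded_linear_bop_apply[of S] bounded_linear_bop_apply[of T]]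
    by simp
  have "bop_apply (r *\<^sub>R S) = (\<lambda>x. r *\<^sub>R bop_apply S x)"
    by (simp add: fun_eq_iff scaleR_bop_def scaleR_eq_scaleC)
  then show "norm (r *\<^sub>R S) = \<bar>r\<bar> * norm S"
    unfolding norm_bop_def using onorm_scaleR[OF bounded_linear_bop_apply[of S]] by simp
  have "bop_apply (S * T) = bop_apply S \<circ> bop_apply T" by (simp add: fun_eq_iff)
  then show "norm (S * T) \<le> norm S * norm T"
    unfolding norm_bop_def using onorm_compose[OF bounded_linear_bop_apply[of S] bounded_linear_bop_apply[of T]]
    by simp
qed

end

lemma norm_bop_apply: "norm (bop_apply T x) \<le> norm T * norm x"
  unfolding norm_bop_def by (rule onorm[OF bounded_linear_bop_apply])

lemma norm_bop_le: "(\<And>x. norm (bop_apply T x) \<le> c * norm x) \<Longrightarrow> 0 \<le> c \<Longrightarrow> norm T \<le> c"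
  unfolding norm_bop_def by (rule onorm_bound)

text \<open>Only an inequality, because on the zero space the identity is 0.\<close>

lemma norm_one_bop_le: "norm (1::'a::complex_hilbert bop) \<le> 1"
  by (rule norm_bop_le) auto

lemma norm_scaleC_bop: "norm (c *\<^sub>C T) = cmod c * norm T" for T :: "'a::complex_hilbert bop"
proof (rule antisym)
  have *: "norm (d *\<^sub>C S) \<le> cmod d * norm S" for d and S :: "'a bop"
    by (rule norm_bop_le)
      (auto simp: scaleC_bound mult.assoc intro!: mult_left_mono norm_bop_apply)
  show "norm (c *\<^sub>C T) \<le> cmod c * norm T" by (rule *)
  show "cmod c * norm T \<le> norm (c *\<^sub>C T)"
    using *[of "inverse c" "c *\<^sub>C T"] by (cases "c = 0") (auto simp: norm_divide field_simps)
qed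

lemma norm_power_bop_le: "norm (T ^ n) \<le> norm T ^ n" for T :: "'a::complex_hilbert bop"
  by (induction n) (auto simp: norm_one_bop_le intro: order_trans[OF norm_mult_ineq mult_left_mono])

interpretation bop_apply: bounded_bilinear bop_apply
proof
  show "\<exists>K. \<forall>T x. norm (bop_apply T (x::'a)) \<le> norm T * norm x * K"
    by (rule exI[of _ 1]) (simp add: norm_bop_apply)
qed (auto simp: bop_add scaleR_bop_def scaleR_eq_scaleC bop_scaleC)

text \<open>The limit is formed pointwise. Letting m tend to infinity in the Cauchy estimate for a
  fixed vector gives a bound uniform over vectors, hence convergence in norm.\<close>

instance bop :: (complex_hilbert) banach
proof
  fix X :: "nat \<Rightarrow> 'a bop"
  assume "Cauchy X"
  have cau: "Cauchy (\<lambda>n. bop_apply (X n) x)" for x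
    using \<open>Cauchy X\<close> by (rule bounded_linear.Cauchy[OF bop_apply.bounded_linear_left])
  define Y where "Y x = lim (\<lambda>n. bop_apply (X n) x)" for x
  have Y: "(\<lambda>n. bop_apply (X n) x) \<longlonglongrightarrow> Y x" for x
    unfolding Y_def using cau Cauchy_convergent convergent_LIMSEQ_iff by blast
  obtain K where K: "\<And>n. norm (X n) \<le> K"
    using Cauchy_Bseq[OF \<open>Cauchy X\<close>] unfolding Bseq_def by blast
  have "bop_apply (Bop Y) = Y"
  proof (rule bop_apply_Bop)
    show "Y (x + y) = Y x + Y y" for x y
      using tendsto_add[OF Y[of x] Y[of y]] Y[of "x + y"] by (simp add: bop_add LIMSEQ_unique)
    show "Y (c *\<^sub>C x) = c *\<^sub>C Y x" for c x
      using bounded_linear.tendsto[OF bounded_linear_scaleC Y[of x]] Y[of "c *\<^sub>C x"]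
      by (simp add: bop_scaleC LIMSEQ_unique)
    show "norm (Y x) \<le> K * norm x" for x
      by (rule LIMSEQ_le_const2[OF tendsto_norm[OF Y]])
        (meson K mult_right_mono norm_bop_apply norm_ge_zero order_trans)
  qed
  then have Y': "bop_apply (Bop Y) x = Y x" for x by simp
  have "X \<longlonglongrightarrow> Bop Y"
  proof (rule metric_LIMSEQ_I)
    fix e :: real assume "0 < e"
    then obtain N where N: "\<And>m n. N \<le> m \<Longrightarrow> N \<le> n \<Longrightarrow> dist (X m) (X n) < e / 2"
      using metric_CauchyD[OF \<open>Cauchy X\<close>, of "e / 2"] by auto
    have "norm (X n - Bop Y) \<le> e / 2" if "N \<le> n" for n
    proof (rule norm_bop_le)
      fix x
      have "(\<lambda>m. norm (bop_apply (X n) x - bop_apply (X m) x)) \<longlonglongrightarrow> norm (bop_apply (X n) x - Y x)"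
        by (intro tendsto_intros Y)
      then have "norm (bop_apply (X n) x - Y x) \<le> e / 2 * norm x"
      proof (rule LIMSEQ_le_const2)
        have "norm (bop_apply (X n) x - bop_apply (X m) x) \<le> e / 2 * norm x" if "N \<le> m" for m
        proof -
          have "norm (bop_apply (X n - X m) x) \<le> norm (X n - X m) * norm x" by (rule norm_bop_apply)
          also have "\<dots> \<le> e / 2 * norm x"
            using N[OF \<open>N \<le> n\<close> that] by (intro mult_right_mono) (auto simp: dist_norm)
          finally show ?thesis by simp
        qed
        then show "\<exists>M. \<forall>m\<ge>M. norm (bop_apply (X n) x - bop_apply (X m) x) \<le> e / 2 * norm x" by blast
      qed
      then show "norm (bop_apply (X n - Bop Y) x) \<le> e / 2 * norm x" by (simp add: Y')
    qed (use \<open>0 < e\<close> in simp)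
    then have "\<forall>n\<ge>N. dist (X n) (Bop Y) < e" using \<open>0 < e\<close> unfolding dist_norm by fastforce
    then show "\<exists>N. \<forall>n\<ge>N. dist (X n) (Bop Y) < e" by blast
  qed
  then show "convergent X" by (auto simp: convergent_def)
qed

section \<open>The Loewner order\<close>

lemma positive_opD: "positive_op T \<Longrightarrow> self_adjoint T" "positive_op T \<Longrightarrow> 0 \<le> Re (cinner x (bop_apply T x))"
  by (simp_all add: positive_op_def)

lemma positive_op_adj_mult: "positive_op (adj X * X)"
  by (simp add: positive_op_def self_adjoint_adj_mult cinner_adj_right Re_cinner_self)

lemma positive_op_sandwich: "positive_op T \<Longrightarrow> positive_op (adj X * T * X)"
  by (simp add: positive_op_def self_adjoint_sandwich cinner_adj_right)

lemma positive_op_add: "positive_op S \<Longrightarrow> positive_op T \<Longrightarrow> positive_op (S + T)"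
  by (simp add: positive_op_def cinner_add_right)

lemma positive_op_scale: "0 \<le> r \<Longrightarrow> positive_op T \<Longrightarrow> positive_op (complex_of_real r *\<^sub>C T)"
  by (simp add: positive_op_def cinner_scaleC_right)

lemma positive_op_const: "0 \<le> r \<Longrightarrow> positive_op (complex_of_real r *\<^sub>C 1)"
  by (intro positive_op_scale) (simp_all add: positive_op_def Re_cinner_self)

lemma norm_bop_le_square:
  assumes "self_adjoint B" "0 \<le> c" "positive_op (complex_of_real (c\<^sup>2) *\<^sub>C 1 - B * B)"
  shows "norm B \<le> c"
proof (rule norm_bop_le[OF _ \<open>0 \<le> c\<close>])
  fix x
  have "0 \<le> Re (cinner x (bop_apply (complex_of_real (c\<^sup>2) *\<^sub>C 1 - B * B) x))"
    by (rule positive_opD[OF assms(3)])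
  also have "\<dots> = c\<^sup>2 * (norm x)\<^sup>2 - (norm (bop_apply B x))\<^sup>2"
    using self_adjointD[OF assms(1), of x "bop_apply B x"]
    by (simp add: cinner.diff_right cinner_scaleC_right Re_cinner_self[symmetric])
  finally have "(norm (bop_apply B x))\<^sup>2 \<le> (c * norm x)\<^sup>2" by (simp add: power_mult_distrib)
  then show "norm (bop_apply B x) \<le> c * norm x" by (rule power2_le_imp_le) (simp add: assms)
qed

text \<open>\<open>2 c (c\<^sup>2 - B\<^sup>2) = (c - B) (c + B) (c - B) + (c + B) (c - B) (c + B)\<close> with \<open>c > 0\<close>.\<close>

lemma norm_bop_le_order:
  assumes "positive_op (complex_of_real c *\<^sub>C 1 - B)" "positive_op (complex_of_real c *\<^sub>C 1 + B)" "0 < c"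
  shows "norm B \<le> c"
proof (rule norm_bop_le_square)
  define P where "P = complex_of_real c *\<^sub>C 1 - B"
  define Q where "Q = complex_of_real c *\<^sub>C 1 + B"
  have sa: "adj P = P" "adj Q = Q"
    using positive_opD(1)[OF assms(1)] positive_opD(1)[OF assms(2)] by (simp_all add: P_def Q_def self_adjoint_def)
  show B: "self_adjoint B"
    using self_adjoint_intros(4)[OF self_adjoint_intros(6)[OF self_adjoint_intros(2)] positive_opD(1)[OF assms(1)]]
    by (metis add_diff_cancel_left' add_uminus_conv_diff diff_add_cancel)
  have "positive_op (adj P * Q * P + adj Q * P * Q)"
    using assms by (intro positive_op_add positive_op_sandwich) (auto simp: P_def Q_def)
  then have pos: "positive_op (complex_of_real (1 / (2 * c)) *\<^sub>C (P * Q * P + Q * P * Q))"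
    using \<open>0 < c\<close> by (intro positive_op_scale) (auto simp: sa)
  have 1: "P * Q * P + Q * P * Q = (P + Q) * (P * Q)"
    by (simp add: P_def Q_def algebra_simps scaleC_add_right scaleC_diff_right)
  have 2: "P * Q = complex_of_real (c\<^sup>2) *\<^sub>C 1 - B * B"
    by (simp add: P_def Q_def algebra_simps scaleC_add_right scaleC_diff_right power2_eq_square)
  have 3: "P + Q = complex_of_real (2 * c) *\<^sub>C 1"
    using scaleC_add_left[of "complex_of_real c" "complex_of_real c" "1::'a bop"] by (simp add: P_def Q_def)
  show "positive_op (complex_of_real (c\<^sup>2) *\<^sub>C 1 - B * B)"
    using pos \<open>0 < c\<close> unfolding 1 unfolding 2 3 by simp
qed (use assms in simp)

text \<open>Antisymmetry is the substantial law: if both inequalities hold, then e + (A - B) and e -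
  (A - B) are positive for every e > 0, so the norm of A - B is at most e.\<close>

instantiation bop :: (complex_hilbert) ordered_ab_group_add
begin

instance
proof
  fix A B C :: "'a bop"
  have *: "A = B" if "A \<le> B" "B \<le> A" for A B :: "'a bop"
  proof -
    have small: "norm (A - B) \<le> e" if "0 < e" for e
    proof (rule norm_bop_le_order[OF _ _ that])
      show "positive_op (complex_of_real e *\<^sub>C 1 - (A - B))"
        using positive_op_add[OF positive_op_const[of e] \<open>A \<le> B\<close>[unfolded less_eq_bop_def]] that
        by (simp add: algebra_simps)
      show "positive_op (complex_of_real e *\<^sub>C 1 + (A - B))"
        using positive_op_add[OF positive_op_const[of e] \<open>B \<le> A\<close>[unfolded less_eq_bop_def]] that
        by (simp add: algebra_simps)
    qed
    have "norm (A - B) \<le> 0" by (rule field_le_epsilon) (simp add: small)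
    then show "A = B" by simp
  qed
  show "A \<le> A" by (simp add: less_eq_bop_def positive_op_def cinner.zero_right)
  show "A \<le> B \<Longrightarrow> B \<le> A \<Longrightarrow> A = B" by (rule *)
  then show "A < B \<longleftrightarrow> A \<le> B \<and> \<not> B \<le> A" unfolding less_bop_def using * \<open>A \<le> A\<close> by blast
  show "A \<le> B \<Longrightarrow> B \<le> C \<Longrightarrow> A \<le> C"
    unfolding less_eq_bop_def using positive_op_add[of "B - A" "C - B"] by simp
  show "A \<le> B \<Longrightarrow> C + A \<le> C + B" by (simp add: less_eq_bop_def)
qed

end

lemma positive_op_iff: "positive_op T \<longleftrightarrow> 0 \<le> T"
  by (simp add: less_eq_bop_def)

lemma bop_leI:
  assumes "self_adjoint S" "self_adjoint T"
    and "\<And>x. Re (cinner x (bop_apply S x)) \<le> Re (cinner x (bop_apply T x))"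
  shows "S \<le> T"
  using assms by (simp add: less_eq_bop_def positive_op_def cinner.diff_right)

lemma bop_leD: "S \<le> T \<Longrightarrow> Re (cinner x (bop_apply S x)) \<le> Re (cinner x (bop_apply T x))"
  by (simp add: less_eq_bop_def positive_op_def cinner.diff_right)

lemma bop_nonneg_sa: "0 \<le> T \<Longrightarrow> self_adjoint T"
  by (simp add: less_eq_bop_def positive_op_def)

abbreviation cst :: "real \<Rightarrow> 'a::complex_hilbert bop" where
  "cst r \<equiv> complex_of_real r *\<^sub>C 1"

lemma cst_le_iff_form:
  assumes "self_adjoint T"
  shows "cst m \<le> T \<longleftrightarrow> (\<forall>x. m * (norm x)\<^sup>2 \<le> Re (cinner x (bop_apply T x)))"
    and "T \<le> cst m \<longleftrightarrow> (\<forall>x. Re (cinner x (bop_apply T x)) \<le> m * (norm x)\<^sup>2)"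
  using assms by (simp_all add: less_eq_bop_def positive_op_def cinner.diff_right cinner_scaleC_right Re_cinner_self)

lemma cst_le_sa: "cst m \<le> T \<Longrightarrow> self_adjoint T" "T \<le> cst m \<Longrightarrow> self_adjoint T"
proof -
  assume "cst m \<le> T"
  then have "self_adjoint ((T - cst m) + cst m)"
    by (intro self_adjoint_intros(2,3,6)) (simp add: less_eq_bop_def positive_op_def)
  then show "self_adjoint T" by simp
next
  assume "T \<le> cst m"
  then have "self_adjoint (cst m - T)" by (simp add: less_eq_bop_def positive_op_def)
  then have "self_adjoint (cst m - (cst m - T))"
    by (rule self_adjoint_intros(4)[OF self_adjoint_intros(6)[OF self_adjoint_intros(2)]])
  then show "self_adjoint T" by simp
qed

lemma bop_sandwich_mono: "S \<le> T \<Longrightarrow> adj X * S * X \<le> adj X * T * X"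
  unfolding less_eq_bop_def using positive_op_sandwich[of "T - S" X] by (simp add: algebra_simps)

lemma scale_bop_mono: "S \<le> T \<Longrightarrow> 0 \<le> r \<Longrightarrow> complex_of_real r *\<^sub>C S \<le> complex_of_real r *\<^sub>C T"
  for S T :: "'a::complex_hilbert bop"
  unfolding less_eq_bop_def using positive_op_scale[of r "T - S"] by (simp add: scaleC_diff_right)

lemma cst_mono: "r \<le> s \<Longrightarrow> cst r \<le> cst s"
  unfolding less_eq_bop_def using positive_op_const[of "s - r"] by (simp add: scaleC_diff_left)

lemma norm_le_cst:
  assumes "self_adjoint T" "norm T \<le> c"
  shows "T \<le> cst c" "cst (- c) \<le> T"
proof -
  have *: "\<bar>Re (cinner x (bop_apply T x))\<bar> \<le> c * (norm x)\<^sup>2" for x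
  proof -
    have "\<bar>Re (cinner x (bop_apply T x))\<bar> \<le> cmod (cinner x (bop_apply T x))" by (rule abs_Re_le_cmod)
    also have "\<dots> \<le> norm x * norm (bop_apply T x)" by (rule cauchy_schwarz)
    also have "\<dots> \<le> norm x * (norm T * norm x)" by (intro mult_left_mono norm_bop_apply) simp
    also have "\<dots> \<le> norm x * (c * norm x)" by (intro mult_left_mono mult_right_mono assms) auto
    finally show ?thesis by (simp add: power2_eq_square mult_ac)
  qed
  show "T \<le> cst c" "cst (- c) \<le> T"
    unfolding cst_le_iff_form[OF assms(1)] using * abs_le_D1 abs_le_D2 by (auto, smt (verit) *)
qed

lemma norm_le_between:
  assumes "cst (- c) \<le> T" "T \<le> cst c" "0 \<le> c"
  shows "norm T \<le> c"
\<comment> \<open>\<open>norm_bop_le_order\<close> asks for a strictly positive bound, whereas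
  \<open>c\<close> may be 0 here.\<close>
proof (rule field_le_epsilon)
  fix e :: real assume "0 < e"
  show "norm T \<le> c + e"
  proof (rule norm_bop_le_order)
    have "T \<le> cst (c + e)" using assms(2) cst_mono[of c "c + e"] \<open>0 < e\<close> by (meson less_imp_le less_add_same_cancel1 order_trans)
    then show "positive_op (cst (c + e) - T)" by (simp add: less_eq_bop_def)
    have "cst (- (c + e)) \<le> T" using assms(1) cst_mono[of "- (c + e)" "- c"] \<open>0 < e\<close> by (meson less_imp_le less_add_same_cancel1 neg_le_iff_le order_trans)
    then have "positive_op (T - cst (- (c + e)))" by (simp add: less_eq_bop_def)
    also have "T - cst (- (c + e)) = cst (c + e) + T" by (simp only: of_real_minus scaleC_minus_left) simp
    finally show "positive_op (cst (c + e) + T)" .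
  qed (use assms \<open>0 < e\<close> in simp)
qed

lemma bop_le_tendsto:
  fixes S T :: "'a::complex_hilbert bop"
  assumes "X \<longlonglongrightarrow> S" "Y \<longlonglongrightarrow> T" "\<And>n. X n \<le> Y n"
  shows "S \<le> T"
proof -
  have lim: "(\<lambda>n. Y n - X n) \<longlonglongrightarrow> T - S" by (intro tendsto_intros assms)
  have lx: "(\<lambda>n. bop_apply (Y n - X n) x) \<longlonglongrightarrow> bop_apply (T - S) x" for x
    by (rule bop_apply.tendsto[OF lim tendsto_const])
  have sa: "self_adjoint (T - S)"
    unfolding self_adjoint_iff
  proof (intro allI)
    fix x y
    have "(\<lambda>n. cinner (bop_apply (Y n - X n) x) y) \<longlonglongrightarrow> cinner (bop_apply (T - S) x) y"
      by (intro cinner.tendsto lx tendsto_const)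
    moreover have "(\<lambda>n. cinner (bop_apply (Y n - X n) x) y) = (\<lambda>n. cinner x (bop_apply (Y n - X n) y))"
      using assms(3) by (intro ext self_adjointD) (simp add: less_eq_bop_def positive_op_def)
    moreover have "(\<lambda>n. cinner x (bop_apply (Y n - X n) y)) \<longlonglongrightarrow> cinner x (bop_apply (T - S) y)"
      by (intro cinner.tendsto lx tendsto_const)
    ultimately show "cinner (bop_apply (T - S) x) y = cinner x (bop_apply (T - S) y)"
      using LIMSEQ_unique by metis
  qed
  moreover have "0 \<le> Re (cinner x (bop_apply (T - S) x))" for x
  proof (rule LIMSEQ_le_const)
    show "(\<lambda>n. Re (cinner x (bop_apply (Y n - X n) x))) \<longlonglongrightarrow> Re (cinner x (bop_apply (T - S) x))"
      by (intro tendsto_Re cinner.tendsto lx tendsto_const)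
    show "\<exists>N. \<forall>n\<ge>N. 0 \<le> Re (cinner x (bop_apply (Y n - X n) x))"
      using assms(3) positive_opD(2) unfolding less_eq_bop_def by blast
  qed
  ultimately show ?thesis by (simp add: less_eq_bop_def positive_op_def)
qed

section \<open>Inverses and the spectrum\<close>

lemma inv_op_eqI:
  assumes "S * T = 1" "T * S = 1"
  shows "inv_op T = S"
  unfolding inv_op_def
proof (rule the_equality)
  fix S' assume "S' * T = 1 \<and> T * S' = 1"
  then have "S' * (T * S) = S" by (simp add: mult.assoc[symmetric])
  then show "S' = S" using assms by simp
qed (use assms in simp)

lemma inv_op:
  assumes "invertible_op T"
  shows "inv_op T * T = 1" "T * inv_op T = 1"
  using assms inv_op_eqI unfolding invertible_op_def by metis+

lemma invertible_op_mult: "invertible_op S \<Longrightarrow> invertible_op T \<Longrightarrow> invertible_op (S * T)"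
  unfolding invertible_op_def
proof clarify
  fix S' T' assume "S' * S = 1" "S * S' = 1" "T' * T = 1" "T * T' = 1"
  then have "(T' * S') * (S * T) = 1 \<and> (S * T) * (T' * S') = 1"
    by (metis mult.assoc mult.right_neutral)
  then show "\<exists>R. R * (S * T) = 1 \<and> S * T * R = 1" by blast
qed

text \<open>An inverse of a commuting product yields a left and a right inverse of the factor, and
  these coincide. It serves to pass from (T - z) (T - cnj z) to T - z.\<close>

lemma invertible_op_factor:
  assumes "invertible_op (S * T)" "S * T = T * S"
  shows "invertible_op S"
proof -
  obtain R where R: "R * (S * T) = 1" "(S * T) * R = 1" using assms(1) unfolding invertible_op_def by blast
  have "(R * T) * S = 1" using R(1) assms(2) by (simp add: mult.assoc)
  moreover have "S * (T * R) = 1" using R(2) by (simp add: mult.assoc)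
  moreover have "R * T = T * R"
    using calculation by (metis mult.assoc mult.left_neutral mult.right_neutral)
  ultimately show ?thesis unfolding invertible_op_def by metis
qed

lemma invertible_op_scale: "invertible_op T \<Longrightarrow> c \<noteq> 0 \<Longrightarrow> invertible_op (c *\<^sub>C T)"
  unfolding invertible_op_def by (elim exE, rule_tac x = "inverse c *\<^sub>C S" in exI) simp

text \<open>Neumann series; the telescoping identity is proved on both sides since the inverse must
  be two-sided.\<close>

lemma invertible_one_minus:
  assumes "norm B < 1"
  shows "invertible_op (1 - B)"
proof -
  have sm: "summable (\<lambda>n. B ^ n)"
    by (rule summable_comparison_test'[OF summable_geometric[of "norm B"]]) (use assms norm_power_bop_le in auto)
  define S where "S = (\<Sum>n. B ^ n)"
  have z: "(\<lambda>n. 1 - B ^ n) \<longlonglongrightarrow> 1 - 0"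
    by (intro tendsto_diff tendsto_const summable_LIMSEQ_zero sm)
  have lim: "(\<lambda>n. \<Sum>k<n. B ^ k) \<longlonglongrightarrow> S"
    unfolding S_def by (rule summable_LIMSEQ[OF sm])
  have tel: "(1 - B) * (\<Sum>k<n. B ^ k) = 1 - B ^ n" "(\<Sum>k<n. B ^ k) * (1 - B) = 1 - B ^ n" for n
  proof (induction n)
    case (Suc n)
    have "(1 - B) * (\<Sum>k<Suc n. B ^ k) = (1 - B) * (\<Sum>k<n. B ^ k) + (1 - B) * B ^ n"
      by (simp add: distrib_left)
    also have "\<dots> = 1 - B ^ Suc n" unfolding Suc by (simp add: left_diff_distrib)
    finally show "(1 - B) * (\<Sum>k<Suc n. B ^ k) = 1 - B ^ Suc n" .
    have "(\<Sum>k<Suc n. B ^ k) * (1 - B) = (\<Sum>k<n. B ^ k) * (1 - B) + B ^ n * (1 - B)"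
      by (simp add: distrib_right)
    also have "\<dots> = 1 - B ^ Suc n" unfolding Suc by (simp add: right_diff_distrib power_commutes)
    finally show "(\<Sum>k<Suc n. B ^ k) * (1 - B) = 1 - B ^ Suc n" .
  qed simp_all
  have "(\<lambda>n. (1 - B) * (\<Sum>k<n. B ^ k)) \<longlonglongrightarrow> (1 - B) * S"
    by (intro tendsto_mult tendsto_const lim)
  then have "(1 - B) * S = 1" unfolding tel using z LIMSEQ_unique by fastforce
  moreover have "(\<lambda>n. (\<Sum>k<n. B ^ k) * (1 - B)) \<longlonglongrightarrow> S * (1 - B)"
    by (intro tendsto_mult tendsto_const lim)
  then have "S * (1 - B) = 1" unfolding tel using z LIMSEQ_unique by fastforce
  ultimately show ?thesis unfolding invertible_op_def by blast
qed

text \<open>After division by a large \<open>M\<close> the operator lies between m / M and 1, so 1 -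
  T / M has norm at most 1 - m / M < 1 and the Neumann series applies. The maximum with
  \<open>m\<close> in \<open>M\<close> secures m < M even on the zero space.\<close>

lemma invertible_op_bounded_below:
  assumes "cst m \<le> T" "0 < m"
  shows "invertible_op T"
proof -
  define M where "M = max (norm T) m + 1"
  have M: "0 < M" "m < M" "norm T \<le> M" using \<open>0 < m\<close> by (auto simp: M_def)
  have sa: "self_adjoint T" using assms cst_le_sa by blast
  define B where "B = 1 - complex_of_real (1 / M) *\<^sub>C T"
  have up: "T \<le> cst M" using norm_le_cst[OF sa M(3)] by simp
  have "norm B \<le> 1 - m / M"
  proof (rule norm_le_between)
    have "complex_of_real (1 / M) *\<^sub>C cst m \<le> complex_of_real (1 / M) *\<^sub>C T"
      using assms M by (intro scale_bop_mono) auto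
    then have "1 - complex_of_real (1 / M) *\<^sub>C T \<le> 1 - cst (m / M)" by simp
    also have "1 - cst (m / M) = cst (1 - m / M)" by (simp add: scaleC_diff_left)
    finally show "B \<le> cst (1 - m / M)" by (simp add: B_def)
    have "complex_of_real (1 / M) *\<^sub>C T \<le> complex_of_real (1 / M) *\<^sub>C cst M"
      using up M by (intro scale_bop_mono) auto
    then have "0 \<le> B" using M by (simp add: B_def)
    moreover have "cst (- (1 - m / M)) \<le> cst 0" using M by (intro cst_mono) (auto simp: field_simps)
    ultimately show "cst (- (1 - m / M)) \<le> B" using order_trans[of _ "cst 0" B] by simp
  qed (use M in \<open>simp add: field_simps\<close>)
  moreover have "m / M > 0" using M assms by simp
  ultimately have "invertible_op (1 - B)" by (intro invertible_one_minus) linarith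
  then have "invertible_op (complex_of_real (1 / M) *\<^sub>C T)" by (simp add: B_def)
  from invertible_op_scale[OF this, of "complex_of_real M"] show ?thesis using M by simp
qed

section \<open>The spectrum of a self-adjoint operator\<close>

lemma invertible_op_bounds:
  assumes "invertible_op T"
  obtains K where "0 < K" "\<And>x. norm x \<le> K * norm (bop_apply T x)"
proof
  show "0 < norm (inv_op T) + 1" by (simp add: add_nonneg_pos)
  fix x
  have "norm x = norm (bop_apply (inv_op T * T) x)" using inv_op[OF assms] by simp
  also have "\<dots> \<le> norm (inv_op T) * norm (bop_apply T x)" by (simp add: norm_bop_apply)
  also have "\<dots> \<le> (norm (inv_op T) + 1) * norm (bop_apply T x)" by (intro mult_right_mono) auto
  finally show "norm x \<le> (norm (inv_op T) + 1) * norm (bop_apply T x)" .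
qed

text \<open>For z = a + i b with b nonzero, (T - z) (T - cnj z) = (T - a)^2 + b^2 \<ge> b^2 is
  invertible, hence so is the commuting factor T - z.\<close>

lemma op_spectrum_real:
  assumes "self_adjoint T" "z \<in> op_spectrum T"
  shows "z = complex_of_real (Re z)"
proof (rule ccontr)
  assume "z \<noteq> complex_of_real (Re z)"
  then have "Im z \<noteq> 0" by (simp add: complex_eq_iff)
  define R where "R = T - cst (Re z)"
  have R: "adj R = R" using assms(1) by (simp add: R_def self_adjoint_def)
  have fac: "(T - z *\<^sub>C 1) * (T - cnj z *\<^sub>C 1) = R * R + cst ((Im z)\<^sup>2)"
    "(T - cnj z *\<^sub>C 1) * (T - z *\<^sub>C 1) = R * R + cst ((Im z)\<^sup>2)"
  proof -
    have z: "z = Re z + \<i> * Im z" "cnj z = Re z - \<i> * Im z" by (simp_all add: complex_eq_iff)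
    have 1: "T - z *\<^sub>C 1 = R - (\<i> * Im z) *\<^sub>C 1"
      by (subst z(1), unfold R_def scaleC_add_left) simp
    have 2: "T - cnj z *\<^sub>C 1 = R + (\<i> * Im z) *\<^sub>C 1"
      by (subst z(2), unfold R_def scaleC_diff_left) simp
    have 3: "(- (Im z * Im z)) *\<^sub>C 1 = - (cst (Im z * Im z) :: 'a bop)"
      using scaleC_minus_left by fastforce
    show "(T - z *\<^sub>C 1) * (T - cnj z *\<^sub>C 1) = R * R + cst ((Im z)\<^sup>2)"
      "(T - cnj z *\<^sub>C 1) * (T - z *\<^sub>C 1) = R * R + cst ((Im z)\<^sup>2)"
      unfolding 1 2 by (simp_all add: algebra_simps power2_eq_square scaleC_minus_left scaleC_diff_right scaleC_add_right 3)
  qed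
  have "cst ((Im z)\<^sup>2) \<le> adj R * R + cst ((Im z)\<^sup>2)"
    using positive_op_adj_mult[of R] by (simp add: less_eq_bop_def)
  then have "invertible_op (R * R + cst ((Im z)\<^sup>2))"
    using invertible_op_bounded_below \<open>Im z \<noteq> 0\<close> R by (metis zero_less_power2)
  then have "invertible_op (T - z *\<^sub>C 1)"
    using invertible_op_factor fac by metis
  with assms(2) show False by (simp add: op_spectrum_def)
qed

lemma op_spectrum_bounds:
  assumes "cst m \<le> T" "T \<le> cst M" "z \<in> op_spectrum T"
  shows "z = complex_of_real (Re z)" "m \<le> Re z" "Re z \<le> M"
proof -
  have sa: "self_adjoint T" using assms(1) cst_le_sa by blast
  show z: "z = complex_of_real (Re z)" by (rule op_spectrum_real[OF sa assms(3)])
  have ni: "\<not> invertible_op (T - cst (Re z))"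
    using assms(3) z by (simp add: op_spectrum_def)
  show "m \<le> Re z"
  proof (rule ccontr)
    assume "\<not> m \<le> Re z"
    moreover have "cst (m - Re z) \<le> T - cst (Re z)"
      using assms(1) by (simp add: scaleC_diff_left)
    ultimately show False using ni invertible_op_bounded_below[of "m - Re z"] by auto
  qed
  show "Re z \<le> M"
  proof (rule ccontr)
    assume "\<not> Re z \<le> M"
    moreover have "cst (Re z - M) \<le> cst (Re z) - T"
      using assms(2) by (simp add: scaleC_diff_left)
    ultimately have "invertible_op (cst (Re z) - T)" using invertible_op_bounded_below[of "Re z - M"] by auto
    from invertible_op_scale[OF this, of "- 1"] show False using ni by (simp add: scaleC_minus_left)
  qed
qed

lemma op_spectrum_norm:
  assumes "self_adjoint T" "z \<in> op_spectrum T"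
  shows "\<bar>Re z\<bar> \<le> norm T"
  using op_spectrum_bounds[OF norm_le_cst(2,1)[OF assms(1) order_refl] assms(2)] by auto

lemma compact_op_spectrum:
  assumes "self_adjoint T"
  shows "compact (op_spectrum T)"
proof -
  have "bounded (op_spectrum T)"
    unfolding bounded_iff
    using op_spectrum_norm[OF assms] op_spectrum_real[OF assms] by (metis norm_of_real)
  moreover have "open (- op_spectrum T)"
    unfolding open_dist
  proof
    fix z assume "z \<in> - op_spectrum T"
    then have inv: "invertible_op (T - z *\<^sub>C 1)" by (simp add: op_spectrum_def)
    define S where "S = inv_op (T - z *\<^sub>C 1)"
    have S: "(T - z *\<^sub>C 1) * S = 1" using inv_op[OF inv] by (simp add: S_def)
    show "\<exists>e>0. \<forall>w. dist w z < e \<longrightarrow> w \<in> - op_spectrum T"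
    proof (intro exI conjI allI impI)
      \<comment> \<open>T - w = (T - z) (1 - (w - z) S) stays invertible while |w - z| |S| < 1; the
        added 1 covers S = 0.\<close>
      show "0 < 1 / (norm S + 1)" by (simp add: add_nonneg_pos)
      fix w assume w: "dist w z < 1 / (norm S + 1)"
      have "norm ((w - z) *\<^sub>C S) = cmod (w - z) * norm S" by (rule norm_scaleC_bop)
      also have "\<dots> \<le> cmod (w - z) * (norm S + 1)" by (simp add: mult_left_mono)
      also have "\<dots> < 1"
        using w by (simp add: dist_norm pos_less_divide_eq add_nonneg_pos)
      finally have "invertible_op (1 - (w - z) *\<^sub>C S)" by (rule invertible_one_minus)
      then have "invertible_op ((T - z *\<^sub>C 1) * (1 - (w - z) *\<^sub>C S))"
        by (intro invertible_op_mult inv)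
      also have "(T - z *\<^sub>C 1) * (1 - (w - z) *\<^sub>C S) = T - w *\<^sub>C 1"
        using S by (simp only: right_diff_distrib scaleC_mult_bop) (simp add: scaleC_diff_left)
      finally show "w \<in> - op_spectrum T" by (simp add: op_spectrum_def)
    qed
  qed
  ultimately show ?thesis by (simp add: compact_eq_bounded_closed closed_def)
qed

section \<open>The continuous functional calculus\<close>

text \<open>Horner evaluation in which complex coefficients act as scalars on operators:
  coefficients and argument have different types, and operators do not commute in general.\<close>

definition poly_op :: "complex poly \<Rightarrow> 'a::complex_hilbert bop \<Rightarrow> 'a bop" where
  "poly_op p T = fold_coeffs (\<lambda>a S. a *\<^sub>C 1 + T * S) p 0"

lemma poly_op_0 [simp]: "poly_op 0 T = 0"
  by (simp add: poly_op_def)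

lemma poly_op_pCons [simp]: "poly_op (pCons a p) T = a *\<^sub>C 1 + T * poly_op p T"
  by (cases "p = 0 \<and> a = 0") (auto simp: poly_op_def)

lemma poly_op_add [simp]: "poly_op (p + q) T = poly_op p T + poly_op q T"
  by (induction p q rule: poly_induct2) (simp_all add: scaleC_add_left distrib_left)

lemma poly_op_smult [simp]: "poly_op (smult c p) T = c *\<^sub>C poly_op p T"
  by (induction p) (simp_all add: scaleC_add_right)

lemma poly_op_diff [simp]: "poly_op (p - q) T = poly_op p T - poly_op q T"
  using poly_op_add[of "p - q" q T] by (simp add: algebra_simps)

lemma poly_op_mult [simp]: "poly_op (p * q) T = poly_op p T * poly_op q T"
  by (induction p) (simp_all add: distrib_right mult.assoc)

lemma poly_op_sum: "poly_op (\<Sum>i\<in>I. p i) T = (\<Sum>i\<in>I. poly_op (p i) T)"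
  by (induction I rule: infinite_finite_induct) simp_all

lemma poly_op_intertwine: "X * T = S * X \<Longrightarrow> X * poly_op p T = poly_op p S * X"
proof (induction p)
  case (pCons a p)
  have "X * (T * poly_op p T) = S * (X * poly_op p T)"
    using pCons.prems by (simp add: mult.assoc[symmetric])
  then show ?case using pCons by (simp add: distrib_left distrib_right mult.assoc)
qed simp

lemma poly_op_adj: "adj (poly_op p T) = poly_op (map_poly cnj p) (adj T)"
proof (induction p)
  case (pCons a p)
  have "adj (poly_op p T) * adj T = adj T * adj (poly_op p T)"
    using poly_op_intertwine[of T T T p] by (metis adj_simps(7))
  then show ?case using pCons by (simp add: map_poly_pCons)
qed simp

text \<open>Induction on the degree: a root \<open>w\<close> splits off the factor T - w, which is
  invertible because \<open>w\<close> is outside the spectrum.\<close>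

lemma poly_op_invertible:
  assumes "p \<noteq> 0" "\<And>w. poly p w = 0 \<Longrightarrow> w \<notin> op_spectrum T"
  shows "invertible_op (poly_op p T)"
  using assms
proof (induction "degree p" arbitrary: p rule: less_induct)
  case less
  show ?case
  proof (cases "degree p = 0")
    case True
    then obtain c where c: "p = [:c:]" by (meson degree_eq_zeroE)
    have "invertible_op (1::'a bop)" unfolding invertible_op_def by (rule exI[of _ 1]) simp
    with c less show ?thesis by (auto intro: invertible_op_scale)
  next
    case False
    then have "\<not> constant (poly p)" by (simp add: constant_degree)
    then obtain w where w: "poly p w = 0" using fundamental_theorem_of_algebra by blast
    then obtain q where q: "p = [:- w, 1:] * q" by (auto simp: poly_eq_0_iff_dvd dvd_def)
    with less have "q \<noteq> 0" by auto
    then have "degree ([:- w, 1:] * q) = degree [:- w, 1:] + degree q" by (intro degree_mult_eq) auto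
    then have "degree p = Suc (degree q)" unfolding q by simp
    moreover have "v \<notin> op_spectrum T" if "poly q v = 0" for v
      using less.prems(2)[of v] that q by simp
    ultimately have "invertible_op (poly_op q T)" using less.hyps[of q] \<open>q \<noteq> 0\<close> by simp
    moreover have "invertible_op (T - w *\<^sub>C 1)"
      using less.prems(2)[OF w] by (simp add: op_spectrum_def)
    moreover have "poly_op p T = (T - w *\<^sub>C 1) * poly_op q T"
      unfolding q poly_op_mult by (simp add: scaleC_minus_left)
    ultimately show ?thesis using invertible_op_mult by metis
  qed
qed

text \<open>Factorisation applies to p - z unless this is the zero polynomial. In that excluded case
  the conclusion would amount to nonemptiness of the spectrum.\<close>

lemma spectral_mapping:
  assumes "z \<in> op_spectrum (poly_op p T)" "p \<noteq> [:z:]"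
  shows "\<exists>w\<in>op_spectrum T. poly p w = z"
proof (rule ccontr)
  assume "\<not> ?thesis"
  then have "invertible_op (poly_op (p - [:z:]) T)"
    using assms(2) by (intro poly_op_invertible) auto
  with assms(1) show False by (simp add: op_spectrum_def)
qed

text \<open>Let r be the norm. If r and - r were both outside the spectrum, T^2 - r^2 would be
  bounded below. Expanding gives |(T^2 - r^2) x|^2 \<le> r^2 (r^2 |x|^2 - |T x|^2), so |T x|^2 \<le>
  d |x|^2 with a fixed d < r^2, contradicting the choice of r.\<close>

lemma norm_in_op_spectrum:
  fixes T :: "'a::complex_hilbert bop"
  assumes sa: "self_adjoint T" and "T \<noteq> 0"
  shows "\<exists>z\<in>op_spectrum T. cmod z = norm T"
proof (rule ccontr)
  define r where "r = norm T"
  have "r > 0" using \<open>T \<noteq> 0\<close> by (simp add: r_def)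
  assume "\<not> ?thesis"
  then have "invertible_op (T - cst r)" "invertible_op (T - (- complex_of_real r) *\<^sub>C 1)"
    using \<open>r > 0\<close> unfolding op_spectrum_def r_def by auto
  then have "invertible_op ((T - cst r) * (T - (- complex_of_real r) *\<^sub>C 1))" by (rule invertible_op_mult)
  also have "(T - cst r) * (T - (- complex_of_real r) *\<^sub>C 1) = T * T - cst (r\<^sup>2)"
    by (simp add: algebra_simps scaleC_minus_left scaleC_add_right scaleC_diff_right power2_eq_square)
  finally obtain K where K: "0 < K" "\<And>x. norm x \<le> K * norm (bop_apply (T * T - cst (r\<^sup>2)) x)"
    using invertible_op_bounds by blast
  define d where "d = r\<^sup>2 - 1 / (K\<^sup>2 * r\<^sup>2)"
  have est: "(norm (bop_apply T x))\<^sup>2 \<le> d * (norm x)\<^sup>2" for x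
  proof -
    define y where "y = bop_apply T x"
    have "(norm (bop_apply T y - complex_of_real (r\<^sup>2) *\<^sub>C x))\<^sup>2 =
        (norm (bop_apply T y))\<^sup>2 + (r\<^sup>2 * norm x)\<^sup>2 - 2 * r\<^sup>2 * (norm y)\<^sup>2"
      using norm_add_sq[of "bop_apply T y" "- (complex_of_real (r\<^sup>2) *\<^sub>C x)"]
      by (simp add: scaleC_bound cinner.minus_right cinner_scaleC_right self_adjointD[OF sa] y_def[symmetric]
          Re_cinner_self norm_power norm_mult)
    also have "(norm (bop_apply T y))\<^sup>2 \<le> (r * norm y)\<^sup>2"
      unfolding r_def by (intro power_mono norm_bop_apply) simp
    finally have "(norm (bop_apply (T * T - cst (r\<^sup>2)) x))\<^sup>2 \<le> r\<^sup>2 * (r\<^sup>2 * (norm x)\<^sup>2 - (norm y)\<^sup>2)"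
      by (simp add: y_def power_mult_distrib algebra_simps power2_eq_square)
    moreover have "(norm x)\<^sup>2 \<le> (K * norm (bop_apply (T * T - cst (r\<^sup>2)) x))\<^sup>2"
      by (intro power_mono K) simp
    ultimately have "(norm x)\<^sup>2 \<le> K\<^sup>2 * (r\<^sup>2 * (r\<^sup>2 * (norm x)\<^sup>2 - (norm y)\<^sup>2))"
      using mult_left_mono[of _ _ "K\<^sup>2"] by (fastforce simp: power_mult_distrib)
    then show ?thesis
      using \<open>0 < K\<close> \<open>0 < r\<close> by (simp add: d_def y_def field_simps)
  qed
  have "norm T \<le> sqrt (max 0 d)"
  proof (rule norm_bop_le)
    fix x
    have "(norm (bop_apply T x))\<^sup>2 \<le> max 0 d * (norm x)\<^sup>2"
      using est[of x] by (rule order_trans) (simp add: mult_right_mono)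
    also have "\<dots> = (sqrt (max 0 d) * norm x)\<^sup>2" by (simp add: power_mult_distrib)
    finally show "norm (bop_apply T x) \<le> sqrt (max 0 d) * norm x" by (rule power2_le_imp_le) simp
  qed simp
  moreover have "sqrt (max 0 d) < r"
  proof -
    have "0 < K\<^sup>2 * r\<^sup>2" using \<open>0 < K\<close> \<open>0 < r\<close> by simp
    then have "d < r\<^sup>2" by (simp add: d_def)
    then have "max 0 d < r\<^sup>2" using \<open>0 < r\<close> by simp
    then have "sqrt (max 0 d) < sqrt (r\<^sup>2)" by (rule real_sqrt_less_mono)
    then show ?thesis using \<open>0 < r\<close> by simp
  qed
  ultimately show False by (simp add: r_def)
qed

lemma op_spectrum_nonempty:
  assumes "self_adjoint (T::'a::complex_hilbert bop)" "(1::'a bop) \<noteq> 0"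
  shows "op_spectrum T \<noteq> {}"
proof (cases "T = 0")
  case True
  have "0 \<in> op_spectrum T"
    unfolding op_spectrum_def invertible_op_def using True assms(2) by simp
  then show ?thesis by blast
qed (use norm_in_op_spectrum assms in blast)

text \<open>Half of the C*-identity, by Cauchy-Schwarz applied to |S x|^2 = <x, adj S S x>.\<close>

lemma norm_adj_mult_ge: "(norm S)\<^sup>2 \<le> norm (adj S * S)"
proof -
  have "norm S \<le> sqrt (norm (adj S * S))"
  proof (rule norm_bop_le)
    fix x
    have "(norm (bop_apply S x))\<^sup>2 = Re (cinner x (bop_apply (adj S * S) x))"
      by (simp add: cinner_adj_right Re_cinner_self)
    also have "\<dots> \<le> norm x * norm (bop_apply (adj S * S) x)" by (rule Re_cinner_le)
    also have "\<dots> \<le> norm x * (norm (adj S * S) * norm x)" by (intro mult_left_mono norm_bop_apply) simp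
    also have "\<dots> = (sqrt (norm (adj S * S)) * norm x)\<^sup>2" by (simp add: power_mult_distrib power2_eq_square)
    finally show "norm (bop_apply S x) \<le> sqrt (norm (adj S * S)) * norm x" by (rule power2_le_imp_le) simp
  qed simp
  then have "(norm S)\<^sup>2 \<le> (sqrt (norm (adj S * S)))\<^sup>2" by (intro power_mono) auto
  then show ?thesis by simp
qed

text \<open>p(T) is normal but need not be self-adjoint. The C*-identity passes to \<open>R\<close>,
  the self-adjoint operator given by the product of \<open>p\<close> and its conjugate polynomial;
  its norm is the modulus of a spectral value, which spectral mapping pulls back to a point of the
  spectrum of \<open>T\<close>.\<close>

lemma norm_poly_op_le:
  fixes T :: "'a::complex_hilbert bop"
  assumes sa: "self_adjoint T" and c: "0 \<le> c" "\<And>z. z \<in> op_spectrum T \<Longrightarrow> cmod (poly p z) \<le> c"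
  shows "norm (poly_op p T) \<le> c"
proof -
  define q where "q = map_poly cnj p * p"
  define R where "R = poly_op q T"
  have R: "R = adj (poly_op p T) * poly_op p T"
    using sa by (simp add: R_def q_def poly_op_adj self_adjoint_def)
  have "norm R \<le> c\<^sup>2"
  proof (cases "R = 0")
    case False
    have one: "(1::'a bop) \<noteq> 0"
    proof
      assume "(1::'a bop) = 0"
      then have "R = 0" by (metis mult.right_neutral mult_zero_right)
      with False show False by simp
    qed
    obtain z where z: "z \<in> op_spectrum R" "cmod z = norm R"
      using norm_in_op_spectrum[OF _ False] self_adjoint_adj_mult R by metis
    have "\<exists>w\<in>op_spectrum T. poly q w = z"
    \<comment> \<open>A constant \<open>q\<close> maps every spectral point to \<open>z\<close>, and
      the spectrum is nonempty because \<open>R\<close> is nonzero.\<close>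
    proof (cases "q = [:z:]")
      case True
      then show ?thesis using op_spectrum_nonempty[OF sa one] by fastforce
    qed (use z spectral_mapping[of z q T] R_def in blast)
    then obtain w where w: "w \<in> op_spectrum T" "poly q w = z" by blast
    have "cnj w = w" using op_spectrum_real[OF sa w(1)] by (metis complex_cnj_complex_of_real)
    then have "poly q w = cnj (poly p w) * poly p w" by (simp add: q_def)
    then have "cmod z = (cmod (poly p w))\<^sup>2" using w by (simp add: norm_mult power2_eq_square)
    also have "\<dots> \<le> c\<^sup>2" using c(2)[OF w(1)] by (intro power_mono) auto
    finally show ?thesis using z by simp
  qed simp
  then have "(norm (poly_op p T))\<^sup>2 \<le> c\<^sup>2" using norm_adj_mult_ge[of "poly_op p T"] R by simp
  then show ?thesis using c(1) by (rule power2_le_imp_le)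
qed

section \<open>Uniform approximation and construction of the calculus\<close>

lemma real_poly_approx:
  fixes f :: "real \<Rightarrow> real"
  assumes "compact X" "continuous_on X f" "0 < e"
  obtains p :: "complex poly" where "\<And>x. x \<in> X \<Longrightarrow> cmod (poly p (of_real x) - of_real (f x)) < e"
proof -
  obtain g where g: "real_polynomial_function g" "\<And>x. x \<in> X \<Longrightarrow> \<bar>f x - g x\<bar> < e"
    using Stone_Weierstrass_real_polynomial_function[OF assms] by blast
  obtain a n where gs: "g = (\<lambda>x. \<Sum>i\<le>n. a i * x ^ i)"
    using g(1) real_polynomial_function_iff_sum by auto
  define p where "p = (\<Sum>i\<le>n. monom (complex_of_real (a i)) i)"
  have "poly p (of_real x) = of_real (g x)" for x
    by (simp add: p_def gs poly_sum poly_monom)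
  then have "cmod (poly p (of_real x) - of_real (f x)) < e" if "x \<in> X" for x
    using g(2)[OF that] by (metis abs_minus_commute norm_of_real of_real_diff)
  then show ?thesis using that by blast
qed

text \<open>Polynomials in z alone are dense because the spectrum is real: the real and imaginary
  parts of \<open>g\<close> are approximated separately on its projection to the line.\<close>

lemma spectrum_poly_approx:
  assumes sa: "self_adjoint T" and g: "continuous_on (op_spectrum T) g" and "0 < e"
  shows "\<exists>p. \<forall>z\<in>op_spectrum T. cmod (poly p z - g z) < e"
proof -
  define X where "X = Re ` op_spectrum T"
  have X: "compact X" unfolding X_def
    by (intro compact_continuous_image compact_op_spectrum sa continuous_intros)
  have im: "complex_of_real ` X \<subseteq> op_spectrum T"
    using op_spectrum_real[OF sa] by (auto simp: X_def)
  have cont: "continuous_on X (\<lambda>x. g (complex_of_real x))"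
    by (rule continuous_on_compose2[OF g _ im]) (intro continuous_intros)
  obtain p where p: "\<And>x. x \<in> X \<Longrightarrow> cmod (poly p (of_real x) - of_real (Re (g (of_real x)))) < e / 2"
    using real_poly_approx[OF X continuous_on_Re[OF cont], of "e / 2"] \<open>0 < e\<close> by auto
  obtain q where q: "\<And>x. x \<in> X \<Longrightarrow> cmod (poly q (of_real x) - of_real (Im (g (of_real x)))) < e / 2"
    using real_poly_approx[OF X continuous_on_Im[OF cont], of "e / 2"] \<open>0 < e\<close> by auto
  have "cmod (poly (p + smult \<i> q) z - g z) < e" if "z \<in> op_spectrum T" for z
  proof -
    have x: "Re z \<in> X" and z: "complex_of_real (Re z) = z"
      using that op_spectrum_real[OF sa that] by (auto simp: X_def)
    have "poly (p + smult \<i> q) z - g z =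
        (poly p z - of_real (Re (g z))) + \<i> * (poly q z - of_real (Im (g z)))"
      by (simp add: algebra_simps complex_eq_iff)
    then have "cmod (poly (p + smult \<i> q) z - g z) \<le>
        cmod (poly p z - of_real (Re (g z))) + cmod (poly q z - of_real (Im (g z)))"
      by (metis norm_triangle_ineq norm_mult norm_ii mult_1)
    also have "\<dots> < e" using p[OF x] q[OF x] unfolding z by linarith
    finally show ?thesis .
  qed
  then show ?thesis by blast
qed

definition poly_approx_seq :: "'a::complex_hilbert bop \<Rightarrow> (complex \<Rightarrow> complex) \<Rightarrow> nat \<Rightarrow> complex poly" where
  "poly_approx_seq T g n = (SOME p. \<forall>z\<in>op_spectrum T. cmod (poly p z - g z) < 1 / real (Suc n))"

definition fcal :: "'a::complex_hilbert bop \<Rightarrow> (complex \<Rightarrow> complex) \<Rightarrow> 'a bop" where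
  "fcal T g = lim (\<lambda>n. poly_op (poly_approx_seq T g n) T)"

lemma poly_approx_seq:
  assumes "self_adjoint T" "continuous_on (op_spectrum T) g" "z \<in> op_spectrum T"
  shows "cmod (poly (poly_approx_seq T g n) z - g z) < 1 / real (Suc n)"
  using someI_ex[OF spectrum_poly_approx[OF assms(1,2), of "1 / real (Suc n)"]] assms(3)
  unfolding poly_approx_seq_def by simp

text \<open>This makes the limit in \<open>fcal\<close> independent of the chosen polynomials. The
  case e = 0 is allowed and shows that \<open>fcal\<close> agrees with \<open>poly_op\<close> on
  polynomials.\<close>

lemma fcal_dist_poly_op:
  fixes T :: "'a::complex_hilbert bop"
  assumes sa: "self_adjoint T" and g: "continuous_on (op_spectrum T) g"
    and e: "0 \<le> e" "\<And>z. z \<in> op_spectrum T \<Longrightarrow> cmod (poly q z - g z) \<le> e"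
  shows "norm (poly_op q T - fcal T g) \<le> e"
proof -
  let ?P = "\<lambda>n. poly_op (poly_approx_seq T g n) T"
  have est: "norm (?P m - ?P n) \<le> 1 / real (Suc m) + 1 / real (Suc n)" for m n
    unfolding poly_op_diff[symmetric]
  proof (rule norm_poly_op_le[OF sa])
    fix z assume z: "z \<in> op_spectrum T"
    have "cmod (poly (poly_approx_seq T g m - poly_approx_seq T g n) z) \<le>
        cmod (poly (poly_approx_seq T g m) z - g z) + cmod (poly (poly_approx_seq T g n) z - g z)"
      using norm_triangle_ineq4[of "poly (poly_approx_seq T g m) z - g z" "poly (poly_approx_seq T g n) z - g z"] by simp
    also have "\<dots> \<le> 1 / real (Suc m) + 1 / real (Suc n)"
      using poly_approx_seq[OF sa g z] by (intro add_mono less_imp_le)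
    finally show "cmod (poly (poly_approx_seq T g m - poly_approx_seq T g n) z) \<le> 1 / real (Suc m) + 1 / real (Suc n)" .
  qed simp
  have "Cauchy ?P"
  proof (rule metric_CauchyI)
    fix e :: real assume "0 < e"
    then obtain N where N: "1 / real (Suc N) < e / 2"
      using reals_Archimedean[of "e / 2"] by (auto simp: inverse_eq_divide)
    have "dist (?P m) (?P n) < e" if "N \<le> m" "N \<le> n" for m n
    proof -
      have "1 / real (Suc m) \<le> 1 / real (Suc N)" "1 / real (Suc n) \<le> 1 / real (Suc N)"
        using that by (auto intro!: divide_left_mono)
      then show ?thesis using est[of m n] N unfolding dist_norm by linarith
    qed
    then show "\<exists>M. \<forall>m\<ge>M. \<forall>n\<ge>M. dist (?P m) (?P n) < e" by blast
  qed
  then have lim: "?P \<longlonglongrightarrow> fcal T g"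
    unfolding fcal_def using Cauchy_convergent convergent_LIMSEQ_iff by blast
  have "(\<lambda>n. norm (poly_op q T - ?P n)) \<longlonglongrightarrow> norm (poly_op q T - fcal T g)"
    by (intro tendsto_intros lim)
  moreover have "(\<lambda>n. e + 1 / real (Suc n)) \<longlonglongrightarrow> e + 0"
    by (intro tendsto_add tendsto_const LIMSEQ_Suc lim_1_over_n)
  moreover have "norm (poly_op q T - ?P n) \<le> e + 1 / real (Suc n)" for n
    unfolding poly_op_diff[symmetric]
  proof (rule norm_poly_op_le[OF sa])
    fix z assume z: "z \<in> op_spectrum T"
    have "cmod (poly (q - poly_approx_seq T g n) z) \<le> cmod (poly q z - g z) + cmod (poly (poly_approx_seq T g n) z - g z)"
      using norm_triangle_ineq4[of "poly q z - g z" "poly (poly_approx_seq T g n) z - g z"] by simp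
    also have "\<dots> \<le> e + 1 / real (Suc n)"
      by (intro add_mono e(2)[OF z] less_imp_le[OF poly_approx_seq[OF sa g z]])
    finally show "cmod (poly (q - poly_approx_seq T g n) z) \<le> e + 1 / real (Suc n)" .
  qed (use e in simp)
  ultimately have "norm (poly_op q T - fcal T g) \<le> e + 0"
    by (intro LIMSEQ_le) auto
  then show ?thesis by simp
qed

lemma fcal_lim:
  assumes sa: "self_adjoint T" and g: "continuous_on (op_spectrum T) g"
    and u: "uniform_limit (op_spectrum T) (\<lambda>n. poly (q n)) g sequentially"
  shows "(\<lambda>n. poly_op (q n) T) \<longlonglongrightarrow> fcal T g"
proof (rule metric_LIMSEQ_I)
  fix e :: real assume "0 < e"
  then have "\<forall>\<^sub>F n in sequentially. \<forall>z\<in>op_spectrum T. dist (poly (q n) z) (g z) < e / 2"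
    by (intro uniform_limitD[OF u]) simp
  then obtain N where N: "\<And>n z. N \<le> n \<Longrightarrow> z \<in> op_spectrum T \<Longrightarrow> dist (poly (q n) z) (g z) < e / 2"
    unfolding eventually_sequentially by blast
  have "dist (poly_op (q n) T) (fcal T g) < e" if "N \<le> n" for n
  proof -
    have "norm (poly_op (q n) T - fcal T g) \<le> e / 2"
      using \<open>0 < e\<close> N[OF that] by (intro fcal_dist_poly_op sa g) (auto simp: dist_norm less_imp_le)
    then show ?thesis using \<open>0 < e\<close> by (simp add: dist_norm)
  qed
  then show "\<exists>N. \<forall>n\<ge>N. dist (poly_op (q n) T) (fcal T g) < e" by blast
qed

lemma poly_approx_seq_uniform_limit:
  assumes "self_adjoint T" "continuous_on (op_spectrum T) g"
  shows "uniform_limit (op_spectrum T) (\<lambda>n. poly (poly_approx_seq T g n)) g sequentially"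
proof (rule uniform_limitI)
  fix e :: real assume "0 < e"
  then obtain N where N: "1 / real (Suc N) < e"
    using reals_Archimedean[of e] by (auto simp: inverse_eq_divide)
  have "dist (poly (poly_approx_seq T g n) z) (g z) < e" if "N \<le> n" "z \<in> op_spectrum T" for n z
  proof -
    have "1 / real (Suc n) \<le> 1 / real (Suc N)" using that by (auto intro!: divide_left_mono)
    then show ?thesis using poly_approx_seq[OF assms that(2), of n] N unfolding dist_norm by linarith
  qed
  then show "\<forall>\<^sub>F n in sequentially. \<forall>z\<in>op_spectrum T. dist (poly (poly_approx_seq T g n) z) (g z) < e"
    unfolding eventually_sequentially by blast
qed

lemma bounded_op_spectrum_image:
  assumes "self_adjoint T" "continuous_on (op_spectrum T) g"
  shows "bounded (g ` op_spectrum T)"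
  by (intro compact_imp_bounded compact_continuous_image assms compact_op_spectrum)

lemma tendsto_adj:
  fixes S :: "'a::complex_hilbert bop"
  assumes "X \<longlonglongrightarrow> S"
  shows "(\<lambda>n. adj (X n)) \<longlonglongrightarrow> adj S"
proof -
  have nrm: "norm (adj R) \<le> norm R" for R :: "'a bop"
  proof (cases "norm (adj R) = 0")
    case False
    have "(norm (adj R))\<^sup>2 \<le> norm (R * adj R)" using norm_adj_mult_ge[of "adj R"] by simp
    also have "\<dots> \<le> norm R * norm (adj R)" by (rule norm_mult_ineq)
    finally show ?thesis using False by (simp add: power2_eq_square)
  qed simp
  have "(\<lambda>n. norm (X n - S)) \<longlonglongrightarrow> 0" using assms by (simp add: LIM_zero_iff tendsto_norm_zero)
  then have "(\<lambda>n. norm (adj (X n) - adj S)) \<longlonglongrightarrow> 0"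
    by (rule Lim_null_comparison[rotated]) (use nrm[of "X _ - S"] in simp)
  then show ?thesis by (simp add: tendsto_norm_zero_iff LIM_zero_iff)
qed

text \<open>Each law holds for polynomials and passes to uniform limits. Products use that
  continuous functions are bounded on the compact spectrum; conjugation uses that the spectrum is
  real, so that conjugating coefficients conjugates values.\<close>

theorem functional_calculus_fcal:
  assumes sa: "self_adjoint T"
  shows "functional_calculus T (fcal T)"
proof -
  let ?\<sigma> = "op_spectrum T"
  note lim = fcal_lim[OF sa] and app = poly_approx_seq_uniform_limit[OF sa]
  have lim': "(\<lambda>n. poly_op (poly_approx_seq T g n) T) \<longlonglongrightarrow> fcal T g" if "continuous_on ?\<sigma> g" for g
    using lim[OF that app[OF that]] .
  have poly: "fcal T (poly p) = poly_op p T" for p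
  proof -
    have "norm (poly_op p T - fcal T (poly p)) \<le> 0"
      by (rule fcal_dist_poly_op[OF sa]) (auto intro: continuous_intros)
    then show ?thesis by simp
  qed
  have cong: "fcal T g = fcal T h"
    if g: "continuous_on ?\<sigma> g" and h: "continuous_on ?\<sigma> h" and eq: "\<forall>z\<in>?\<sigma>. g z = h z" for g h
  proof -
    have "uniform_limit ?\<sigma> (\<lambda>n. poly (poly_approx_seq T g n)) h sequentially"
      using app[OF g] by (rule uniform_limit_cong'[THEN iffD1, rotated -1]) (use eq in auto)
    from lim[OF h this] lim'[OF g] show ?thesis using LIMSEQ_unique by blast
  qed
  have add: "fcal T (\<lambda>z. g z + h z) = fcal T g + fcal T h"
    if g: "continuous_on ?\<sigma> g" and h: "continuous_on ?\<sigma> h" for g h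
  proof -
    have "uniform_limit ?\<sigma> (\<lambda>n z. poly (poly_approx_seq T g n) z + poly (poly_approx_seq T h n) z) (\<lambda>z. g z + h z) sequentially"
      by (intro uniform_limit_add app g h)
    then have "(\<lambda>n. poly_op (poly_approx_seq T g n + poly_approx_seq T h n) T) \<longlonglongrightarrow> fcal T (\<lambda>z. g z + h z)"
      by (intro lim continuous_intros g h) (simp add: poly_add[abs_def])
    then show ?thesis using tendsto_add[OF lim'[OF g] lim'[OF h]] LIMSEQ_unique by fastforce
  qed
  have mult: "fcal T (\<lambda>z. g z * h z) = fcal T g * fcal T h"
    if g: "continuous_on ?\<sigma> g" and h: "continuous_on ?\<sigma> h" for g h
  proof -
    have "uniform_limit ?\<sigma> (\<lambda>n z. poly (poly_approx_seq T g n) z * poly (poly_approx_seq T h n) z) (\<lambda>z. g z * h z) sequentially"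
      by (intro uniform_lim_mult app g h bounded_op_spectrum_image sa)
    then have "(\<lambda>n. poly_op (poly_approx_seq T g n * poly_approx_seq T h n) T) \<longlonglongrightarrow> fcal T (\<lambda>z. g z * h z)"
      by (intro lim continuous_intros g h) (simp add: poly_mult[abs_def])
    then show ?thesis using tendsto_mult[OF lim'[OF g] lim'[OF h]] LIMSEQ_unique by fastforce
  qed
  have scale: "fcal T (\<lambda>z. c * g z) = c *\<^sub>C fcal T g" if g: "continuous_on ?\<sigma> g" for c g
    using mult[of "poly [:c:]" g] g poly[of "[:c:]"] by simp
  have conj: "fcal T (\<lambda>z. cnj (g z)) = adj (fcal T g)" if g: "continuous_on ?\<sigma> g" for g
  proof -
    have real: "cnj z = z" if "z \<in> ?\<sigma>" for z
      using op_spectrum_real[OF sa that] by (metis complex_cnj_complex_of_real)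
    have "uniform_limit ?\<sigma> (\<lambda>n z. cnj (poly (poly_approx_seq T g n) z)) (\<lambda>z. cnj (g z)) sequentially"
      by (intro uniform_limit_intros app g)
    then have "uniform_limit ?\<sigma> (\<lambda>n. poly (map_poly cnj (poly_approx_seq T g n))) (\<lambda>z. cnj (g z)) sequentially"
      by (rule uniform_limit_cong'[THEN iffD1, rotated -1]) (use real in auto)
    then have "(\<lambda>n. poly_op (map_poly cnj (poly_approx_seq T g n)) T) \<longlonglongrightarrow> fcal T (\<lambda>z. cnj (g z))"
      by (intro lim continuous_intros g)
    moreover have "poly_op (map_poly cnj p) T = adj (poly_op p T)" for p
      using sa by (simp add: poly_op_adj self_adjoint_def)
    ultimately show ?thesis using tendsto_adj[OF lim'[OF g]] LIMSEQ_unique by fastforce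
  qed
  have "poly [:1:] = (\<lambda>z::complex. 1)" "poly [:0, 1:] = (\<lambda>z::complex. z)"
    by (simp_all add: fun_eq_iff)
  then have one: "fcal T (\<lambda>z. 1) = 1" and ident: "fcal T (\<lambda>z. z) = T"
    using poly[of "[:1:]"] poly[of "[:0, 1:]"] by simp_all
  show ?thesis
    unfolding functional_calculus_def Let_def Ball_def mem_Collect_eq
    apply (intro conjI allI impI)
    apply (erule cong, assumption, blast)
    apply (erule add, assumption)
    apply (erule mult, assumption)
    apply (erule scale)
    apply (erule conj)
    apply (rule one)
    apply (rule ident)
    done
qed

section \<open>Uniqueness of the calculus\<close>

lemma functional_calculusD:
  assumes "functional_calculus T \<pi>"
  shows "\<And>g h. continuous_on (op_spectrum T) g \<Longrightarrow> continuous_on (op_spectrum T) h \<Longrightarrow>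
      (\<And>z. z \<in> op_spectrum T \<Longrightarrow> g z = h z) \<Longrightarrow> \<pi> g = \<pi> h"
    and "\<And>g h. continuous_on (op_spectrum T) g \<Longrightarrow> continuous_on (op_spectrum T) h \<Longrightarrow>
      \<pi> (\<lambda>z. g z + h z) = \<pi> g + \<pi> h"
    and "\<And>g h. continuous_on (op_spectrum T) g \<Longrightarrow> continuous_on (op_spectrum T) h \<Longrightarrow>
      \<pi> (\<lambda>z. g z * h z) = \<pi> g * \<pi> h"
    and "\<And>g c. continuous_on (op_spectrum T) g \<Longrightarrow> \<pi> (\<lambda>z. c * g z) = c *\<^sub>C \<pi> g"
    and "\<And>g. continuous_on (op_spectrum T) g \<Longrightarrow> \<pi> (\<lambda>z. cnj (g z)) = adj (\<pi> g)"
    and "\<pi> (\<lambda>z. 1) = 1" and "\<pi> (\<lambda>z. z) = T"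
  using assms unfolding functional_calculus_def Let_def Ball_def mem_Collect_eq by blast+

text \<open>A *-homomorphism is automatically contractive: with r = sqrt (c^2 - |g|^2), the sum of
  adj \<pi>(g) \<pi>(g) and adj \<pi>(r) \<pi>(r) is c^2, whence |\<pi>(g) x| \<le> c |x|.\<close>

lemma norm_functional_calculus_le:
  fixes T :: "'a::complex_hilbert bop"
  assumes fc: "functional_calculus T \<pi>" and g: "continuous_on (op_spectrum T) g"
    and c: "0 \<le> c" "\<And>z. z \<in> op_spectrum T \<Longrightarrow> cmod (g z) \<le> c"
  shows "norm (\<pi> g) \<le> c"
proof -
  let ?\<sigma> = "op_spectrum T"
  note cong = functional_calculusD(1)[OF fc] and add = functional_calculusD(2)[OF fc]
    and mult = functional_calculusD(3)[OF fc] and scale = functional_calculusD(4)[OF fc]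
    and conj = functional_calculusD(5)[OF fc] and one = functional_calculusD(6)[OF fc]
  define r where "r z = complex_of_real (sqrt (c\<^sup>2 - (cmod (g z))\<^sup>2))" for z
  have r: "continuous_on ?\<sigma> r" unfolding r_def by (intro continuous_intros g)
  have g': "continuous_on ?\<sigma> (\<lambda>z. cnj (g z))" and r': "continuous_on ?\<sigma> (\<lambda>z. cnj (r z))"
    by (intro continuous_intros g r)+
  have "\<pi> (\<lambda>z. cnj (g z) * g z + cnj (r z) * r z) = \<pi> (\<lambda>z. of_real (c\<^sup>2) * 1)"
  proof (rule cong)
    fix z assume "z \<in> ?\<sigma>"
    show "cnj (g z) * g z + cnj (r z) * r z = of_real (c\<^sup>2) * 1"
    proof -
      have "(cmod (g z))\<^sup>2 \<le> c\<^sup>2" using c \<open>z \<in> ?\<sigma>\<close> by (intro power_mono) auto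
      then have "(sqrt (c\<^sup>2 - (cmod (g z))\<^sup>2))\<^sup>2 = c\<^sup>2 - (cmod (g z))\<^sup>2" by simp
      moreover have "cnj (r z) * r z = of_real ((sqrt (c\<^sup>2 - (cmod (g z))\<^sup>2))\<^sup>2)"
        by (simp only: r_def power2_eq_square of_real_mult complex_cnj_complex_of_real)
      ultimately have "cnj (r z) * r z = of_real (c\<^sup>2 - (cmod (g z))\<^sup>2)" by (simp only:)
      moreover have "cnj (g z) * g z = of_real ((cmod (g z))\<^sup>2)"
        by (metis complex_norm_square mult.commute of_real_power)
      ultimately show "cnj (g z) * g z + cnj (r z) * r z = of_real (c\<^sup>2) * 1" by simp
    qed
  qed (intro continuous_intros g g' r r')+
  moreover have "\<pi> (\<lambda>z. cnj (g z) * g z + cnj (r z) * r z) = adj (\<pi> g) * \<pi> g + adj (\<pi> r) * \<pi> r"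
    using g g' r r' by (simp add: add mult conj continuous_on_mult)
  moreover have "\<pi> (\<lambda>z. of_real (c\<^sup>2) * 1) = cst (c\<^sup>2)"
    using scale[of "\<lambda>z. 1"] one by simp
  ultimately have eq: "adj (\<pi> g) * \<pi> g + adj (\<pi> r) * \<pi> r = cst (c\<^sup>2)" by simp
  show ?thesis
  proof (rule norm_bop_le[OF _ c(1)])
    fix x
    have "(norm (bop_apply (\<pi> g) x))\<^sup>2 + (norm (bop_apply (\<pi> r) x))\<^sup>2 =
        Re (cinner x (bop_apply (adj (\<pi> g) * \<pi> g + adj (\<pi> r) * \<pi> r) x))"
      by (simp add: cinner_add_right cinner_adj_right Re_cinner_self)
    also have "\<dots> = (c * norm x)\<^sup>2"
      unfolding eq by (simp add: cinner_scaleC_right Re_cinner_self power_mult_distrib)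
    finally have "(norm (bop_apply (\<pi> g) x))\<^sup>2 \<le> (c * norm x)\<^sup>2" using zero_le_power2[of "norm (bop_apply (\<pi> r) x)"] by linarith
    then show "norm (bop_apply (\<pi> g) x) \<le> c * norm x" by (rule power2_le_imp_le) (simp add: c)
  qed
qed

lemma functional_calculus_poly:
  assumes fc: "functional_calculus T \<pi>"
  shows "\<pi> (poly p) = poly_op p T"
proof (induction p)
  case 0
  have "\<pi> (\<lambda>z. 0 * 1) = 0 *\<^sub>C \<pi> (\<lambda>z. 1)"
    by (rule functional_calculusD(4)[OF fc continuous_on_const])
  then show ?case by simp
next
  case (pCons a p)
  have c: "continuous_on S (\<lambda>z::complex. z * poly p z)" "continuous_on S (\<lambda>z::complex. a * 1)"
    "continuous_on S (poly p)" "continuous_on S (\<lambda>z. z)" for S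
    by (intro continuous_intros)+
  note functional_calculusD(2)[OF fc c(2,1)] functional_calculusD(3)[OF fc c(4,3)]
    functional_calculusD(4)[OF fc continuous_on_const[of _ 1], of a] functional_calculusD(6,7)[OF fc]
  moreover have "poly (pCons a p) = (\<lambda>z. a * 1 + z * poly p z)" by (simp add: fun_eq_iff)
  ultimately show ?case using pCons by simp
qed

text \<open>Any calculus is determined on polynomials and is contractive, so it shares the limits
  defining \<open>fcal\<close>. Thus the description in \<open>cfc\<close> has exactly one
  solution.\<close>

lemma functional_calculus_unique:
  assumes sa: "self_adjoint T" and fc: "functional_calculus T \<pi>" and g: "continuous_on (op_spectrum T) g"
  shows "\<pi> g = fcal T g"
proof -
  let ?p = "\<lambda>n. poly_approx_seq T g n"
  have est: "norm (poly_op (?p n) T - \<pi> g) \<le> 1 / real (Suc n)" for n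
  proof -
    have c: "continuous_on (op_spectrum T) (poly (?p n))" "continuous_on (op_spectrum T) (\<lambda>z. -1 * g z)"
      by (intro continuous_intros g)+
    have "\<pi> (\<lambda>z. poly (?p n) z + - 1 * g z) = \<pi> (poly (?p n)) + \<pi> (\<lambda>z. - 1 * g z)"
      by (rule functional_calculusD(2)[OF fc c])
    also have "\<pi> (poly (?p n)) = poly_op (?p n) T" by (rule functional_calculus_poly[OF fc])
    also have "\<pi> (\<lambda>z. - 1 * g z) = - 1 *\<^sub>C \<pi> g" by (rule functional_calculusD(4)[OF fc g])
    also have "poly_op (?p n) T + - 1 *\<^sub>C \<pi> g = poly_op (?p n) T - \<pi> g" by (simp add: scaleC_minus_left)
    finally have "\<pi> (\<lambda>z. poly (?p n) z + - 1 * g z) = poly_op (?p n) T - \<pi> g" .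
    moreover have "norm (\<pi> (\<lambda>z. poly (?p n) z + - 1 * g z)) \<le> 1 / real (Suc n)"
    proof (rule norm_functional_calculus_le[OF fc])
      show "cmod (poly (?p n) z + - 1 * g z) \<le> 1 / real (Suc n)" if "z \<in> op_spectrum T" for z
        using poly_approx_seq[OF sa g that, of n] by simp
    qed (rule continuous_on_add[OF c], simp)
    ultimately show ?thesis by metis
  qed
  have "(\<lambda>n. poly_op (?p n) T - \<pi> g) \<longlonglongrightarrow> 0"
  proof (rule Lim_null_comparison)
    show "\<forall>\<^sub>F n in sequentially. norm (poly_op (?p n) T - \<pi> g) \<le> 1 / real (Suc n)"
      by (intro always_eventually allI est)
    show "(\<lambda>n. 1 / real (Suc n)) \<longlonglongrightarrow> 0"
      by (intro LIMSEQ_Suc lim_1_over_n)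
  qed
  then have "(\<lambda>n. poly_op (?p n) T) \<longlonglongrightarrow> \<pi> g" by (rule LIM_zero_cancel)
  then show ?thesis
    using fcal_lim[OF sa g poly_approx_seq_uniform_limit[OF sa g]] LIMSEQ_unique by blast
qed

lemma cfc_eq_fcal:
  assumes "self_adjoint T" "continuous_on (op_spectrum T) g"
  shows "cfc g T = fcal T g"
  unfolding cfc_def
proof (rule the_equality)
  show "\<exists>\<pi>. functional_calculus T \<pi> \<and> fcal T g = \<pi> g"
    using functional_calculus_fcal[OF assms(1)] by blast
  show "S = fcal T g" if "\<exists>\<pi>. functional_calculus T \<pi> \<and> S = \<pi> g" for S
    using that functional_calculus_unique[OF assms(1) _ assms(2)] by blast
qed

section \<open>Real functions of self-adjoint operators\<close>

text \<open>Functions can be compared on a fixed real set \<open>X\<close> even when the operator,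
  and with it the spectrum, varies; self-adjointness is bundled since every use requires it.\<close>

definition spec_in :: "'a::complex_hilbert bop \<Rightarrow> real set \<Rightarrow> bool" where
  "spec_in T X \<longleftrightarrow> self_adjoint T \<and> op_spectrum T \<subseteq> complex_of_real ` X"

lemma spec_in_sa: "spec_in T X \<Longrightarrow> self_adjoint T"
  by (simp add: spec_in_def)

lemma spec_in_mono: "spec_in T X \<Longrightarrow> X \<subseteq> Y \<Longrightarrow> spec_in T Y"
  unfolding spec_in_def by blast

lemma spec_in_spectrum:
  assumes "self_adjoint T"
  shows "spec_in T (Re ` op_spectrum T)"
  unfolding spec_in_def
proof (intro conjI subsetI)
  show "z \<in> complex_of_real ` Re ` op_spectrum T" if "z \<in> op_spectrum T" for z
    using op_spectrum_real[OF assms that] that by (intro image_eqI[of _ _ "Re z"]) auto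
qed (fact assms)

lemma spec_in_UNIV: "self_adjoint T \<Longrightarrow> spec_in T UNIV"
  using spec_in_mono[OF spec_in_spectrum] by blast

lemma spec_in_Icc:
  assumes "cst m \<le> T" "T \<le> cst M"
  shows "spec_in T {m..M}"
proof (rule spec_in_mono)
  show "spec_in T (Re ` op_spectrum T)" using spec_in_spectrum cst_le_sa(1)[OF assms(1)] .
  show "Re ` op_spectrum T \<subseteq> {m..M}" using op_spectrum_bounds(2,3)[OF assms] by auto
qed

lemma spec_in_Re: "spec_in T X \<Longrightarrow> z \<in> op_spectrum T \<Longrightarrow> Re z \<in> X"
  unfolding spec_in_def by auto

lemma spec_in_compact:
  assumes "spec_in S X" "spec_in T X"
  obtains Y where "compact Y" "Y \<subseteq> X" "spec_in S Y" "spec_in T Y"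
proof
  have sa: "self_adjoint S" "self_adjoint T" using assms spec_in_sa by auto
  let ?Y = "Re ` op_spectrum S \<union> Re ` op_spectrum T"
  show "compact ?Y"
    by (intro compact_Un compact_continuous_image compact_op_spectrum sa continuous_intros)
  show "?Y \<subseteq> X" using spec_in_Re[OF assms(1)] spec_in_Re[OF assms(2)] by auto
  show "spec_in S ?Y" "spec_in T ?Y"
    by (rule spec_in_mono[OF spec_in_spectrum[OF sa(1)]], simp)
      (rule spec_in_mono[OF spec_in_spectrum[OF sa(2)]], simp)
qed

lemma continuous_on_op_spectrum_Re:
  assumes "spec_in T X" "continuous_on X f"
  shows "continuous_on (op_spectrum T) (\<lambda>z. complex_of_real (f (Re z)))"
proof -
  have "continuous_on (op_spectrum T) (\<lambda>z. f (Re z))"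
    by (rule continuous_on_compose2[OF assms(2)]) (auto intro: continuous_intros spec_in_Re[OF assms(1)])
  then show ?thesis by (rule continuous_on_of_real)
qed

lemma op_fun_eq:
  assumes "spec_in T X" "continuous_on X f"
  shows "op_fun f T = fcal T (\<lambda>z. complex_of_real (f (Re z)))"
  unfolding op_fun_def by (rule cfc_eq_fcal[OF spec_in_sa[OF assms(1)] continuous_on_op_spectrum_Re[OF assms]])

lemma op_fun_mult:
  assumes "spec_in T X" "continuous_on X f" "continuous_on X g"
  shows "op_fun (\<lambda>t. f t * g t) T = op_fun f T * op_fun g T"
  using functional_calculusD(3)[OF functional_calculus_fcal[OF spec_in_sa[OF assms(1)]]
      continuous_on_op_spectrum_Re[OF assms(1,2)] continuous_on_op_spectrum_Re[OF assms(1,3)]] assms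
  by (simp add: op_fun_eq[where X = X] continuous_on_mult)

lemma op_fun_add:
  assumes "spec_in T X" "continuous_on X f" "continuous_on X g"
  shows "op_fun (\<lambda>t. f t + g t) T = op_fun f T + op_fun g T"
  using functional_calculusD(2)[OF functional_calculus_fcal[OF spec_in_sa[OF assms(1)]]
      continuous_on_op_spectrum_Re[OF assms(1,2)] continuous_on_op_spectrum_Re[OF assms(1,3)]] assms
  by (simp add: op_fun_eq[where X = X] continuous_on_add)

lemma op_fun_scale:
  assumes "spec_in T X" "continuous_on X f"
  shows "op_fun (\<lambda>t. c * f t) T = complex_of_real c *\<^sub>C op_fun f T"
  using functional_calculusD(4)[OF functional_calculus_fcal[OF spec_in_sa[OF assms(1)]]
      continuous_on_op_spectrum_Re[OF assms(1,2)], of "complex_of_real c"] assms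
  by (simp add: op_fun_eq[where X = X] continuous_on_mult continuous_on_const)

lemma op_fun_cong:
  assumes "spec_in T X" "continuous_on X f" "\<And>t. t \<in> X \<Longrightarrow> f t = g t"
  shows "op_fun f T = op_fun g T"
proof -
  have g: "continuous_on X g" using assms(2,3) continuous_on_cong by blast
  show ?thesis
    unfolding op_fun_eq[OF assms(1,2)] op_fun_eq[OF assms(1) g]
    by (rule functional_calculusD(1)[OF functional_calculus_fcal[OF spec_in_sa[OF assms(1)]]
          continuous_on_op_spectrum_Re[OF assms(1,2)] continuous_on_op_spectrum_Re[OF assms(1) g]])
      (use assms spec_in_Re in auto)
qed

lemma op_fun_self_adjoint:
  assumes "spec_in T X" "continuous_on X f"
  shows "self_adjoint (op_fun f T)"
  using functional_calculusD(5)[OF functional_calculus_fcal[OF spec_in_sa[OF assms(1)]] continuous_on_op_spectrum_Re[OF assms]]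
  by (simp add: op_fun_eq[OF assms] self_adjoint_def)

lemma op_fun_dist_poly_op:
  assumes "spec_in T X" "continuous_on X f" "0 \<le> e"
    and "\<And>t. t \<in> X \<Longrightarrow> cmod (poly p (complex_of_real t) - complex_of_real (f t)) \<le> e"
  shows "norm (poly_op p T - op_fun f T) \<le> e"
  unfolding op_fun_eq[OF assms(1,2)]
proof (rule fcal_dist_poly_op[OF spec_in_sa[OF assms(1)] continuous_on_op_spectrum_Re[OF assms(1,2)] assms(3)])
  fix z assume z: "z \<in> op_spectrum T"
  show "cmod (poly p z - complex_of_real (f (Re z))) \<le> e"
    using assms(4)[OF spec_in_Re[OF assms(1) z]] op_spectrum_real[OF spec_in_sa[OF assms(1)] z] by simp
qed

lemma op_fun_const:
  assumes "self_adjoint T"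
  shows "op_fun (\<lambda>t. c) T = cst c"
proof -
  from op_fun_dist_poly_op[OF spec_in_UNIV[OF assms], of "\<lambda>t. c" 0 "[:complex_of_real c:]"] show ?thesis by simp
qed

lemma op_fun_id:
  assumes "self_adjoint T"
  shows "op_fun (\<lambda>t. t) T = T"
proof -
  from op_fun_dist_poly_op[OF spec_in_UNIV[OF assms], of "\<lambda>t. t" 0 "[:0, 1:]"] show ?thesis by simp
qed

lemma op_fun_nonneg:
  assumes "spec_in T X" "continuous_on X f" "\<And>t. t \<in> X \<Longrightarrow> 0 \<le> f t"
  shows "0 \<le> op_fun f T"
proof -
  have s: "continuous_on X (\<lambda>t. sqrt (f t))" by (intro continuous_intros assms)
  have "op_fun f T = op_fun (\<lambda>t. sqrt (f t) * sqrt (f t)) T"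
    by (rule op_fun_cong[OF assms(1,2)]) (use assms(3) in simp)
  also have "\<dots> = adj (op_fun (\<lambda>t. sqrt (f t)) T) * op_fun (\<lambda>t. sqrt (f t)) T"
    using op_fun_self_adjoint[OF assms(1) s] unfolding op_fun_mult[OF assms(1) s s] self_adjoint_def by simp
  finally show ?thesis using positive_op_adj_mult positive_op_iff by metis
qed

lemma op_fun_minus:
  assumes "spec_in T X" "continuous_on X f"
  shows "op_fun (\<lambda>t. - f t) T = - op_fun f T"
  using op_fun_scale[OF assms, of "- 1"] by (simp add: scaleC_minus_left)

lemma op_fun_mono:
  assumes "spec_in T X" "continuous_on X f" "continuous_on X g" "\<And>t. t \<in> X \<Longrightarrow> f t \<le> g t"
  shows "op_fun f T \<le> op_fun g T"
proof -
  have "0 \<le> op_fun (\<lambda>t. g t + - f t) T"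
    by (rule op_fun_nonneg[OF assms(1)]) (use assms in \<open>auto intro!: continuous_intros\<close>)
  also have "\<dots> = op_fun g T + op_fun (\<lambda>t. - f t) T"
    using assms by (intro op_fun_add) (auto intro!: continuous_intros)
  also note op_fun_minus[OF assms(1,2)]
  finally show ?thesis by simp
qed

lemma op_fun_ge_cst:
  assumes "spec_in T X" "continuous_on X f" "\<And>t. t \<in> X \<Longrightarrow> c \<le> f t"
  shows "cst c \<le> op_fun f T"
  using op_fun_mono[OF assms(1) continuous_on_const assms(2), of c] assms
  by (simp add: op_fun_const[OF spec_in_sa[OF assms(1)]])

section \<open>Intertwining, norm continuity and inverses\<close>

lemma poly_sequence:
  fixes f :: "real \<Rightarrow> real"
  assumes "compact X" "continuous_on X f"
  obtains p :: "nat \<Rightarrow> complex poly"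
  where "\<And>n t. t \<in> X \<Longrightarrow> cmod (poly (p n) (of_real t) - of_real (f t)) \<le> 1 / real (Suc n)"
proof -
  have "\<exists>p. \<forall>t\<in>X. cmod (poly p (of_real t) - of_real (f t)) \<le> 1 / real (Suc n)" for n
    using real_poly_approx[OF assms, of "1 / real (Suc n)"] less_imp_le by (metis of_nat_0_less_iff zero_less_Suc zero_less_divide_1_iff)
  then have "\<forall>n. \<exists>p. \<forall>t\<in>X. cmod (poly p (of_real t) - of_real (f t)) \<le> 1 / real (Suc n)" by blast
  from choice[OF this] that show ?thesis by blast
qed

lemma tendsto_poly_op_op_fun:
  assumes "spec_in T X" "continuous_on X f"
    and "\<And>n t. t \<in> X \<Longrightarrow> cmod (poly (p n) (of_real t) - of_real (f t)) \<le> 1 / real (Suc n)"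
  shows "(\<lambda>n. poly_op (p n) T) \<longlonglongrightarrow> op_fun f T"
proof (rule LIM_zero_cancel, rule Lim_null_comparison)
  show "\<forall>\<^sub>F n in sequentially. norm (poly_op (p n) T - op_fun f T) \<le> 1 / real (Suc n)"
    by (intro always_eventually allI op_fun_dist_poly_op[OF assms(1,2)] assms(3)) auto
  show "(\<lambda>n. 1 / real (Suc n)) \<longlonglongrightarrow> 0"
    by (intro LIMSEQ_Suc lim_1_over_n)
qed

text \<open>Polynomials intertwine, and one sequence converges for both operators since their
  spectra lie in a common compact set. Allowing S and T to differ covers conjugation by a symmetry,
  the exchange of \<open>R * adj R\<close> with \<open>adj R * R\<close>, and restriction to the
  range of a reducing projection.\<close>

lemma op_fun_intertwine:
  assumes "spec_in S X" "spec_in T X" "continuous_on X f" "R * T = S * R"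
  shows "R * op_fun f T = op_fun f S * R"
proof -
  obtain Y where Y: "compact Y" "Y \<subseteq> X" "spec_in S Y" "spec_in T Y"
    using spec_in_compact[OF assms(1,2)] .
  have f: "continuous_on Y f" using assms(3) Y(2) continuous_on_subset by blast
  obtain p where p: "\<And>n t. t \<in> Y \<Longrightarrow> cmod (poly (p n) (of_real t) - of_real (f t)) \<le> 1 / real (Suc n)"
    using poly_sequence[OF Y(1) f] by blast
  have "(\<lambda>n. R * poly_op (p n) T) \<longlonglongrightarrow> R * op_fun f T"
    by (intro tendsto_mult tendsto_const tendsto_poly_op_op_fun[OF Y(4) f p])
  moreover have "(\<lambda>n. R * poly_op (p n) T) \<longlonglongrightarrow> op_fun f S * R"
    unfolding poly_op_intertwine[OF assms(4)]
    by (intro tendsto_mult tendsto_const tendsto_poly_op_op_fun[OF Y(3) f p])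
  ultimately show ?thesis using LIMSEQ_unique by blast
qed

text \<open>For polynomials this is the identity \<open>R p(R\<^sup>* R) R\<^sup>* = R R\<^sup>* p(R R\<^sup>*)\<close>.\<close>

lemma op_fun_flip:
  assumes "spec_in (R * adj R) X" "spec_in (adj R * R) X" "continuous_on X f"
  shows "R * op_fun f (adj R * R) * adj R = op_fun (\<lambda>t. t * f t) (R * adj R)"
proof -
  have "R * op_fun f (adj R * R) = op_fun f (R * adj R) * R"
    by (rule op_fun_intertwine[OF assms]) (simp add: mult.assoc)
  then have "R * op_fun f (adj R * R) * adj R = op_fun f (R * adj R) * (R * adj R)"
    by (simp add: mult.assoc)
  also have "\<dots> = op_fun (\<lambda>t. f t * t) (R * adj R)"
    using op_fun_mult[OF assms(1,3) continuous_on_id] op_fun_id[OF spec_in_sa[OF assms(1)]] by simp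
  finally show ?thesis by (simp add: mult.commute)
qed

lemma tendsto_poly_op:
  fixes T :: "'a::complex_hilbert bop"
  assumes "X \<longlonglongrightarrow> T"
  shows "(\<lambda>n. poly_op p (X n)) \<longlonglongrightarrow> poly_op p T"
  by (induction p) (auto intro!: tendsto_intros assms)

text \<open>One polynomial within e / 3 of \<open>f\<close> on the common compact set serves the
  limit and all members of the sequence, and polynomials are norm continuous.\<close>

lemma tendsto_op_fun:
  fixes T :: "'a::complex_hilbert bop"
  assumes "compact X" "continuous_on X f" "\<And>n. spec_in (S n) X" "spec_in T X" "S \<longlonglongrightarrow> T"
  shows "(\<lambda>n. op_fun f (S n)) \<longlonglongrightarrow> op_fun f T"
proof (rule metric_LIMSEQ_I)
  fix e :: real assume "0 < e"
  then obtain p where p: "\<And>t. t \<in> X \<Longrightarrow> cmod (poly p (of_real t) - of_real (f t)) < e / 3"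
    using real_poly_approx[OF assms(1,2), of "e / 3"] by auto
  have d: "norm (poly_op p R - op_fun f R) \<le> e / 3" if "spec_in R X" for R :: "'a bop"
    using \<open>0 < e\<close> by (intro op_fun_dist_poly_op[OF that assms(2)] less_imp_le[OF p]) auto
  obtain N where N: "\<And>n. N \<le> n \<Longrightarrow> norm (poly_op p (S n) - poly_op p T) < e / 3"
    using metric_LIMSEQ_D[OF tendsto_poly_op[OF assms(5), of p], of "e / 3"] \<open>0 < e\<close> unfolding dist_norm by auto
  have "dist (op_fun f (S n)) (op_fun f T) < e" if "N \<le> n" for n
  proof -
    have "norm (op_fun f (S n) - op_fun f T) =
        norm ((poly_op p (S n) - poly_op p T) - (poly_op p (S n) - op_fun f (S n)) + (poly_op p T - op_fun f T))" by simp
    also have "\<dots> \<le> norm (poly_op p (S n) - poly_op p T) + norm (poly_op p (S n) - op_fun f (S n)) + norm (poly_op p T - op_fun f T)"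
      by (metis (no_types, lifting) add_right_mono norm_triangle_ineq norm_triangle_ineq4 order_trans)
    also have "\<dots> < e" using N[OF that] d[OF assms(3)[of n]] d[OF assms(4)] by linarith
    finally show ?thesis by (simp add: dist_norm)
  qed
  then show "\<exists>N. \<forall>n\<ge>N. dist (op_fun f (S n)) (op_fun f T) < e" by blast
qed

lemma op_fun_inverse:
  assumes "spec_in T X" "continuous_on X f" "\<And>t. t \<in> X \<Longrightarrow> f t \<noteq> 0"
  shows "invertible_op (op_fun f T)" and "inv_op (op_fun f T) = op_fun (\<lambda>t. 1 / f t) T"
proof -
  have i: "continuous_on X (\<lambda>t. 1 / f t)" using assms by (intro continuous_intros) auto
  have "op_fun (\<lambda>t. f t * (1 / f t)) T = op_fun (\<lambda>t. 1) T" "op_fun (\<lambda>t. 1 / f t * f t) T = op_fun (\<lambda>t. 1) T"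
    using assms by (auto intro!: op_fun_cong[OF assms(1)] continuous_intros)
  then have *: "op_fun f T * op_fun (\<lambda>t. 1 / f t) T = 1" "op_fun (\<lambda>t. 1 / f t) T * op_fun f T = 1"
    using op_fun_mult[OF assms(1,2) i] op_fun_mult[OF assms(1) i assms(2)]
      op_fun_const[OF spec_in_sa[OF assms(1)], of 1] by simp_all
  then show "invertible_op (op_fun f T)" unfolding invertible_op_def by blast
  show "inv_op (op_fun f T) = op_fun (\<lambda>t. 1 / f t) T" using * by (intro inv_op_eqI)
qed

section \<open>Square roots and inverses\<close>

lemma spec_in_nonneg: "0 \<le> T \<Longrightarrow> spec_in T {0..}"
  using spec_in_mono[OF spec_in_Icc[of 0 T "norm T"], of "{0..}"] norm_le_cst(1)[OF bop_nonneg_sa order_refl, of T]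
  by simp

lemma op_fun_sqrt:
  assumes "0 \<le> T"
  shows "0 \<le> op_fun sqrt T" "op_fun sqrt T * op_fun sqrt T = T"
proof -
  note s = spec_in_nonneg[OF assms]
  have c: "continuous_on {0..} sqrt" by (intro continuous_intros)
  show "0 \<le> op_fun sqrt T" by (rule op_fun_nonneg[OF s c]) simp
  have "op_fun (\<lambda>t. sqrt t * sqrt t) T = op_fun (\<lambda>t. t) T"
    by (intro op_fun_cong[OF s]) (auto intro!: continuous_intros)
  then show "op_fun sqrt T * op_fun sqrt T = T"
    using op_fun_mult[OF s c c] op_fun_id[OF spec_in_sa[OF s]] by simp
qed

lemma nonneg_square_root:
  assumes "0 \<le> T"
  obtains R where "adj R = R" "R * R = T" "0 \<le> R"
  by (rule that[OF bop_nonneg_sa[OF op_fun_sqrt(1)[OF assms], unfolded self_adjoint_def]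
        op_fun_sqrt(2)[OF assms] op_fun_sqrt(1)[OF assms]])

lemma abs_op:
  shows "0 \<le> abs_op T" "abs_op T * abs_op T = adj T * T"
  unfolding abs_op_def by (rule op_fun_sqrt[OF positive_op_adj_mult[unfolded positive_op_iff]])+

text \<open>Let \<open>l < 0\<close> be the bottom of the spectrum of \<open>C = R - B\<close>, and \<open>G = R + B\<close>. Since
  \<open>2 (R\<^sup>2 - B\<^sup>2) = C G + G C \<ge> 0\<close>, on approximate eigenvectors of \<open>C\<close> for \<open>l\<close> the form of \<open>G\<close> is
  nearly \<open>0\<close>; but \<open>C \<ge> - G\<close>.\<close>

lemma nonneg_bop_le_of_square_le:
  fixes B R :: "'a::complex_hilbert bop"
  assumes "0 \<le> B" "0 \<le> R" "B * B \<le> R * R"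
  shows "B \<le> R"
proof (rule ccontr)
  assume nle: "\<not> B \<le> R"
  define C where "C = R - B"
  define G where "G = R + B"
  have sa: "self_adjoint B" "self_adjoint R" "self_adjoint C" "self_adjoint G"
    using bop_nonneg_sa assms by (auto simp: C_def G_def)
  define q where "q x = Re (cinner x (bop_apply C x))" for x
  define l where "l = Inf (q ` {x. norm x = 1})"
  have bdd: "bdd_below (q ` {x. norm x = 1})"
  proof (rule bdd_belowI2)
    fix x :: 'a assume "x \<in> {x. norm x = 1}"
    then show "- norm C \<le> q x"
      using spec[OF norm_le_cst(2)[OF sa(3) order_refl, unfolded cst_le_iff_form(1)[OF sa(3)]], of x]
      unfolding q_def by simp
  qed
  have lq: "l * (norm x)\<^sup>2 \<le> q x" for x
  proof (cases "x = 0")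
    case False
    have "l \<le> q ((1 / norm x) *\<^sub>R x)"
      unfolding l_def using False by (intro cInf_lower bdd imageI) simp
    also have "\<dots> = q x / (norm x)\<^sup>2"
      by (simp add: q_def bop_apply.scaleR_right cinner.scaleR_left cinner.scaleR_right power2_eq_square)
    finally show ?thesis using False by (simp add: field_simps)
  qed (simp add: q_def bop_zero cinner.zero_left)
  have "\<not> 0 \<le> C" using nle by (simp add: C_def)
  then have "\<not> (\<forall>x. 0 \<le> q x)"
    using bop_leI[of 0 C] sa(3) by (auto simp: q_def cinner.zero_right)
  then obtain x0 where x0: "q x0 < 0" by (auto simp: not_le)
  have "l < 0" using lq[of x0] x0 by (smt (verit) mult_nonneg_nonneg zero_le_power2)
  define D where "D = C - cst l"
  have "0 \<le> D" using lq cst_le_iff_form(1)[OF sa(3)] by (simp add: D_def q_def)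
  \<comment> \<open>The square root turns smallness of the form of \<open>D\<close> at
    \<open>x\<close>, which is |W x|^2, into smallness of the vector D x.\<close>
  then obtain W where W: "adj W = W" "W * W = D" by (rule nonneg_square_root)
  define N where "N = norm W * norm G"
  \<comment> \<open>The quantitative form for a unit vector on which the form of \<open>C\<close> is
    below l + s^2; as s tends to 0 the right side vanishes while l^2 does not.\<close>
  have key: "l\<^sup>2 < - l * s\<^sup>2 + N * s" if "0 < s" for s
  proof -
    have ne: "{x::'a. norm x = 1} \<noteq> {}"
    proof -
      have "x0 \<noteq> 0" using x0 by (auto simp: q_def bop_zero cinner.zero_left)
      then have "norm ((1 / norm x0) *\<^sub>R x0) = 1" by simp
      then show ?thesis by blast
    qed
    have "Inf (q ` {x. norm x = 1}) < l + s\<^sup>2" using that by (simp add: l_def)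
    then obtain x where x: "norm x = 1" "q x < l + s\<^sup>2"
      using cInf_lessD[of "q ` {x. norm x = 1}" "l + s\<^sup>2"] ne by auto
    define g where "g = Re (cinner x (bop_apply G x))"
    have "(norm (bop_apply W x))\<^sup>2 = Re (cinner x (bop_apply D x))"
      unfolding W(2)[symmetric] using cinner_adj_left[of W x "bop_apply W x"] W(1)
      by (simp add: Re_cinner_self[symmetric])
    also have "\<dots> = q x - l" using x(1) by (simp add: D_def q_def cinner.diff_right cinner_scaleC_right Re_cinner_self)
    also have "\<dots> \<le> s\<^sup>2" using x(2) by simp
    finally have Wx: "norm (bop_apply W x) \<le> s" by (rule power2_le_imp_le) (use that in simp)
    have "norm (bop_apply D x) \<le> norm W * norm (bop_apply W x)"
      unfolding W(2)[symmetric] by (simp add: norm_bop_apply)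
    also have "\<dots> \<le> norm W * s" using Wx by (simp add: mult_left_mono)
    finally have Dx: "norm (bop_apply D x) \<le> norm W * s" .
    have sq: "complex_of_real 2 *\<^sub>C (R * R - B * B) = C * G + G * C"
      using scaleC_add_left[of 1 1 "R * R - B * B"] by (simp add: C_def G_def algebra_simps)
    have "0 \<le> complex_of_real 2 *\<^sub>C (R * R - B * B)"
      using scale_bop_mono[of 0 "R * R - B * B" 2] assms(3) by simp
    then have "0 \<le> C * G + G * C" unfolding sq .
    from bop_leD[OF this, of x] have "0 \<le> Re (cinner x (bop_apply (C * G + G * C) x))"
      by (simp add: cinner.zero_right)
    also have "\<dots> = 2 * Re (cinner (bop_apply C x) (bop_apply G x))"
      using self_adjointD[OF sa(3), of x "bop_apply G x"] self_adjointD[OF sa(4), of x "bop_apply C x"]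
        Re_cinner_commute[of "bop_apply C x" "bop_apply G x"]
      by (simp add: cinner_add_right)
    also have "bop_apply C x = complex_of_real l *\<^sub>C x + bop_apply D x" by (simp add: D_def)
    also have "Re (cinner (complex_of_real l *\<^sub>C x + bop_apply D x) (bop_apply G x)) =
        l * g + Re (cinner (bop_apply D x) (bop_apply G x))"
      by (simp add: cinner_add_left cinner_scaleC_left g_def)
    finally have "- l * g \<le> Re (cinner (bop_apply D x) (bop_apply G x))" by simp
    also have "\<dots> \<le> norm (bop_apply D x) * norm (bop_apply G x)" by (rule Re_cinner_le)
    also have "\<dots> \<le> (norm W * s) * norm G"
      using norm_bop_apply[of G x] x(1) Dx by (intro mult_mono) (auto intro: order_trans[OF norm_ge_zero])
    finally have 1: "- l * g \<le> N * s" by (simp add: N_def mult_ac)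
    \<comment> \<open>C + G = 2 R, so positivity of \<open>R\<close> is what bounds \<open>C\<close>
      below by - G.\<close>
    have "0 \<le> Re (cinner x (bop_apply R x))" using bop_leD[OF assms(2), of x] by (simp add: cinner.zero_right)
    then have "- g \<le> q x"
      by (simp add: q_def g_def C_def G_def cinner.diff_right cinner_add_right)
    then have "- g < l + s\<^sup>2" using x(2) by simp
    then have "l * (l + s\<^sup>2) < l * (- g)" using \<open>l < 0\<close> by (simp only: mult_less_cancel_left_neg)
    then show ?thesis using 1 by (simp add: power2_eq_square algebra_simps)
  qed
  have "N \<ge> 0" by (simp add: N_def)
  \<comment> \<open>Chosen so that s^2 \<le> s and (N - l) s \<le> l^2, which contradicts
    \<open>key\<close>.\<close>
  define s where "s = min 1 (l\<^sup>2 / (- l + N))"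
  have p: "0 < - l + N" using \<open>l < 0\<close> \<open>0 \<le> N\<close> by simp
  then have s: "0 < s" "s \<le> 1" using \<open>l < 0\<close> by (auto simp: s_def)
  have "- l * s\<^sup>2 + N * s \<le> - l * s + N * s"
    using s \<open>l < 0\<close> by (simp add: power2_eq_square)
  also have "\<dots> = (- l + N) * s" by (simp add: algebra_simps)
  also have "\<dots> \<le> (- l + N) * (l\<^sup>2 / (- l + N))"
    using p by (intro mult_left_mono) (auto simp: s_def)
  also have "\<dots> = l\<^sup>2" using p by simp
  finally show False using key[OF s(1)] by simp
qed

lemma inv_op_self_adjoint:
  assumes "self_adjoint T" "invertible_op T"
  shows "self_adjoint (inv_op T)"
proof -
  have "adj (inv_op T) * T = 1" "T * adj (inv_op T) = 1"
    using inv_op[OF assms(2)] assms(1) by (metis adj_simps(3,7) self_adjoint_def)+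
  then show ?thesis unfolding self_adjoint_def using inv_op_eqI by metis
qed

text \<open>Put T u = x = S v and let R be the square root of S. Cauchy-Schwarz gives <x, u> = <R u,
  R v> \<le> |R u| |R v|, where |R u|^2 = <u, S u> \<le> <u, T u> = <x, u> and |R v|^2 = <x, v>.
  Squaring and cancelling yields <x, u> \<le> <x, v>.\<close>

lemma inv_op_antimono:
  assumes "0 \<le> S" "S \<le> T" "invertible_op S" "invertible_op T"
  shows "inv_op T \<le> inv_op S"
proof (rule bop_leI)
  have T: "0 \<le> T" using assms by (meson order_trans)
  show "self_adjoint (inv_op T)" "self_adjoint (inv_op S)"
    using assms T bop_nonneg_sa inv_op_self_adjoint by auto
  obtain R where R: "adj R = R" "R * R = S" using nonneg_square_root[OF assms(1)] .
  have RS: "cinner (bop_apply R u) (bop_apply R v) = cinner u (bop_apply S v)" for u v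
    using cinner_adj_left[of R u "bop_apply R v"] R by (metis bop_simps(6))
  fix x
  define u where "u = bop_apply (inv_op T) x"
  define v where "v = bop_apply (inv_op S) x"
  have Tu: "bop_apply T u = x" and Sv: "bop_apply S v = x"
    using inv_op(2)[OF assms(4)] inv_op(2)[OF assms(3)] unfolding u_def v_def by (metis bop_simps(2,6))+
  define a where "a = Re (cinner x u)"
  define b where "b = Re (cinner x v)"
  have "(norm (bop_apply R v))\<^sup>2 = b"
    unfolding b_def Re_cinner_self[symmetric] RS Sv by (rule Re_cinner_commute)
  moreover have Ru: "(norm (bop_apply R u))\<^sup>2 \<le> a"
    unfolding a_def Re_cinner_self[symmetric] RS
    using bop_leD[OF assms(2), of u] unfolding Tu by (simp add: Re_cinner_commute)
  moreover have "a \<le> norm (bop_apply R u) * norm (bop_apply R v)"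
    using Re_cinner_le[of "bop_apply R u" "bop_apply R v"] unfolding RS Sv a_def
    by (subst Re_cinner_commute)
  moreover have "0 \<le> a" using Ru by (rule order_trans[OF zero_le_power2])
  ultimately have "a\<^sup>2 \<le> a * b"
    by (smt (verit) mult_mono power2_eq_square power_mono power_mult_distrib zero_le_power2)
  then have "a \<le> b" using \<open>0 \<le> a\<close> \<open>_ = b\<close>
    by (cases "a = 0") (auto simp: power2_eq_square)
  then show "Re (cinner x (bop_apply (inv_op T) x)) \<le> Re (cinner x (bop_apply (inv_op S) x))"
    by (simp add: a_def b_def u_def v_def)
qed

text \<open>Invertibility gives |x| \<le> K |T x| \<le> K |R| |R x|, and |R x|^2 is the form of T,
  which is therefore bounded below. The maximum in the upper bound keeps it at least
  \<open>m\<close> on the zero space too.\<close>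

lemma positive_invertible_bounds:
  assumes "0 \<le> T" "invertible_op T"
  obtains m M where "0 < m" "m \<le> M" "cst m \<le> T" "T \<le> cst M"
proof -
  have sa: "self_adjoint T" using assms bop_nonneg_sa by blast
  obtain R where R: "adj R = R" "R * R = T" using nonneg_square_root[OF assms(1)] .
  obtain K where K: "0 < K" "\<And>x. norm x \<le> K * norm (bop_apply T x)"
    using invertible_op_bounds[OF assms(2)] by blast
  define m where "m = 1 / ((K * norm R)\<^sup>2 + 1)"
  have pos: "0 < (K * norm R)\<^sup>2 + 1" by (simp add: add_nonneg_pos)
  have m: "0 < m" using pos by (simp add: m_def)
  have "m * (norm x)\<^sup>2 \<le> Re (cinner x (bop_apply T x))" for x
  proof -
    have Rx: "(norm (bop_apply R x))\<^sup>2 = Re (cinner x (bop_apply T x))"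
      unfolding R(2)[symmetric] using cinner_adj_left[of R x "bop_apply R x"] R(1)
      by (simp add: Re_cinner_self[symmetric])
    have "norm x \<le> K * norm (bop_apply T x)" by (rule K)
    also have "\<dots> \<le> K * (norm R * norm (bop_apply R x))"
      unfolding R(2)[symmetric] using K(1) by (simp add: norm_bop_apply)
    finally have "(norm x)\<^sup>2 \<le> (K * (norm R * norm (bop_apply R x)))\<^sup>2" by (intro power_mono) auto
    also have "\<dots> = (K * norm R)\<^sup>2 * (norm (bop_apply R x))\<^sup>2" by (simp add: power_mult_distrib)
    also have "\<dots> \<le> ((K * norm R)\<^sup>2 + 1) * (norm (bop_apply R x))\<^sup>2" by (intro mult_right_mono) auto
    finally show ?thesis unfolding Rx[symmetric] m_def using pos by (simp add: field_simps)
  qed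
  then have 1: "cst m \<le> T" using cst_le_iff_form(1)[OF sa] by blast
  have 2: "T \<le> cst (max m (norm T))" by (rule norm_le_cst(1)[OF sa]) simp
  show ?thesis by (rule that[OF m _ 1 2]) simp
qed

section \<open>Operator concave functions and pinchings\<close>

text \<open>The form in which operator concavity is transported to other Hilbert spaces: only vectors in
  the range of the projection \<open>P\<close> are tested.\<close>

definition pinching_concave :: "'l::complex_hilbert itself \<Rightarrow> (real \<Rightarrow> real) \<Rightarrow> bool" where
  "pinching_concave (_ :: 'l itself) \<phi> \<longleftrightarrow>
     (\<forall>(D :: 'l bop) P m x. 0 < m \<and> cst m \<le> D \<and> adj P = P \<and> P * P = P \<and> bop_apply P x = x \<longrightarrow>
        Re (cinner x (bop_apply (op_fun \<phi> D) x)) \<le>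
        Re (cinner x (bop_apply (op_fun \<phi> (P * D * P + (1 - P) * D * (1 - P))) x)))"

lemma pinching_bounds:
  assumes P: "adj P = P" "P * P = P"
  shows "cst m \<le> D \<Longrightarrow> cst m \<le> P * D * P + (1 - P) * D * (1 - P)"
    and "D \<le> cst M \<Longrightarrow> P * D * P + (1 - P) * D * (1 - P) \<le> cst M"
proof -
  have e: "cst r = P * cst r * P + (1 - P) * cst r * (1 - P)" for r
    using P by (simp add: algebra_simps scaleC_diff_right)
  have Q: "adj (1 - P) = 1 - P" using P by simp
  show "cst m \<le> D \<Longrightarrow> cst m \<le> P * D * P + (1 - P) * D * (1 - P)"
    by (subst e) (use bop_sandwich_mono[of "cst m" D P] bop_sandwich_mono[of "cst m" D "1 - P"] P Q in
        \<open>auto intro: add_mono\<close>)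
  show "D \<le> cst M \<Longrightarrow> P * D * P + (1 - P) * D * (1 - P) \<le> cst M"
    by (subst e) (use bop_sandwich_mono[of D "cst M" P] bop_sandwich_mono[of D "cst M" "1 - P"] P Q in
        \<open>auto intro: add_mono\<close>)
qed

lemma spec_in_pos:
  assumes "0 < m" "cst m \<le> T"
  shows "spec_in T {0<..}"
  by (rule spec_in_mono[OF spec_in_Icc[OF assms(2) norm_le_cst(1)[OF cst_le_sa(1)[OF assms(2)] order_refl]]])
    (use assms(1) in auto)

lemma operator_concaveD:
  assumes conc: "operator_concave_on TYPE('l::complex_hilbert) {0<..} g"
    and A: "0 < a" "cst a \<le> (A :: 'l bop)" and B: "0 < b" "cst b \<le> B" and t: "0 \<le> t" "t \<le> 1"
  shows "complex_of_real t *\<^sub>C op_fun g A + complex_of_real (1 - t) *\<^sub>C op_fun g B \<le>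
    op_fun g (complex_of_real t *\<^sub>C A + complex_of_real (1 - t) *\<^sub>C B)"
proof -
  have cont': "continuous_on {0<..} (\<lambda>t. - g t)"
    using conc unfolding operator_concave_on_def operator_convex_on_def by blast
  then have cont: "continuous_on {0<..} g" using continuous_on_minus by fastforce
  define m where "m = min a b"
  have m: "0 < m" using A B by (simp add: m_def)
  let ?C = "complex_of_real t *\<^sub>C A + complex_of_real (1 - t) *\<^sub>C B"
  have "cst m \<le> A" "cst m \<le> B"
    using A(2) B(2) cst_mono[of m a] cst_mono[of m b] by (auto simp: m_def intro: order_trans)
  then have "complex_of_real t *\<^sub>C cst m + complex_of_real (1 - t) *\<^sub>C cst m \<le> ?C"
    using t by (intro add_mono scale_bop_mono) auto
  then have C: "cst m \<le> ?C"
    using scaleC_add_left[of "complex_of_real t" "complex_of_real (1 - t)" "cst m :: 'l bop"] by simp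
  note s = spec_in_pos[OF A] spec_in_pos[OF B] spec_in_pos[OF m C]
  have "op_fun (\<lambda>t. - g t) ?C \<le>
      complex_of_real t *\<^sub>C op_fun (\<lambda>t. - g t) A + complex_of_real (1 - t) *\<^sub>C op_fun (\<lambda>t. - g t) B"
    using conc s t unfolding operator_concave_on_def operator_convex_on_def spec_in_def by blast
  then have "- op_fun g ?C \<le> - (complex_of_real t *\<^sub>C op_fun g A + complex_of_real (1 - t) *\<^sub>C op_fun g B)"
    by (simp only: op_fun_minus[OF s(1) cont] op_fun_minus[OF s(2) cont] op_fun_minus[OF s(3) cont]
        scaleC_minus_right minus_add_distrib)
  then show ?thesis by (simp only: neg_le_iff_le)
qed

text \<open>The pinching is the average of D and U D U for the symmetry U = 2 P - 1. Since g(U D U)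
  = U g(D) U and U fixes x, concavity at weight 1/2 gives the claim.\<close>

lemma pinching_concave_of_operator_concave:
  assumes conc: "operator_concave_on TYPE('l::complex_hilbert) {0<..} g"
  shows "pinching_concave TYPE('l) g"
  unfolding pinching_concave_def
proof (intro allI impI, elim conjE)
  fix D P :: "'l bop" and m :: real and x :: 'l
  assume m: "0 < m" "cst m \<le> D" and P: "adj P = P" "P * P = P" and x: "bop_apply P x = x"
  have "continuous_on {0<..} (\<lambda>t. - g t)"
    using conc unfolding operator_concave_on_def operator_convex_on_def by blast
  then have cont: "continuous_on {0<..} g" using continuous_on_minus by fastforce
  define U where "U = P + P - 1"
  have U: "adj U = U" "U * U = 1" "bop_apply U x = x"
    using P x by (simp_all add: U_def algebra_simps)
  have UDU: "cst m \<le> U * D * U"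
    using bop_sandwich_mono[OF m(2), of U] U by (simp add: mult.assoc)
  have "D + U * D * U = (P * D * P + (1 - P) * D * (1 - P)) + (P * D * P + (1 - P) * D * (1 - P))"
    by (simp add: U_def algebra_simps)
  moreover have "(1/2) *\<^sub>C (X + X) = X" for X :: "'l bop"
    by (simp add: scaleC_add_right flip: scaleC_add_left)
  ultimately have "(1/2) *\<^sub>C (D + U * D * U) = P * D * P + (1 - P) * D * (1 - P)" by metis
  then have C: "complex_of_real (1/2) *\<^sub>C D + complex_of_real (1 - 1/2) *\<^sub>C (U * D * U) =
      P * D * P + (1 - P) * D * (1 - P)" by (simp add: scaleC_add_right)
  have "U * op_fun g D = op_fun g (U * D * U) * U"
    by (rule op_fun_intertwine[OF spec_in_pos[OF m(1) UDU] spec_in_pos[OF m] cont])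
      (simp add: mult.assoc U)
  then have gU: "op_fun g (U * D * U) = U * op_fun g D * U"
    using U by (simp add: mult.assoc)
  have "complex_of_real (1/2) *\<^sub>C op_fun g D + complex_of_real (1 - 1/2) *\<^sub>C op_fun g (U * D * U) \<le>
      op_fun g (P * D * P + (1 - P) * D * (1 - P))"
    using operator_concaveD[OF conc m m(1) UDU, of "1/2"] unfolding C by simp
  from bop_leD[OF this, of x]
  have "Re (cinner x (bop_apply (op_fun g D) x)) / 2 + Re (cinner x (bop_apply (U * op_fun g D * U) x)) / 2 \<le>
      Re (cinner x (bop_apply (op_fun g (P * D * P + (1 - P) * D * (1 - P))) x))"
    unfolding gU by (simp add: cinner_add_right cinner_scaleC_right del: bop_simps(6))
  moreover have "cinner x (bop_apply (U * op_fun g D * U) x) = cinner x (bop_apply (op_fun g D) x)"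
    using cinner_adj_left[of U x "bop_apply (op_fun g D) x"] U by simp
  ultimately show "Re (cinner x (bop_apply (op_fun g D) x)) \<le>
      Re (cinner x (bop_apply (op_fun g (P * D * P + (1 - P) * D * (1 - P))) x))" by simp
qed

text \<open>Write \<open>t B + (1 - t) = t A + (1 - t) E\<close> with \<open>E \<ge> 1\<close>, so that concavity and \<open>g(E) \<ge> 0\<close> give
  \<open>g (t B + (1 - t)) \<ge> t g(A)\<close>; let \<open>t\<close> tend to \<open>1\<close>.\<close>

lemma operator_monotone_of_operator_concave:
  assumes conc: "operator_concave_on TYPE('l::complex_hilbert) {0<..} g" and pos: "\<And>t. 0 < t \<Longrightarrow> 0 \<le> g t"
    and A: "0 < a" "cst a \<le> (A :: 'l bop)" and AB: "A \<le> B"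
  shows "op_fun g A \<le> op_fun g B"
proof -
  have "continuous_on {0<..} (\<lambda>t. - g t)"
    using conc unfolding operator_concave_on_def operator_convex_on_def by blast
  then have cont: "continuous_on {0<..} g" using continuous_on_minus by fastforce
  have B: "cst a \<le> B" using A AB by (meson order_trans)
  \<comment> \<open>The shift by 2 keeps every weight strictly between 0 and 1, as division by 1 - l
    n below requires.\<close>
  define l where "l n = 1 - 1 / real (n + 2)" for n :: nat
  have l: "0 < l n" "l n < 1" for n by (auto simp: l_def field_simps)
  define T where "T n = complex_of_real (l n) *\<^sub>C B + cst (1 - l n)" for n
  have "(\<lambda>n. 1 / real (n + 2)) \<longlonglongrightarrow> 0"
    using LIMSEQ_ignore_initial_segment[OF lim_1_over_n[where 'a = real], of 2] by simp
  then have "l \<longlonglongrightarrow> 1 - 0" unfolding l_def by (intro tendsto_diff tendsto_const)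
  then have llim: "l \<longlonglongrightarrow> 1" by simp
  have sc: "(\<lambda>n. complex_of_real (f n) *\<^sub>C (S::'l bop)) \<longlonglongrightarrow> complex_of_real c *\<^sub>C S"
    if "f \<longlonglongrightarrow> c" for f c S
    unfolding scaleR_bop_def[symmetric] by (intro tendsto_scaleR that tendsto_const)
  have "T \<longlonglongrightarrow> complex_of_real 1 *\<^sub>C B + cst (1 - 1)"
    unfolding T_def by (intro tendsto_add sc tendsto_diff tendsto_const llim)
  then have Tlim: "T \<longlonglongrightarrow> B" by simp
  \<comment> \<open>Each T n is a convex combination of B and 1, so all their spectra lie in one
    compact interval of positive reals.\<close>
  define m where "m = min a 1"
  define M where "M = max (norm B) 1"
  have m: "0 < m" using A by (simp add: m_def)
  have mB: "cst m \<le> B" using B cst_mono[of m a] by (auto simp: m_def intro: order_trans)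
  have BM: "B \<le> cst M" using norm_le_cst(1)[OF cst_le_sa(1)[OF B], of M] by (simp add: M_def)
  have conv: "cst r = complex_of_real (l n) *\<^sub>C cst r + complex_of_real (1 - l n) *\<^sub>C cst r" for r n
    by (simp flip: scaleC_add_left add: algebra_simps)
  have Ts: "spec_in (T n) {m..M}" for n
  proof (rule spec_in_Icc)
    have c: "cst (1 - l n) = complex_of_real (1 - l n) *\<^sub>C cst 1" by simp
    show "cst m \<le> T n"
      unfolding T_def c by (subst conv[of m n]) (use l[of n] mB in \<open>intro add_mono scale_bop_mono cst_mono, auto simp: m_def\<close>)
    show "T n \<le> cst M"
      unfolding T_def c by (subst conv[of M n]) (use l[of n] BM in \<open>intro add_mono scale_bop_mono cst_mono, auto simp: M_def\<close>)
  qed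
  have sub: "{m..M} \<subseteq> {0<..}" using m by auto
  have gT: "(\<lambda>n. op_fun g (T n)) \<longlonglongrightarrow> op_fun g B"
    by (rule tendsto_op_fun[OF compact_Icc continuous_on_subset[OF cont sub] Ts spec_in_Icc[OF mB BM] Tlim])
  have gA: "(\<lambda>n. complex_of_real (l n) *\<^sub>C op_fun g A) \<longlonglongrightarrow> op_fun g A"
    using sc[OF llim, of "op_fun g A"] by simp
  show ?thesis
  proof (rule bop_le_tendsto[OF gA gT])
    fix n
    define E where "E = complex_of_real (l n / (1 - l n)) *\<^sub>C (B - A) + 1"
    have "0 \<le> complex_of_real (l n / (1 - l n)) *\<^sub>C (B - A)"
      using scale_bop_mono[of 0 "B - A" "l n / (1 - l n)"] AB l[of n] by simp
    then have E: "cst 1 \<le> E" by (simp add: E_def)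
    have "complex_of_real (1 - l n) *\<^sub>C E = complex_of_real ((1 - l n) * (l n / (1 - l n))) *\<^sub>C (B - A) + cst (1 - l n)"
      unfolding E_def scaleC_add_right scaleC_scaleC of_real_mult ..
    also have "(1 - l n) * (l n / (1 - l n)) = l n" using l[of n] by simp
    finally have TE: "T n = complex_of_real (l n) *\<^sub>C A + complex_of_real (1 - l n) *\<^sub>C E"
      by (simp add: T_def scaleC_diff_right)
    have "0 \<le> op_fun g E"
      by (rule op_fun_nonneg[OF spec_in_pos[OF _ E] cont]) (auto intro: pos)
    then have "0 \<le> complex_of_real (1 - l n) *\<^sub>C op_fun g E"
      using scale_bop_mono[of 0 "op_fun g E" "1 - l n"] l[of n] by simp
    then have "complex_of_real (l n) *\<^sub>C op_fun g A \<le>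
        complex_of_real (l n) *\<^sub>C op_fun g A + complex_of_real (1 - l n) *\<^sub>C op_fun g E" by simp
    also have "\<dots> \<le> op_fun g (T n)"
      unfolding TE by (rule operator_concaveD[OF conc A _ E]) (use l[of n] in auto)
    finally show "complex_of_real (l n) *\<^sub>C op_fun g A \<le> op_fun g (T n)" .
  qed
qed

lemma op_fun_cst: "op_fun f (cst a :: 'a::complex_hilbert bop) = cst (f a)"
proof -
  have s: "spec_in (cst a :: 'a bop) {a..a}" by (rule spec_in_Icc) auto
  have "op_fun f (cst a :: 'a bop) = op_fun (\<lambda>t. f a) (cst a)"
    by (rule op_fun_cong[OF s]) auto
  then show ?thesis using op_fun_const[OF spec_in_sa[OF s]] by simp
qed

text \<open>Lets operator inequalities between scalar operators be read back as inequalities between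
  numbers.\<close>

lemma cst_le_cst_iff:
  assumes "(1::'a::complex_hilbert bop) \<noteq> 0"
  shows "(cst a :: 'a bop) \<le> cst b \<longleftrightarrow> a \<le> b"
proof
  assume ab: "(cst a :: 'a bop) \<le> cst b"
  obtain x :: 'a where "x \<noteq> 0" using assms bop_ext[of 1 "0::'a bop"] by auto
  moreover have "a * (norm x)\<^sup>2 \<le> b * (norm x)\<^sup>2"
    using bop_leD[OF ab, of x] by (simp add: cinner_scaleC_right Re_cinner_self)
  ultimately show "a \<le> b" by simp
qed (rule cst_mono)

text \<open>The Hansen--Pedersen argument. For \<open>P\<^sub>\<delta> = P + \<delta> (1 - P)\<close> monotonicity gives
  \<open>\<phi>(\<surd>D P\<^sub>\<delta>\<^sup>2 \<surd>D) \<le> \<phi>(D)\<close>; conjugating by \<open>P\<^sub>\<delta> \<surd>D\<close> turns this into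
  \<open>h(P\<^sub>\<delta> D P\<^sub>\<delta>) \<le> P\<^sub>\<delta> h(D) P\<^sub>\<delta>\<close> for \<open>h(t) = t \<phi>(t)\<close>, and \<open>\<delta>\<close> tends to \<open>0\<close>.\<close>

lemma pinching_convex_of_operator_monotone:
  assumes mono: "\<And>a (A :: 'l::complex_hilbert bop) B. 0 < a \<Longrightarrow> cst a \<le> A \<Longrightarrow> A \<le> B \<Longrightarrow> op_fun \<phi> A \<le> op_fun \<phi> B"
    and cont: "continuous_on {0<..} \<phi>" and cont0: "continuous_on {0..} (\<lambda>t. t * \<phi> t)"
  shows "pinching_concave TYPE('l) (\<lambda>t. - (t * \<phi> t))"
  unfolding pinching_concave_def
proof (intro allI impI, elim conjE)
  fix D P :: "'l bop" and m :: real and x :: 'l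
  assume m: "0 < m" "cst m \<le> D" and P: "adj P = P" "P * P = P" and x: "bop_apply P x = x"
  let ?h = "\<lambda>t. t * \<phi> t"
  define M where "M = norm D"
  have DM: "D \<le> cst M" unfolding M_def by (rule norm_le_cst(1)[OF cst_le_sa(1)[OF m(2)] order_refl])
  have "0 \<le> D" using m cst_mono[of 0 m] by (auto intro: order_trans)
  then obtain R where R: "adj R = R" "R * R = D" by (rule nonneg_square_root)
  have sD: "spec_in D {0<..}" by (rule spec_in_pos[OF m])
  have RD: "R * op_fun \<phi> D * R = op_fun ?h D"
    using op_fun_flip[of R "{0<..}" \<phi>] sD cont by (simp add: R)
  define d where "d n = 1 / real (n + 2)" for n :: nat
  have d: "0 < d n" "d n < 1" for n by (auto simp: d_def field_simps)
  have dlim: "d \<longlonglongrightarrow> 0" unfolding d_def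
    using LIMSEQ_ignore_initial_segment[OF lim_1_over_n[where 'a = real], of 2] by simp
  define Pd where "Pd n = P + complex_of_real (d n) *\<^sub>C (1 - P)" for n
  have adjPd: "adj (Pd n) = Pd n" for n using P by (simp add: Pd_def)
  have Pd2: "Pd n * Pd n = P + complex_of_real ((d n)\<^sup>2) *\<^sub>C (1 - P)" for n
    using P by (simp add: Pd_def algebra_simps power2_eq_square scaleC_diff_right scaleC_add_right)
  have Q0: "0 \<le> 1 - P"
    using positive_op_adj_mult[of "1 - P"] P by (simp add: positive_op_iff algebra_simps)
  have Pd2_le: "Pd n * Pd n \<le> cst 1" for n
  proof -
    have "complex_of_real ((d n)\<^sup>2) *\<^sub>C (1 - P) \<le> complex_of_real 1 *\<^sub>C (1 - P)"
      using scale_bop_mono[OF Q0, of "1 - (d n)\<^sup>2"] d[of n] power_le_one[of "d n" 2]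
      by (simp add: scaleC_diff_left)
    then show ?thesis unfolding Pd2 by (simp add: le_diff_eq add.commute)
  qed
  have Pd2_ge: "cst ((d n)\<^sup>2) \<le> Pd n * Pd n" for n
  proof -
    have P0: "0 \<le> P" using positive_op_adj_mult[of P] P by (simp add: positive_op_iff)
    have "0 \<le> complex_of_real (1 - (d n)\<^sup>2) *\<^sub>C P"
      using scale_bop_mono[OF P0, of "1 - (d n)\<^sup>2"] d[of n] power_le_one[of "d n" 2] by simp
    also have "\<dots> = Pd n * Pd n - cst ((d n)\<^sup>2)" unfolding Pd2 by (simp add: scaleC_diff_left scaleC_diff_right)
    finally show ?thesis by simp
  qed
  have step: "op_fun ?h (Pd n * D * Pd n) \<le> Pd n * op_fun ?h D * Pd n"
    and spPd: "spec_in (Pd n * D * Pd n) {0..M}" for n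
  proof -
    define X where "X = Pd n * R"
    \<comment> \<open>The positive parameter \<open>d n\<close> makes \<open>adj X * X\<close>
      bounded below, so that monotonicity on the open half-line applies; for P itself this bound
      could fail.\<close>
    define a where "a = m * (d n)\<^sup>2"
    have a: "0 < a" using m d[of n] by (simp add: a_def)
    have XX: "X * adj X = Pd n * D * Pd n" "adj X * X = R * (Pd n * Pd n) * R"
      by (simp_all add: X_def adjPd R mult.assoc flip: R(2))
    have up1: "adj X * X \<le> D"
      using bop_sandwich_mono[OF Pd2_le[of n], of R] R unfolding XX by simp
    have "complex_of_real ((d n)\<^sup>2) *\<^sub>C cst m \<le> complex_of_real ((d n)\<^sup>2) *\<^sub>C D"
      by (intro scale_bop_mono m) simp
    also have "\<dots> \<le> adj X * X"
      using bop_sandwich_mono[OF Pd2_ge[of n], of R] R unfolding XX by simp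
    finally have lo1: "cst a \<le> adj X * X" by (simp add: a_def mult.commute)
    have "complex_of_real m *\<^sub>C cst ((d n)\<^sup>2) \<le> complex_of_real m *\<^sub>C (Pd n * Pd n)"
      using m by (intro scale_bop_mono Pd2_ge) simp
    also have "\<dots> \<le> X * adj X"
      using bop_sandwich_mono[OF m(2), of "Pd n"] adjPd unfolding XX by simp
    finally have lo2: "cst a \<le> X * adj X" by (simp add: a_def)
    have "X * adj X \<le> complex_of_real M *\<^sub>C (Pd n * Pd n)"
      using bop_sandwich_mono[OF DM, of "Pd n"] adjPd unfolding XX by simp
    also have "\<dots> \<le> complex_of_real M *\<^sub>C cst 1"
      by (intro scale_bop_mono Pd2_le) (simp add: M_def)
    finally have up2: "X * adj X \<le> cst M" by simp
    show "spec_in (Pd n * D * Pd n) {0..M}"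
      using spec_in_mono[OF spec_in_Icc[OF lo2 up2], of "{0..M}"] a unfolding XX by auto
    have "op_fun \<phi> (adj X * X) \<le> op_fun \<phi> D" by (rule mono[OF a lo1 up1])
    from bop_sandwich_mono[OF this, of "adj X"]
    have "X * op_fun \<phi> (adj X * X) * adj X \<le> X * op_fun \<phi> D * adj X" by simp
    also have "X * op_fun \<phi> (adj X * X) * adj X = op_fun ?h (X * adj X)"
      by (rule op_fun_flip[OF spec_in_pos[OF a lo2] spec_in_pos[OF a lo1] cont])
    also have "X * op_fun \<phi> D * adj X = Pd n * op_fun ?h D * Pd n"
      unfolding RD[symmetric] by (simp add: X_def adjPd R mult.assoc)
    finally show "op_fun ?h (Pd n * D * Pd n) \<le> Pd n * op_fun ?h D * Pd n" unfolding XX .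
  qed
  have "(\<lambda>n. d n *\<^sub>R (1 - P)) \<longlonglongrightarrow> 0 *\<^sub>R (1 - P)"
    by (intro tendsto_scaleR dlim tendsto_const)
  then have "(\<lambda>n. P + d n *\<^sub>R (1 - P)) \<longlonglongrightarrow> P + 0 *\<^sub>R (1 - P)"
    by (intro tendsto_add tendsto_const)
  then have Plim: "Pd \<longlonglongrightarrow> P" by (simp add: Pd_def[abs_def] scaleR_bop_def)
  have "0 \<le> P * D * P" using bop_sandwich_mono[OF \<open>0 \<le> D\<close>, of P] P by simp
  moreover have "P * D * P \<le> cst M"
  proof -
    have "P * D * P \<le> complex_of_real M *\<^sub>C P" using bop_sandwich_mono[OF DM, of P] P by simp
    also have "\<dots> \<le> cst M"
      using scale_bop_mono[OF Q0, of M] by (simp add: M_def scaleC_diff_right)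
    finally show ?thesis .
  qed
  \<comment> \<open>0 may belong to the spectrum of P D P, since it vanishes off the range of P; the
    limit therefore uses continuity of t \<phi>(t) on the closed half-line.\<close>
  ultimately have sPDP: "spec_in (P * D * P) {0..M}" by (intro spec_in_Icc) auto
  have "op_fun ?h (P * D * P) \<le> P * op_fun ?h D * P"
  proof (rule bop_le_tendsto[OF _ _ step])
    show "(\<lambda>n. op_fun ?h (Pd n * D * Pd n)) \<longlonglongrightarrow> op_fun ?h (P * D * P)"
      by (rule tendsto_op_fun[OF compact_Icc continuous_on_subset[OF cont0] spPd sPDP])
        (auto intro!: tendsto_mult Plim)
    show "(\<lambda>n. Pd n * op_fun ?h D * Pd n) \<longlonglongrightarrow> P * op_fun ?h D * P"
      by (intro tendsto_mult Plim tendsto_const)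
  qed
  from bop_leD[OF this, of x]
  have 1: "Re (cinner x (bop_apply (op_fun ?h (P * D * P)) x)) \<le> Re (cinner x (bop_apply (op_fun ?h D) x))"
    using cinner_adj_left[of P x "bop_apply (op_fun ?h D) x"] P x by simp
  define C where "C = P * D * P + (1 - P) * D * (1 - P)"
  have mC: "cst m \<le> C" unfolding C_def by (rule pinching_bounds(1)[OF P m(2)])
  have sC: "spec_in C {0<..}" by (rule spec_in_pos[OF m(1) mC])
  have sC0: "spec_in C {0..}" by (rule spec_in_mono[OF sC]) auto
  have sPDP0: "spec_in (P * D * P) {0..}" by (rule spec_in_mono[OF sPDP]) auto
  \<comment> \<open>P intertwines the pinching with the compression, so h(C) and h(P D P) have the
    same form on the range of P.\<close>
  have "P * C = (P * P) * D * P + (P * (1 - P)) * D * (1 - P)"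
    by (simp only: C_def distrib_left mult.assoc)
  also have "\<dots> = P * D * (P * P)" using P by (simp add: right_diff_distrib)
  also have "\<dots> = (P * D * P) * P" by (simp only: mult.assoc)
  finally have "P * C = (P * D * P) * P" .
  from op_fun_intertwine[OF sPDP0 sC0 cont0 this]
  have "P * op_fun ?h C = op_fun ?h (P * D * P) * P" .
  then have "bop_apply P (bop_apply (op_fun ?h C) x) = bop_apply (op_fun ?h (P * D * P)) x"
    using x by (metis bop_simps(6))
  then have "cinner x (bop_apply (op_fun ?h C) x) = cinner x (bop_apply (op_fun ?h (P * D * P)) x)"
    using cinner_adj_left[of P x "bop_apply (op_fun ?h C) x"] P x by simp
  with 1 have 2: "Re (cinner x (bop_apply (op_fun ?h C) x)) \<le> Re (cinner x (bop_apply (op_fun ?h D) x))" by simp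
  have ch: "continuous_on {0<..} ?h" by (intro continuous_intros cont)
  have "op_fun (\<lambda>t. - ?h t) D = - op_fun ?h D" "op_fun (\<lambda>t. - ?h t) C = - op_fun ?h C"
    using op_fun_minus[OF sD ch] op_fun_minus[OF sC ch] by auto
  with 2 show "Re (cinner x (bop_apply (op_fun (\<lambda>t. - ?h t) D) x)) \<le>
      Re (cinner x (bop_apply (op_fun (\<lambda>t. - ?h t) (P * D * P + (1 - P) * D * (1 - P))) x))"
    unfolding C_def[symmetric] by (simp add: cinner.minus_right)
qed

section \<open>Finite orthonormal families\<close>

definition orthonormal_on :: "'i set \<Rightarrow> ('i \<Rightarrow> 'a::complex_hilbert) \<Rightarrow> bool" where
  "orthonormal_on I b \<longleftrightarrow> (\<forall>i\<in>I. \<forall>j\<in>I. cinner (b i) (b j) = (if i = j then 1 else 0))"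

definition diag_op :: "'i set \<Rightarrow> ('i \<Rightarrow> real) \<Rightarrow> ('i \<Rightarrow> 'a::complex_hilbert) \<Rightarrow> 'a bop" where
  "diag_op I c b = Bop (\<lambda>x. \<Sum>i\<in>I. (complex_of_real (c i) * cinner (b i) x) *\<^sub>C b i)"

lemma diag_op_apply:
  "bop_apply (diag_op I c b) x = (\<Sum>i\<in>I. (complex_of_real (c i) * cinner (b i) x) *\<^sub>C b i)"
proof -
  let ?T = "\<lambda>x. \<Sum>i\<in>I. (complex_of_real (c i) * cinner (b i) x) *\<^sub>C b i"
  have "bop_apply (Bop ?T) = ?T"
  proof (rule bop_apply_Bop)
    show "?T (x + y) = ?T x + ?T y" for x y
      by (simp add: cinner_add_right distrib_left scaleC_add_left sum.distrib)
    show "?T (a *\<^sub>C x) = a *\<^sub>C ?T x" for a x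
      by (simp add: cinner_scaleC_right scaleC_sum_right mult_ac)
    show "norm (?T x) \<le> (\<Sum>i\<in>I. \<bar>c i\<bar> * (norm (b i) * norm (b i))) * norm x" for x
    proof -
      have "norm (?T x) \<le> (\<Sum>i\<in>I. norm ((complex_of_real (c i) * cinner (b i) x) *\<^sub>C b i))"
        by (rule norm_sum)
      also have "\<dots> \<le> (\<Sum>i\<in>I. \<bar>c i\<bar> * (norm (b i) * norm (b i)) * norm x)"
      proof (rule sum_mono)
        fix i
        have "norm ((complex_of_real (c i) * cinner (b i) x) *\<^sub>C b i) = \<bar>c i\<bar> * (cmod (cinner (b i) x) * norm (b i))"
          by (simp add: scaleC_bound norm_mult)
        also have "\<dots> \<le> \<bar>c i\<bar> * ((norm (b i) * norm x) * norm (b i))"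
          by (intro mult_left_mono mult_right_mono cauchy_schwarz) auto
        finally show "norm ((complex_of_real (c i) * cinner (b i) x) *\<^sub>C b i) \<le> \<bar>c i\<bar> * (norm (b i) * norm (b i)) * norm x"
          by (simp add: mult_ac)
      qed
      finally show ?thesis by (simp add: sum_distrib_right)
    qed
  qed
  then show ?thesis by (simp add: diag_op_def)
qed

lemma cinner_diag_op:
  "cinner y (bop_apply (diag_op I c b) x) = (\<Sum>i\<in>I. complex_of_real (c i) * (cnj (cinner (b i) y) * cinner (b i) x))"
proof -
  have "cinner y (b i) = cnj (cinner (b i) y)" for i by (rule cinner_commute)
  then show ?thesis
    by (simp add: diag_op_apply cinner.sum_right cinner_scaleC_right mult_ac)
qed

lemma adj_diag_op: "adj (diag_op I c b) = diag_op I c b"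
proof (rule adj_eqI)
  fix x y
  have "cinner (bop_apply (diag_op I c b) x) y = cnj (cinner y (bop_apply (diag_op I c b) x))"
    by (rule cinner_commute)
  also have "\<dots> = cinner x (bop_apply (diag_op I c b) y)"
    by (simp add: cinner_diag_op mult_ac)
  finally show "cinner (bop_apply (diag_op I c b) x) y = cinner x (bop_apply (diag_op I c b) y)" .
qed

lemma cinner_diag_op_self:
  "Re (cinner x (bop_apply (diag_op I c b) x)) = (\<Sum>i\<in>I. c i * (cmod (cinner (b i) x))\<^sup>2)"
proof -
  have "cnj z * z = complex_of_real ((cmod z)\<^sup>2)" for z
    by (metis complex_norm_square mult.commute of_real_power)
  then show ?thesis by (simp add: cinner_diag_op flip: of_real_mult)
qed

lemma diag_op_basis:
  assumes "finite I" "orthonormal_on I b" "j \<in> I"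
  shows "bop_apply (diag_op I c b) (b j) = complex_of_real (c j) *\<^sub>C b j"
proof -
  have "bop_apply (diag_op I c b) (b j) = (\<Sum>i\<in>I. if i = j then complex_of_real (c j) *\<^sub>C b j else 0)"
    unfolding diag_op_apply using assms(2,3) by (intro sum.cong) (auto simp: orthonormal_on_def)
  then show ?thesis using assms by simp
qed

lemma diag_op_projection:
  assumes "finite I" "orthonormal_on I b"
  shows "diag_op I (\<lambda>i. 1) b * diag_op I (\<lambda>i. 1) b = diag_op I (\<lambda>i. 1) b"
proof (rule bop_ext)
  fix x
  have "bop_apply (diag_op I (\<lambda>i. 1) b) (bop_apply (diag_op I (\<lambda>i. 1) b) x) =
      (\<Sum>i\<in>I. (complex_of_real 1 * cinner (b i) x) *\<^sub>C bop_apply (diag_op I (\<lambda>i. 1) b) (b i))"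
    by (subst (2) diag_op_apply) (simp add: bop_sum bop_scaleC)
  also have "\<dots> = bop_apply (diag_op I (\<lambda>i. 1) b) x"
    unfolding diag_op_apply[of I _ b x] by (intro sum.cong) (auto simp: diag_op_basis[OF assms])
  finally show "bop_apply (diag_op I (\<lambda>i. 1) b * diag_op I (\<lambda>i. 1) b) x = bop_apply (diag_op I (\<lambda>i. 1) b) x"
    by simp
qed

lemma bessel:
  assumes "finite I" "orthonormal_on I b"
  shows "(\<Sum>i\<in>I. (cmod (cinner (b i) x))\<^sup>2) \<le> (norm x)\<^sup>2"
proof -
  let ?P = "diag_op I (\<lambda>i. 1) b"
  have "0 \<le> adj (1 - ?P) * (1 - ?P)" using positive_op_adj_mult positive_op_iff by blast
  also have "adj (1 - ?P) * (1 - ?P) = 1 - ?P"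
    by (simp add: adj_diag_op algebra_simps diag_op_projection[OF assms])
  finally have "?P \<le> 1" by simp
  from bop_leD[OF this, of x] show ?thesis
    by (simp add: cinner_diag_op_self Re_cinner_self)
qed

text \<open>The shift gives the operator the value \<open>m\<close> on the orthogonal complement of
  the family, so the lower bound holds on the whole space. The upper bound is Bessel's
  inequality.\<close>

lemma diag_op_bounds:
  assumes "finite I" "orthonormal_on I b" "\<And>i. i \<in> I \<Longrightarrow> m \<le> c i \<and> c i \<le> M" "m \<le> M"
  shows "cst m \<le> cst m + diag_op I (\<lambda>i. c i - m) b" "cst m + diag_op I (\<lambda>i. c i - m) b \<le> cst M"
proof -
  have sa: "self_adjoint (diag_op I (\<lambda>i. c i - m) b)" by (simp add: self_adjoint_def adj_diag_op)
  have "0 \<le> diag_op I (\<lambda>i. c i - m) b"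
    by (rule bop_leI[OF _ sa]) (use assms(3) in \<open>auto simp: cinner_diag_op_self cinner.zero_right intro!: sum_nonneg\<close>)
  then show "cst m \<le> cst m + diag_op I (\<lambda>i. c i - m) b" by simp
  have "diag_op I (\<lambda>i. c i - m) b \<le> cst (M - m)"
    unfolding cst_le_iff_form(2)[OF sa]
  proof
    fix x
    have "Re (cinner x (bop_apply (diag_op I (\<lambda>i. c i - m) b) x)) \<le> (\<Sum>i\<in>I. (M - m) * (cmod (cinner (b i) x))\<^sup>2)"
      unfolding cinner_diag_op_self using assms(3) by (intro sum_mono mult_right_mono) auto
    also have "\<dots> = (M - m) * (\<Sum>i\<in>I. (cmod (cinner (b i) x))\<^sup>2)" by (simp add: sum_distrib_left)
    also have "\<dots> \<le> (M - m) * (norm x)\<^sup>2" using assms(4) by (intro mult_left_mono bessel[OF assms(1,2)]) auto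
    finally show "Re (cinner x (bop_apply (diag_op I (\<lambda>i. c i - m) b) x)) \<le> (M - m) * (norm x)\<^sup>2" .
  qed
  then have "cst m + diag_op I (\<lambda>i. c i - m) b \<le> cst m + cst (M - m)" by (rule add_left_mono)
  also have "cst m + cst (M - m) = cst M" by (simp flip: scaleC_add_left)
  finally show "cst m + diag_op I (\<lambda>i. c i - m) b \<le> cst M" .
qed

lemma orthonormal_sum:
  assumes "finite I" "orthonormal_on I b" "j \<in> I"
  shows "cinner (b j) (\<Sum>i\<in>I. c i *\<^sub>C b i) = c j"
proof -
  have "cinner (b j) (\<Sum>i\<in>I. c i *\<^sub>C b i) = (\<Sum>i\<in>I. if i = j then c j else 0)"
    unfolding cinner.sum_right using assms(2,3)
    by (intro sum.cong) (auto simp: orthonormal_on_def cinner_scaleC_right)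
  then show ?thesis using assms by simp
qed

lemma orthonormal_cinner_sums:
  assumes "finite I" "orthonormal_on I b"
  shows "cinner (\<Sum>i\<in>I. c i *\<^sub>C b i) (\<Sum>i\<in>I. d i *\<^sub>C b i) = (\<Sum>i\<in>I. cnj (c i) * d i)"
  unfolding cinner.sum_left[of _ I] by (intro sum.cong) (auto simp: cinner_scaleC_left orthonormal_sum[OF assms])

text \<open>The family is indexed by itself. The third clause says that \<open>F\<close> lies in the
  span of \<open>E\<close>; the fourth says the converse by duality, in the form needed later to see
  that the projection onto this span kills every vector orthogonal to \<open>F\<close>.\<close>

lemma gram_schmidt:
  fixes F :: "'a::complex_hilbert set"
  assumes "finite F"
  shows "\<exists>E. finite E \<and> orthonormal_on E (\<lambda>e. e) \<and> (\<forall>v\<in>F. (\<Sum>e\<in>E. cinner e v *\<^sub>C e) = v) \<and>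
    (\<forall>y. (\<forall>v\<in>F. cinner v y = 0) \<longrightarrow> (\<forall>e\<in>E. cinner e y = 0))"
  using assms
proof induction
  case empty
  show ?case by (rule exI[of _ "{}"]) (simp add: orthonormal_on_def)
next
  case (insert v F)
  then obtain E where fin: "finite E" and on: "orthonormal_on E (\<lambda>e. e)"
    and rep: "\<And>w. w \<in> F \<Longrightarrow> (\<Sum>e\<in>E. cinner e w *\<^sub>C e) = w"
    and sp: "\<And>y e. (\<forall>w\<in>F. cinner w y = 0) \<Longrightarrow> e \<in> E \<Longrightarrow> cinner e y = 0"
    by blast
  define r where "r = v - (\<Sum>e\<in>E. cinner e v *\<^sub>C e)"
  show ?case
  proof (cases "r = 0")
    case True
    then have "(\<Sum>e\<in>E. cinner e v *\<^sub>C e) = v" by (simp add: r_def)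
    then show ?thesis using fin on rep sp by (intro exI[of _ E]) auto
  next
    case False
    have er: "cinner e r = 0" if "e \<in> E" for e
      using orthonormal_sum[OF fin on that] by (simp add: r_def cinner.diff_right)
    have re: "cinner r e = 0" if "e \<in> E" for e
      using er[OF that] by (subst cinner_commute) simp
    define f where "f = complex_of_real (1 / norm r) *\<^sub>C r"
    have ff: "cinner f f = 1"
      using False by (simp add: cinner_self f_def scaleC_bound norm_divide)
    have fE: "f \<notin> E" using er[of f] ff by (auto simp: f_def cinner_scaleC_right)
    have rv: "cinner r v = complex_of_real ((norm r)\<^sup>2)"
    proof -
      have "v = r + (\<Sum>e\<in>E. cinner e v *\<^sub>C e)" by (simp add: r_def)
      then have "cinner r v = cinner r r + (\<Sum>e\<in>E. cinner e v * cinner r e)"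
        by (metis (no_types, lifting) cinner.sum_right cinner_add_right cinner_scaleC_right sum.cong)
      then show ?thesis using re by (simp add: cinner_self)
    qed
    have rF: "cinner r w = 0" if "w \<in> F" for w
    proof -
      have "cinner r w = cinner r (\<Sum>e\<in>E. cinner e w *\<^sub>C e)" using rep[OF that] by simp
      also have "\<dots> = (\<Sum>e\<in>E. cinner e w * cinner r e)" by (simp add: cinner.sum_right cinner_scaleC_right)
      finally show ?thesis using re by simp
    qed
    show ?thesis
    proof (intro exI[of _ "insert f E"] conjI ballI allI impI)
      show "finite (insert f E)" using fin by simp
      show "orthonormal_on (insert f E) (\<lambda>e. e)"
        using on ff er re fE unfolding orthonormal_on_def
        by (auto simp: f_def cinner_scaleC_left cinner_scaleC_right)
      show "(\<Sum>e\<in>insert f E. cinner e w *\<^sub>C e) = w" if "w \<in> insert v F" for w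
      proof (cases "w \<in> F")
        case True
        then show ?thesis using rep[OF True] rF[OF True] fin fE by (simp add: f_def cinner_scaleC_left)
      next
        case False
        then have w: "w = v" using that by simp
        have "cinner f v *\<^sub>C f = r"
          using \<open>r \<noteq> 0\<close> by (simp add: f_def cinner_scaleC_left rv power2_eq_square)
        then show ?thesis unfolding w using fin fE by (simp add: r_def)
      qed
      show "cinner e y = 0" if y: "\<forall>w\<in>insert v F. cinner w y = 0" and e: "e \<in> insert f E" for y e
      proof (cases "e \<in> E")
        case True
        then show ?thesis using sp[of y e] y by simp
      next
        case False
        then have ef: "e = f" using e by simp
        have "cinner r y = 0"
          using y sp[of y] by (simp add: r_def cinner.diff_left cinner.sum_left cinner_scaleC_left)
        then show ?thesis by (simp add: ef f_def cinner_scaleC_left)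
      qed
    qed
  qed
qed

section \<open>Orthonormal families in infinite dimension\<close>

lemma infinite_dimensional_orthonormal_nat:
  assumes "infinite_dimensional TYPE('l::complex_hilbert)"
  shows "\<exists>b :: nat \<Rightarrow> 'l::complex_hilbert. orthonormal_on {..<n} b"
proof (induction n)
  case 0
  show ?case by (simp add: orthonormal_on_def)
next
  case (Suc n)
  then obtain b :: "nat \<Rightarrow> 'l" where b: "orthonormal_on {..<n} b" by blast
  \<comment> \<open>\<open>span\<close> is real linear, so the multiples by the imaginary unit are
    added to contain the complex span.\<close>
  let ?S = "b ` {..<n} \<union> (\<lambda>i. \<i> *\<^sub>C b i) ` {..<n}"
  have "span ?S \<noteq> UNIV" using assms unfolding infinite_dimensional_def by auto
  then obtain v where v: "v \<notin> span ?S" by blast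
  have "c *\<^sub>C b i \<in> span ?S" if "i < n" for c i
  proof -
    have "c *\<^sub>C b i = Re c *\<^sub>R b i + Im c *\<^sub>R (\<i> *\<^sub>C b i)"
      unfolding scaleR_eq_scaleC scaleC_scaleC scaleC_add_left[symmetric]
      by (simp add: complex_eq_iff mult.commute flip: complex_eq)
    moreover have "b i \<in> span ?S" "\<i> *\<^sub>C b i \<in> span ?S" using that by (auto intro: span_base)
    ultimately show ?thesis by (simp only: span_add span_scale)
  qed
  then have "(\<Sum>i<n. cinner (b i) v *\<^sub>C b i) \<in> span ?S" by (intro span_sum) auto
  then have r0: "v - (\<Sum>i<n. cinner (b i) v *\<^sub>C b i) \<noteq> 0" using v by auto
  define r where "r = v - (\<Sum>i<n. cinner (b i) v *\<^sub>C b i)"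
  have er: "cinner (b i) r = 0" if "i < n" for i
    using orthonormal_sum[OF _ b, of i] that by (simp add: r_def cinner.diff_right)
  have re: "cinner r (b i) = 0" if "i < n" for i
    using er[OF that] by (subst cinner_commute) simp
  define f where "f = complex_of_real (1 / norm r) *\<^sub>C r"
  have "cinner f f = 1"
    using r0 by (simp add: cinner_self f_def r_def[symmetric] scaleC_bound norm_divide)
  moreover have "cinner f (b i) = 0" "cinner (b i) f = 0" if "i < n" for i
    using er[OF that] re[OF that] by (simp_all add: f_def cinner_scaleC_left cinner_scaleC_right)
  ultimately have "orthonormal_on {..<Suc n} (b(n := f))"
    using b unfolding orthonormal_on_def by (auto simp: less_Suc_eq)
  then show ?case by blast
qed

lemma infinite_dimensional_orthonormal:
  assumes "infinite_dimensional TYPE('l::complex_hilbert)" "finite (J :: 'j set)"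
  obtains b :: "'j \<Rightarrow> 'l::complex_hilbert" where "orthonormal_on J b"
proof -
  obtain h where h: "bij_betw h J {0..<card J}" using ex_bij_betw_finite_nat[OF assms(2)] by blast
  obtain b :: "nat \<Rightarrow> 'l" where b: "orthonormal_on {..<card J} b"
    using infinite_dimensional_orthonormal_nat[OF assms(1)] by blast
  have "h i < card J" if "i \<in> J" for i using h that unfolding bij_betw_def by auto
  moreover have "h i = h j \<longleftrightarrow> i = j" if "i \<in> J" "j \<in> J" for i j
    using h that unfolding bij_betw_def inj_on_def by auto
  ultimately have "orthonormal_on J (\<lambda>j. b (h j))"
    using b unfolding orthonormal_on_def by auto
  then show ?thesis by (rule that)
qed

lemma infinite_dimensional_nontrivial:
  assumes "infinite_dimensional TYPE('l::complex_hilbert)"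
  shows "(1 :: 'l::complex_hilbert bop) \<noteq> 0"
proof
  assume "(1 :: 'l bop) = 0"
  then have "x = 0" for x :: 'l by (metis bop_simps(1,2))
  then have "span ({} :: 'l set) = UNIV" by auto
  then show False using assms unfolding infinite_dimensional_def by blast
qed

lemma poly_op_eq_sum: "poly_op p T = (\<Sum>i\<le>degree p. coeff p i *\<^sub>C T ^ i)"
proof -
  have "poly_op (monom a i) T = a *\<^sub>C T ^ i" for a i
    by (induction i) (simp_all add: monom_Suc monom_0)
  then show ?thesis
    using poly_op_sum[of "\<lambda>i. monom (coeff p i) i" "{..degree p}" T] by (simp add: poly_as_sum_of_monoms)
qed

lemma op_fun_eigenvector:
  fixes T :: "'a::complex_hilbert bop"
  assumes "compact X" "continuous_on X f" "spec_in T X" "a \<in> X"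
    and eig: "bop_apply T w = complex_of_real a *\<^sub>C w"
  shows "bop_apply (op_fun f T) w = complex_of_real (f a) *\<^sub>C w"
proof -
  obtain p where p: "\<And>n t. t \<in> X \<Longrightarrow> cmod (poly (p n) (of_real t) - of_real (f t)) \<le> 1 / real (Suc n)"
    using poly_sequence[OF assms(1,2)] by blast
  have pw: "bop_apply (poly_op q T) w = poly q (of_real a) *\<^sub>C w" for q
    by (induction q) (simp_all add: bop_scaleC eig scaleC_add_left mult.commute)
  have "(\<lambda>n. bop_apply (poly_op (p n) T) w) \<longlonglongrightarrow> bop_apply (op_fun f T) w"
    by (intro bop_apply.tendsto tendsto_const tendsto_poly_op_op_fun[OF assms(3,2) p])
  moreover have "(\<lambda>n. bop_apply (poly_op (p n) T) w) \<longlonglongrightarrow> complex_of_real (f a) *\<^sub>C w"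
  proof (rule LIM_zero_cancel, rule Lim_null_comparison)
    have "norm (bop_apply (poly_op (p n) T) w - complex_of_real (f a) *\<^sub>C w) \<le> 1 / real (Suc n) * norm w" for n
      unfolding pw scaleC_diff_left[symmetric] scaleC_bound by (intro mult_right_mono p assms) simp
    then show "\<forall>\<^sub>F n in sequentially. norm (bop_apply (poly_op (p n) T) w - complex_of_real (f a) *\<^sub>C w)
        \<le> 1 / real (Suc n) * norm w" by simp
    have "(\<lambda>n. 1 / real (Suc n) * norm w) \<longlonglongrightarrow> 0 * norm w"
      by (intro tendsto_mult tendsto_const LIMSEQ_Suc lim_1_over_n)
    then show "(\<lambda>n. 1 / real (Suc n) * norm w) \<longlonglongrightarrow> 0" by simp
  qed
  ultimately show ?thesis using LIMSEQ_unique by blast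
qed

section \<open>Jensen's inequality for positive unital maps\<close>

text \<open>For a fixed vector \<open>x\<close> and a polynomial approximation of \<open>\<phi>\<close> of degree \<open>d\<close>, only the inner
  products of the vectors \<open>\<surd>T\<^sub>i S\<^sup>k x\<close>, \<open>k \<le> d\<close>, matter. They are realised in the
  infinite-dimensional space by vectors \<open>w i k\<close> with \<open>D (w i k) = \<lambda>\<^sub>i w i k\<close> for a diagonal
  operator \<open>D\<close>; with \<open>P\<close> the projection onto the span of the \<open>u k = (\<Sum>i. w i k)\<close>, the pinching
  \<open>C\<close> of \<open>D\<close> satisfies \<open>C\<^sup>k (u 0) = u k\<close>.\<close>

lemma jensen_resolution:
  fixes T :: "'i \<Rightarrow> 'k::complex_hilbert bop"
  assumes inf: "infinite_dimensional TYPE('l::complex_hilbert)" and conc: "pinching_concave TYPE('l) \<phi>"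
    and cont: "continuous_on {0<..} \<phi>"
    and I: "finite I" and T: "\<And>i. i \<in> I \<Longrightarrow> 0 \<le> T i" and one: "(\<Sum>i\<in>I. T i) = 1"
    and c: "0 < m" "m \<le> M" "\<And>i. i \<in> I \<Longrightarrow> m \<le> c i \<and> c i \<le> M"
  shows "(\<Sum>i\<in>I. complex_of_real (\<phi> (c i)) *\<^sub>C T i) \<le> op_fun \<phi> (\<Sum>i\<in>I. complex_of_real (c i) *\<^sub>C T i)"
proof -
  define S where "S = (\<Sum>i\<in>I. complex_of_real (c i) *\<^sub>C T i)"
  have cstI: "cst r = (\<Sum>i\<in>I. complex_of_real r *\<^sub>C T i)" for r
    by (simp add: one flip: scaleC_sum_right)
  have scale_T: "complex_of_real r *\<^sub>C T i \<le> complex_of_real s *\<^sub>C T i" if "i \<in> I" "r \<le> s" for i r s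
    using scale_bop_mono[OF T[OF that(1)], of "s - r"] that(2) by (simp add: scaleC_diff_left)
  have mS: "cst m \<le> S" and SM: "S \<le> cst M"
    unfolding cstI S_def using c by (auto intro!: sum_mono scale_T)
  have sS: "spec_in S {m..M}" by (rule spec_in_Icc[OF mS SM])
  have sub: "{m..M} \<subseteq> {0<..}" using c by auto
  note cont' = continuous_on_subset[OF cont sub]
  have "\<forall>i\<in>I. \<exists>R. adj R = R \<and> R * R = T i" using T nonneg_square_root by metis
  then obtain R where R: "\<And>i. i \<in> I \<Longrightarrow> adj (R i) = R i" "\<And>i. i \<in> I \<Longrightarrow> R i * R i = T i" by metis
  have RR: "cinner (bop_apply (R i) x) (bop_apply (R i) y) = cinner x (bop_apply (T i) y)" if "i \<in> I" for i x y
    using cinner_adj_left[of "R i" x "bop_apply (R i) y"] R[OF that] by (metis bop_simps(6))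
  have sa: "self_adjoint (T i)" if "i \<in> I" for i using T[OF that] by (rule bop_nonneg_sa)
  show ?thesis
    unfolding S_def[symmetric]
  proof (rule bop_leI)
    have sum_sa: "self_adjoint (\<Sum>i\<in>J. complex_of_real (r i) *\<^sub>C T i)" if "J \<subseteq> I" for J r
      using finite_subset[OF that I] that by induction (auto intro: sa)
    show "self_adjoint (\<Sum>i\<in>I. complex_of_real (\<phi> (c i)) *\<^sub>C T i)" by (rule sum_sa) simp
    show "self_adjoint (op_fun \<phi> S)" by (rule op_fun_self_adjoint[OF sS cont'])
    fix x
    have main: "Re (cinner x (bop_apply (\<Sum>i\<in>I. complex_of_real (\<phi> (c i)) *\<^sub>C T i) x)) \<le>
        Re (cinner x (bop_apply (op_fun \<phi> S) x)) + 2 * e * (norm x)\<^sup>2" if "0 < e" for e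
    proof -
      \<comment> \<open>One polynomial serves both S and the pinching C below, whose spectra lie in
        the same interval; each replacement costs e |x|^2, hence the factor 2.\<close>
      obtain p where p: "\<And>t. t \<in> {m..M} \<Longrightarrow> cmod (poly p (of_real t) - of_real (\<phi> t)) \<le> e"
        using real_poly_approx[OF compact_Icc cont' \<open>0 < e\<close>] less_imp_le by metis
      define d where "d = degree p"
      define y where "y k = bop_apply (S ^ k) x" for k
      have y0: "y 0 = x" and ySuc: "y (Suc k) = bop_apply S (y k)" for k by (simp_all add: y_def)
      define v where "v i k = bop_apply (R i) (y k)" for i k
      have vv: "cinner (v i k) (v i l) = cinner (y k) (bop_apply (T i) (y l))" if "i \<in> I" for i k l
        unfolding v_def by (rule RR[OF that])
      obtain E where E: "finite E" "orthonormal_on E (\<lambda>e. e)"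
        and Ev: "\<And>i k. i \<in> I \<Longrightarrow> k \<le> d \<Longrightarrow> (\<Sum>e\<in>E. cinner e (v i k) *\<^sub>C e) = v i k"
      proof -
        have "finite ((\<lambda>(i, k). v i k) ` (I \<times> {..d}))" using I by simp
        from gram_schmidt[OF this] that show ?thesis by (auto simp: Ball_def)
      qed
      \<comment> \<open>One orthonormal copy of \<open>E\<close> for each index i:
        \<open>w i k\<close> is the copy of \<open>v i k\<close> in block i, and distinct blocks are
        orthogonal.\<close>
      obtain b :: "'i \<times> 'k \<Rightarrow> 'l" where b: "orthonormal_on (I \<times> E) b"
        using infinite_dimensional_orthonormal[OF inf finite_cartesian_product[OF I E(1)]] by blast
      define w where "w i k = (\<Sum>e\<in>E. cinner e (v i k) *\<^sub>C b (i, e))" for i k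
      have bI: "cinner (b (i, e)) (b (j, f)) = (if i = j \<and> e = f then 1 else 0)"
        if "i \<in> I" "j \<in> I" "e \<in> E" "f \<in> E" for i j e f
        using b that unfolding orthonormal_on_def by auto
      have ww: "cinner (w i k) (w j l) = (if i = j then cinner (y k) (bop_apply (T i) (y l)) else 0)"
        if ij: "i \<in> I" "j \<in> I" and kl: "k \<le> d" "l \<le> d" for i j k l
      proof (cases "i = j")
        case True
        have on: "orthonormal_on E (\<lambda>e. b (i, e))" using bI ij unfolding orthonormal_on_def by simp
        have "cinner (w i k) (w i l) = (\<Sum>e\<in>E. cnj (cinner e (v i k)) * cinner e (v i l))"
          unfolding w_def by (rule orthonormal_cinner_sums[OF E(1) on])
        also have "\<dots> = cinner (\<Sum>e\<in>E. cinner e (v i k) *\<^sub>C e) (\<Sum>e\<in>E. cinner e (v i l) *\<^sub>C e)"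
          by (rule orthonormal_cinner_sums[OF E, symmetric])
        also have "\<dots> = cinner (v i k) (v i l)" using Ev ij kl by simp
        finally show ?thesis using True vv[OF ij(1)] by simp
      next
        case False
        then have "cinner (w i k) (w j l) = 0"
          unfolding w_def cinner.sum_left[of _ E] cinner.sum_right[of _ _ E] using ij
          by (intro sum.neutral ballI) (simp add: cinner_scaleC_left cinner_scaleC_right bI)
        then show ?thesis using False by simp
      qed
      define D where "D = cst m + diag_op (I \<times> E) (\<lambda>q. c (fst q) - m) b"
      have D: "cst m \<le> D" "D \<le> cst M"
        unfolding D_def using diag_op_bounds[OF finite_cartesian_product[OF I E(1)] b, of m "\<lambda>q. c (fst q)" M] c by auto
      have sD: "spec_in D {m..M}" by (rule spec_in_Icc[OF D])
      have Dw: "bop_apply D (w i k) = complex_of_real (c i) *\<^sub>C w i k" if "i \<in> I" for i k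
      proof -
        have "bop_apply D (b (i, e)) = complex_of_real (c i) *\<^sub>C b (i, e)" if "e \<in> E" for e
          using diag_op_basis[OF finite_cartesian_product[OF I E(1)] b, of "(i, e)" "\<lambda>q. c (fst q) - m"] that \<open>i \<in> I\<close>
          by (simp add: D_def flip: scaleC_add_left)
        then show ?thesis
          unfolding w_def by (simp add: bop_sum bop_scaleC scaleC_sum_right mult.commute)
      qed
      \<comment> \<open>\<open>u k\<close> is the image of \<open>y k\<close> under the Naimark
        dilation y \<mapsto> (R i y) over all i. It is isometric because the T i sum to 1, and the
        compression of D along it is S.\<close>
      define u where "u k = (\<Sum>i\<in>I. w i k)" for k
      have uw: "cinner (u k) (\<Sum>i\<in>I. complex_of_real (r i) *\<^sub>C w i l) =
          cinner (y k) (bop_apply (\<Sum>i\<in>I. complex_of_real (r i) *\<^sub>C T i) (y l))" if "k \<le> d" "l \<le> d" for k l r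
      proof -
        have "cinner (u k) (\<Sum>i\<in>I. complex_of_real (r i) *\<^sub>C w i l) =
            (\<Sum>i\<in>I. \<Sum>j\<in>I. complex_of_real (r i) * cinner (w j k) (w i l))"
          by (simp add: u_def cinner.sum_left cinner.sum_right cinner_scaleC_right sum_distrib_left)
        also have "\<dots> = (\<Sum>i\<in>I. \<Sum>j\<in>I. if j = i then complex_of_real (r i) * cinner (y k) (bop_apply (T i) (y l)) else 0)"
          using that by (intro sum.cong refl) (simp add: ww)
        also have "\<dots> = cinner (y k) (bop_apply (\<Sum>i\<in>I. complex_of_real (r i) *\<^sub>C T i) (y l))"
          using I by (simp add: bop_apply_sum cinner.sum_right cinner_scaleC_right)
        finally show ?thesis .
      qed
      have uu: "cinner (u k) (u l) = cinner (y k) (y l)" if "k \<le> d" "l \<le> d" for k l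
        using uw[OF that, of "\<lambda>i. 1"] by (simp add: u_def[symmetric] one)
      have fDu: "bop_apply (op_fun f D) (u k) = (\<Sum>i\<in>I. complex_of_real (f (c i)) *\<^sub>C w i k)"
        if "continuous_on {m..M} f" for f k
        unfolding u_def bop_sum
        by (intro sum.cong refl op_fun_eigenvector[OF compact_Icc that sD] Dw) (use c in auto)
      have Du: "bop_apply D (u k) = (\<Sum>i\<in>I. complex_of_real (c i) *\<^sub>C w i k)" for k
        unfolding u_def bop_sum by (intro sum.cong refl Dw)
      obtain B where B: "finite B" "orthonormal_on B (\<lambda>e. e)"
        and Bu: "\<And>k. k \<le> d \<Longrightarrow> (\<Sum>e\<in>B. cinner e (u k) *\<^sub>C e) = u k"
        and Bz: "\<And>z e. (\<And>k. k \<le> d \<Longrightarrow> cinner (u k) z = 0) \<Longrightarrow> e \<in> B \<Longrightarrow> cinner e z = 0"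
      proof -
        obtain B where B: "finite B" "orthonormal_on B (\<lambda>e. e)"
          and Bu: "\<And>v. v \<in> u ` {..d} \<Longrightarrow> (\<Sum>e\<in>B. cinner e v *\<^sub>C e) = v"
          and Bz: "\<And>z e. (\<And>v. v \<in> u ` {..d} \<Longrightarrow> cinner v z = 0) \<Longrightarrow> e \<in> B \<Longrightarrow> cinner e z = 0"
          using gram_schmidt[of "u ` {..d}"] by blast
        show ?thesis
        proof (rule that[OF B])
          show "(\<Sum>e\<in>B. cinner e (u k) *\<^sub>C e) = u k" if "k \<le> d" for k
            using that by (intro Bu imageI) simp
          show "cinner e z = 0" if z: "\<And>k. k \<le> d \<Longrightarrow> cinner (u k) z = 0" and e: "e \<in> B" for z e
          proof (rule Bz[OF _ e])
            show "cinner v z = 0" if "v \<in> u ` {..d}" for v using that z by blast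
          qed
        qed
      qed
      define P where "P = diag_op B (\<lambda>_. 1) (\<lambda>e. e)"
      have P: "adj P = P" "P * P = P"
        unfolding P_def by (rule adj_diag_op, rule diag_op_projection[OF B])
      have Pu: "bop_apply P (u k) = u k" if "k \<le> d" for k
        using Bu[OF that] by (simp add: P_def diag_op_apply)
      have Pz: "bop_apply P z = 0" if "\<And>k. k \<le> d \<Longrightarrow> cinner (u k) z = 0" for z
        using Bz[OF that] by (simp add: P_def diag_op_apply)
      define C where "C = P * D * P + (1 - P) * D * (1 - P)"
      have C: "cst m \<le> C" "C \<le> cst M"
        unfolding C_def using pinching_bounds[OF P] D by auto
      have sC: "spec_in C {m..M}" by (rule spec_in_Icc[OF C])
      \<comment> \<open>D (u k) - u (k + 1) is orthogonal to every u l with l \<le> d, so P removes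
        it. The bound on k ensures that u (k + 1) is itself in the range of P.\<close>
      have Cu: "bop_apply C (u k) = u (Suc k)" if "Suc k \<le> d" for k
      proof -
        have "bop_apply P (bop_apply D (u k) - u (Suc k)) = 0"
        proof (rule Pz)
          fix l assume "l \<le> d"
          then show "cinner (u l) (bop_apply D (u k) - u (Suc k)) = 0"
            using uw[of l k c] that uu[of l "Suc k"]
            by (simp add: cinner.diff_right Du ySuc S_def)
        qed
        then have "bop_apply P (bop_apply D (u k)) = u (Suc k)"
          using Pu[OF that] by (simp add: bop_diff)
        then show ?thesis using Pu[of k] that by (simp add: C_def bop_zero)
      qed
      have Cpow: "bop_apply (C ^ k) (u 0) = u k" if "k \<le> d" for k
        using that by (induction k) (simp_all add: Cu)
      have "cinner (u 0) (bop_apply (poly_op p C) (u 0)) = (\<Sum>k\<le>d. coeff p k * cinner (u 0) (u k))"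
        by (simp add: poly_op_eq_sum bop_apply_sum d_def[symmetric] cinner.sum_right cinner_scaleC_right Cpow)
      also have "\<dots> = (\<Sum>k\<le>d. coeff p k * cinner x (y k))" by (simp add: uu y0)
      also have "\<dots> = cinner x (bop_apply (poly_op p S) x)"
        by (simp add: poly_op_eq_sum bop_apply_sum d_def[symmetric] cinner.sum_right cinner_scaleC_right y_def)
      finally have pp: "cinner (u 0) (bop_apply (poly_op p C) (u 0)) = cinner x (bop_apply (poly_op p S) x)" .
      have "cinner (u 0) (u 0) = cinner x x" using uu[of 0 0] by (simp add: y0)
      then have nu: "(norm (u 0))\<^sup>2 = (norm x)\<^sup>2" by (metis Re_cinner_self)
      have small: "\<bar>Re (cinner z (bop_apply B z))\<bar> \<le> e * (norm z)\<^sup>2" if "norm B \<le> e"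
        for z :: "'z::complex_hilbert" and B
      proof -
        have "\<bar>Re (cinner z (bop_apply B z))\<bar> \<le> cmod (cinner z (bop_apply B z))" by (rule abs_Re_le_cmod)
        also have "\<dots> \<le> norm z * norm (bop_apply B z)" by (rule cauchy_schwarz)
        also have "\<dots> \<le> norm z * (e * norm z)"
          by (intro mult_left_mono order_trans[OF norm_bop_apply] mult_right_mono that) auto
        finally show ?thesis by (simp add: power2_eq_square mult_ac)
      qed
      have "norm (poly_op p C - op_fun \<phi> C) \<le> e" by (rule op_fun_dist_poly_op[OF sC cont' _ p]) (use that in auto)
      from small[OF this, of "u 0"]
      have 1: "Re (cinner (u 0) (bop_apply (op_fun \<phi> C) (u 0))) \<le>
          Re (cinner (u 0) (bop_apply (poly_op p C) (u 0))) + e * (norm x)\<^sup>2"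
        by (simp add: cinner.diff_right nu abs_le_iff)
      have "norm (poly_op p S - op_fun \<phi> S) \<le> e" by (rule op_fun_dist_poly_op[OF sS cont' _ p]) (use that in auto)
      from small[OF this, of x]
      have 2: "Re (cinner x (bop_apply (poly_op p S) x)) \<le> Re (cinner x (bop_apply (op_fun \<phi> S) x)) + e * (norm x)\<^sup>2"
        by (simp add: cinner.diff_right abs_le_iff)
      \<comment> \<open>\<open>u 0\<close> splits into eigenvectors of D, which turns the left side
        into the form of \<phi>(D). The pinching inequality leads to \<phi>(C), and p(C) and p(S)
        have equal forms at \<open>u 0\<close> and \<open>x\<close>.\<close>
      have "Re (cinner x (bop_apply (\<Sum>i\<in>I. complex_of_real (\<phi> (c i)) *\<^sub>C T i) x)) =
          Re (cinner (u 0) (bop_apply (op_fun \<phi> D) (u 0)))"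
        using uw[of 0 0 "\<lambda>i. \<phi> (c i)"] by (simp add: fDu[OF cont'] y0)
      also have "\<dots> \<le> Re (cinner (u 0) (bop_apply (op_fun \<phi> C) (u 0)))"
        using conc c(1) D(1) P Pu[of 0] unfolding pinching_concave_def C_def by blast
      finally show ?thesis using 1 2 pp by simp
    qed
    show "Re (cinner x (bop_apply (\<Sum>i\<in>I. complex_of_real (\<phi> (c i)) *\<^sub>C T i) x)) \<le>
        Re (cinner x (bop_apply (op_fun \<phi> S) x))"
    proof (rule field_le_epsilon)
      fix e :: real assume "0 < e"
      define e' where "e' = e / (2 * ((norm x)\<^sup>2 + 1))"
      have pos: "0 < (norm x)\<^sup>2 + 1" by (simp add: add_nonneg_pos)
      have "2 * e' * (norm x)\<^sup>2 = e * ((norm x)\<^sup>2 / ((norm x)\<^sup>2 + 1))"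
        using pos by (simp add: e'_def field_simps)
      also have "\<dots> \<le> e * 1" using pos \<open>0 < e\<close> by (intro mult_left_mono) (auto simp: divide_le_eq)
      finally have "2 * e' * (norm x)\<^sup>2 \<le> e" by simp
      moreover have "0 < e'" using pos \<open>0 < e\<close> by (simp add: e'_def)
      ultimately show "Re (cinner x (bop_apply (\<Sum>i\<in>I. complex_of_real (\<phi> (c i)) *\<^sub>C T i) x)) \<le>
          Re (cinner x (bop_apply (op_fun \<phi> S) x)) + e"
        using main[of e'] by simp
    qed
  qed
qed

section \<open>Positive unital maps and their finite resolutions\<close>

lemma unital_positive_mapD:
  assumes "unital_positive_map \<Phi>"
  shows "\<Phi> (S + T) = \<Phi> S + \<Phi> T" "\<Phi> (S - T) = \<Phi> S - \<Phi> T" "\<Phi> (c *\<^sub>C T) = c *\<^sub>C \<Phi> T"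
    "\<Phi> (sum X I) = (\<Sum>i\<in>I. \<Phi> (X i))" "\<Phi> 1 = 1" "\<Phi> (cst r) = cst r"
    "0 \<le> T \<Longrightarrow> 0 \<le> \<Phi> T" "S \<le> T \<Longrightarrow> \<Phi> S \<le> \<Phi> T"
proof -
  interpret L: Vector_Spaces.linear scaleC scaleC \<Phi>
    using assms by (simp add: unital_positive_map_def)
  show "\<Phi> (S + T) = \<Phi> S + \<Phi> T" "\<Phi> (S - T) = \<Phi> S - \<Phi> T" "\<Phi> (c *\<^sub>C T) = c *\<^sub>C \<Phi> T"
    "\<Phi> (sum X I) = (\<Sum>i\<in>I. \<Phi> (X i))"
    by (rule L.add L.diff L.scale L.sum)+
  show one: "\<Phi> 1 = 1" using assms by (simp add: unital_positive_map_def)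
  show "\<Phi> (cst r) = cst r" by (simp add: L.scale one)
  show pos: "0 \<le> \<Phi> T" if "0 \<le> T" for T
    using assms that by (simp add: unital_positive_map_def flip: positive_op_iff)
  show "\<Phi> S \<le> \<Phi> T" if "S \<le> T" using pos[of "T - S"] that by (simp add: L.diff)
qed

lemma unital_positive_map_bounds:
  assumes "unital_positive_map \<Phi>"
  shows "cst m \<le> T \<Longrightarrow> cst m \<le> \<Phi> T" "T \<le> cst M \<Longrightarrow> \<Phi> T \<le> cst M"
  using unital_positive_mapD(8)[OF assms, of "cst m" T] unital_positive_mapD(8)[OF assms, of T "cst M"]
  by (simp_all add: unital_positive_mapD(6)[OF assms])

text \<open>Positivity forces continuity on self-adjoint operators: the interval from - |B| to |B|
  is mapped into itself.\<close>

lemma norm_unital_positive_map_le: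
  assumes "unital_positive_map \<Phi>" "self_adjoint B"
  shows "norm (\<Phi> B) \<le> norm B"
  by (intro norm_le_between unital_positive_map_bounds[OF assms(1)] norm_le_cst[OF assms(2) order_refl]) simp

lemma op_fun_sum:
  assumes "spec_in T X" "finite I" "\<And>i. i \<in> I \<Longrightarrow> continuous_on X (u i)"
  shows "op_fun (\<lambda>t. \<Sum>i\<in>I. c i * u i t) T = (\<Sum>i\<in>I. complex_of_real (c i) *\<^sub>C op_fun (u i) T)"
  using assms(2,3)
proof induction
  case empty
  show ?case using op_fun_const[OF spec_in_sa[OF assms(1)], of 0] by simp
next
  case (insert i I)
  have "op_fun (\<lambda>t. c i * u i t + (\<Sum>i\<in>I. c i * u i t)) T =
      op_fun (\<lambda>t. c i * u i t) T + op_fun (\<lambda>t. \<Sum>i\<in>I. c i * u i t) T"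
    by (rule op_fun_add[OF assms(1)]) (use insert.prems in \<open>auto intro!: continuous_intros\<close>)
  also have "op_fun (\<lambda>t. c i * u i t) T = complex_of_real (c i) *\<^sub>C op_fun (u i) T"
    by (rule op_fun_scale[OF assms(1)]) (use insert.prems in simp)
  finally show ?case using insert by simp
qed

text \<open>On the commutative algebra generated by \<open>A\<close> the map is approximated by
  \<open>f(A) \<mapsto> (\<Sum>k. f (c k) T k)\<close> with a positive resolution \<open>T\<close> of the identity. Bernstein polynomials
  reproduce affine functions, so that \<open>\<Phi> A = (\<Sum>k. c k T k)\<close> holds exactly.\<close>

lemma positive_map_resolution:
  fixes A :: "'h::complex_hilbert bop" and \<Phi> :: "'h bop \<Rightarrow> 'k::complex_hilbert bop"
  assumes \<Phi>: "unital_positive_map \<Phi>" and A: "cst m \<le> A" "A \<le> cst M" and "m < M"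
  obtains T :: "nat \<Rightarrow> nat \<Rightarrow> 'k bop" and c :: "nat \<Rightarrow> nat \<Rightarrow> real"
  where "\<And>n k. k \<le> n \<Longrightarrow> 0 \<le> T n k" "\<And>n. (\<Sum>k\<le>n. T n k) = 1"
    "\<And>n. (\<Sum>k\<le>Suc n. complex_of_real (c (Suc n) k) *\<^sub>C T (Suc n) k) = \<Phi> A"
    "\<And>n k. k \<le> n \<Longrightarrow> m \<le> c n k \<and> c n k \<le> M"
    "\<And>f. continuous_on {m..M} f \<Longrightarrow> (\<lambda>n. \<Sum>k\<le>n. complex_of_real (f (c n k)) *\<^sub>C T n k) \<longlonglongrightarrow> \<Phi> (op_fun f A)"
proof -
  note sA = spec_in_Icc[OF A]
  define s where "s t = (t - m) / (M - m)" for t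
  define u where "u n k t = Bernstein n k (s t)" for n k t
  \<comment> \<open>The Bernstein nodes carried from [0, 1] to [m, M]. In degree 0 the quotient is 0
    and the identity function is not reproduced, which is why that claim is stated for
    \<open>Suc n\<close>.\<close>
  define c where "c n k = m + real k / real n * (M - m)" for n k :: nat
  define T where "T n k = \<Phi> (op_fun (u n k) A)" for n k
  have scont: "continuous_on X s" for X using \<open>m < M\<close> unfolding s_def by (intro continuous_intros) auto
  have ucont: "continuous_on X (u n k)" for X n k
    unfolding u_def Bernstein_def by (intro continuous_intros scont)
  have s01: "0 \<le> s t" "s t \<le> 1" if "t \<in> {m..M}" for t using that \<open>m < M\<close> by (auto simp: s_def)
  have sum: "\<Phi> (op_fun (\<lambda>t. \<Sum>k\<le>n. r k * u n k t) A) = (\<Sum>k\<le>n. complex_of_real (r k) *\<^sub>C T n k)" for r n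
    by (simp add: op_fun_sum[OF sA _ ucont] unital_positive_mapD(3,4)[OF \<Phi>] T_def)
  show ?thesis
  proof (rule that)
    show "0 \<le> T n k" if "k \<le> n" for n k
      unfolding T_def
      by (intro unital_positive_mapD(7)[OF \<Phi>] op_fun_nonneg[OF sA ucont])
        (auto simp: u_def intro!: Bernstein_nonneg s01)
    show "(\<Sum>k\<le>n. T n k) = 1" for n
      using sum[where n = n and r = "\<lambda>k. 1"]
      by (simp add: u_def op_fun_const[OF spec_in_sa[OF sA]] unital_positive_mapD(5)[OF \<Phi>])
    show "m \<le> c n k \<and> c n k \<le> M" if "k \<le> n" for n k
    proof -
      have "real k / real n \<le> 1" using that by (auto simp: divide_le_eq)
      then have "real k / real n * (M - m) \<le> 1 * (M - m)"
        by (rule mult_right_mono) (use \<open>m < M\<close> in simp)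
      moreover have "0 \<le> real k / real n * (M - m)" using \<open>m < M\<close> by simp
      ultimately show ?thesis by (simp add: c_def)
    qed
    show "(\<Sum>k\<le>Suc n. complex_of_real (c (Suc n) k) *\<^sub>C T (Suc n) k) = \<Phi> A" for n
    proof -
      have "(\<Sum>k\<le>Suc n. c (Suc n) k * u (Suc n) k t) = t" for t
      proof -
        have "(\<Sum>k\<le>Suc n. c (Suc n) k * u (Suc n) k t) =
            m * (\<Sum>k\<le>Suc n. Bernstein (Suc n) k (s t)) +
            (M - m) / real (Suc n) * (\<Sum>k\<le>Suc n. real k * Bernstein (Suc n) k (s t))"
          unfolding c_def u_def sum_distrib_left sum.distrib[symmetric]
          by (intro sum.cong) (auto simp: algebra_simps diff_divide_distrib)
        also have "\<dots> = t"
          unfolding sum_Bernstein sum_k_Bernstein using \<open>m < M\<close> by (simp add: s_def)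
        finally show ?thesis .
      qed
      then show ?thesis using sum[where n = "Suc n" and r = "c (Suc n)"] op_fun_id[OF spec_in_sa[OF sA]] by simp
    qed
    show "(\<lambda>n. \<Sum>k\<le>n. complex_of_real (f (c n k)) *\<^sub>C T n k) \<longlonglongrightarrow> \<Phi> (op_fun f A)"
      if f: "continuous_on {m..M} f" for f
    proof (rule metric_LIMSEQ_I)
      fix e :: real assume "0 < e"
      have "continuous_on {0..1} (\<lambda>x. f (m + x * (M - m)))"
      proof (rule continuous_on_compose2[OF f])
        show "(\<lambda>x. m + x * (M - m)) ` {0..1} \<subseteq> {m..M}"
        proof clarsimp
          fix x :: real assume x: "0 \<le> x" "x \<le> 1"
          then have "0 \<le> x * (M - m)" "x * (M - m) \<le> 1 * (M - m)"
            using \<open>m < M\<close> by (auto intro!: mult_right_mono)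
          then show "0 \<le> x * (M - m) \<and> m + x * (M - m) \<le> M" by simp
        qed
      qed (intro continuous_intros)
      from Bernstein_Weierstrass[OF this, of "e / 2"] \<open>0 < e\<close>
      obtain N where N: "\<And>n x. N \<le> n \<Longrightarrow> x \<in> {0..1} \<Longrightarrow>
          \<bar>f (m + x * (M - m)) - (\<Sum>k\<le>n. f (m + real k / real n * (M - m)) * Bernstein n k x)\<bar> < e / 2"
        by auto
      have "dist (\<Sum>k\<le>n. complex_of_real (f (c n k)) *\<^sub>C T n k) (\<Phi> (op_fun f A)) < e" if "N \<le> n" for n
      proof -
        define q where "q t = (\<Sum>k\<le>n. f (c n k) * u n k t)" for t
        have qcont: "continuous_on X q" for X unfolding q_def by (intro continuous_intros ucont)
        have close: "\<bar>q t - f t\<bar> \<le> e / 2" if "t \<in> {m..M}" for t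
        proof -
          have "m + s t * (M - m) = t" using \<open>m < M\<close> by (simp add: s_def)
          then show ?thesis using N[OF \<open>N \<le> n\<close>, of "s t"] s01[OF that] by (simp add: q_def u_def c_def abs_minus_commute)
        qed
        have close': "- (e / 2) \<le> q t + - f t" "q t + - f t \<le> e / 2" if "t \<in> {m..M}" for t
          using close[OF that] by linarith+
        have diff: "op_fun (\<lambda>t. q t + - f t) A = op_fun q A - op_fun f A"
          using op_fun_add[OF sA qcont continuous_on_minus[OF f]] op_fun_minus[OF sA f] by simp
        have dc: "continuous_on {m..M} (\<lambda>t. q t + - f t)" by (intro continuous_intros qcont f)
        have "cst (- (e / 2)) \<le> op_fun (\<lambda>t. q t + - f t) A"
          by (rule op_fun_ge_cst[OF sA dc close'(1)])
        moreover have "op_fun (\<lambda>t. q t + - f t) A \<le> op_fun (\<lambda>t. e / 2) A"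
          by (rule op_fun_mono[OF sA dc continuous_on_const close'(2)])
        ultimately have "norm (op_fun q A - op_fun f A) \<le> e / 2"
          unfolding diff op_fun_const[OF spec_in_sa[OF sA]] using \<open>0 < e\<close> by (intro norm_le_between) auto
        moreover have "self_adjoint (op_fun q A - op_fun f A)"
          by (intro self_adjoint_intros op_fun_self_adjoint[OF sA] qcont f)
        ultimately have "norm (\<Phi> (op_fun q A - op_fun f A)) \<le> e / 2"
          using norm_unital_positive_map_le[OF \<Phi>] order_trans by blast
        moreover have "\<Phi> (op_fun q A) = (\<Sum>k\<le>n. complex_of_real (f (c n k)) *\<^sub>C T n k)"
          unfolding q_def by (rule sum)
        ultimately show ?thesis using \<open>0 < e\<close> by (simp add: dist_norm unital_positive_mapD(2)[OF \<Phi>])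
      qed
      then show "\<exists>N. \<forall>n\<ge>N. dist (\<Sum>k\<le>n. complex_of_real (f (c n k)) *\<^sub>C T n k) (\<Phi> (op_fun f A)) < e" by blast
    qed
  qed
qed

text \<open>The inequality for finite resolutions has the same right side \<phi>(\<Phi> A) in every
  degree at least 1, because the nodes reproduce \<Phi> A exactly. Only the left side passes to a
  limit.\<close>

theorem jensen_positive_map:
  assumes inf: "infinite_dimensional TYPE('l::complex_hilbert)" and conc: "pinching_concave TYPE('l) \<phi>"
    and cont: "continuous_on {0<..} \<phi>" and \<Phi>: "unital_positive_map \<Phi>"
    and A: "0 < m" "cst m \<le> A" "A \<le> cst M" "m < M"
  shows "\<Phi> (op_fun \<phi> A) \<le> op_fun \<phi> (\<Phi> A)"
proof -
  obtain T c where T: "\<And>n k. k \<le> n \<Longrightarrow> 0 \<le> T n k" "\<And>n. (\<Sum>k\<le>n. T n k) = 1"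
    and TA: "\<And>n. (\<Sum>k\<le>Suc n. complex_of_real (c (Suc n) k) *\<^sub>C T (Suc n) k) = \<Phi> A"
    and c: "\<And>n k. k \<le> n \<Longrightarrow> m \<le> c n k \<and> c n k \<le> M"
    and lim: "\<And>f. continuous_on {m..M} f \<Longrightarrow> (\<lambda>n. \<Sum>k\<le>n. complex_of_real (f (c n k)) *\<^sub>C T n k) \<longlonglongrightarrow> \<Phi> (op_fun f A)"
    by (rule positive_map_resolution[OF \<Phi> A(2-4)]) blast
  have "continuous_on {m..M} \<phi>" by (rule continuous_on_subset[OF cont]) (use A(1) in auto)
  from LIMSEQ_Suc[OF lim[OF this]] tendsto_const show ?thesis
  proof (rule bop_le_tendsto)
    fix n
    show "(\<Sum>k\<le>Suc n. complex_of_real (\<phi> (c (Suc n) k)) *\<^sub>C T (Suc n) k) \<le> op_fun \<phi> (\<Phi> A)"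
      unfolding TA[of n, symmetric]
      by (rule jensen_resolution[OF inf conc cont finite_atMost T(1) T(2) A(1) less_imp_le[OF A(4)] c]) auto
  qed
qed

text \<open>A variance is nonnegative: with X the mean, expand the sum of (b i - X) T i (b i -
  X).\<close>

lemma square_resolution_le:
  fixes T :: "'i \<Rightarrow> 'k::complex_hilbert bop"
  assumes "finite I" and T: "\<And>i. i \<in> I \<Longrightarrow> 0 \<le> T i" and one: "(\<Sum>i\<in>I. T i) = 1"
  shows "(\<Sum>i\<in>I. complex_of_real (b i) *\<^sub>C T i) * (\<Sum>i\<in>I. complex_of_real (b i) *\<^sub>C T i) \<le>
    (\<Sum>i\<in>I. complex_of_real ((b i)\<^sup>2) *\<^sub>C T i)"
proof -
  define X where "X = (\<Sum>i\<in>I. complex_of_real (b i) *\<^sub>C T i)"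
  have "self_adjoint (\<Sum>i\<in>J. complex_of_real (b i) *\<^sub>C T i)" if "J \<subseteq> I" for J
    using finite_subset[OF that assms(1)] that by induction (auto intro: bop_nonneg_sa T)
  then have X: "adj X = X" by (simp add: X_def self_adjoint_def)
  have "0 \<le> (\<Sum>i\<in>I. adj (cst (b i) - X) * T i * (cst (b i) - X))"
  proof (rule sum_nonneg)
    fix i assume "i \<in> I"
    from bop_sandwich_mono[OF T[OF this], of "cst (b i) - X"]
    show "0 \<le> adj (cst (b i) - X) * T i * (cst (b i) - X)" by simp
  qed
  also have "\<dots> = (\<Sum>i\<in>I. complex_of_real ((b i)\<^sup>2) *\<^sub>C T i - (complex_of_real (b i) *\<^sub>C T i) * X
      - X * (complex_of_real (b i) *\<^sub>C T i) + X * T i * X)"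
    by (intro sum.cong refl)
      (simp add: X algebra_simps power2_eq_square scaleC_diff_right)
  also have "\<dots> = (\<Sum>i\<in>I. complex_of_real ((b i)\<^sup>2) *\<^sub>C T i) - X * X - X * X + X * (\<Sum>i\<in>I. T i) * X"
    by (simp only: sum.distrib sum_subtractf flip: sum_distrib_left sum_distrib_right X_def)
  finally show ?thesis by (simp add: one X_def[symmetric])
qed

text \<open>Both sides are limits of sums over the same resolutions, where the variance inequality
  applies.\<close>

lemma kadison_inequality:
  assumes \<Phi>: "unital_positive_map \<Phi>" and A: "cst m \<le> A" "A \<le> cst M" "m < M"
    and f: "continuous_on {m..M} f"
  shows "\<Phi> (op_fun f A) * \<Phi> (op_fun f A) \<le> \<Phi> (op_fun (\<lambda>t. (f t)\<^sup>2) A)"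
proof -
  obtain T c where T: "\<And>n k. k \<le> n \<Longrightarrow> 0 \<le> T n k" "\<And>n. (\<Sum>k\<le>n. T n k) = 1"
    and "\<And>n. (\<Sum>k\<le>Suc n. complex_of_real (c (Suc n) k) *\<^sub>C T (Suc n) k) = \<Phi> A"
    and "\<And>n k. k \<le> n \<Longrightarrow> m \<le> c n k \<and> c n k \<le> M"
    and lim: "\<And>f. continuous_on {m..M} f \<Longrightarrow> (\<lambda>n. \<Sum>k\<le>n. complex_of_real (f (c n k)) *\<^sub>C T n k) \<longlonglongrightarrow> \<Phi> (op_fun f A)"
    by (rule positive_map_resolution[OF \<Phi> A]) blast
  have f2: "continuous_on {m..M} (\<lambda>t. (f t)\<^sup>2)" by (intro continuous_intros f)
  show ?thesis
    by (rule bop_le_tendsto[OF tendsto_mult[OF lim[OF f] lim[OF f]] lim[OF f2]])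
      (rule square_resolution_le[OF finite_atMost T(1) T(2)], simp)
qed

section \<open>The main inequalities\<close>

text \<open>Squeezing at 0. It treats t f(t) and - t / f(t), whose value at 0 is 0 whatever f is
  there.\<close>

lemma continuous_on_extend_zero:
  fixes h b :: "real \<Rightarrow> real"
  assumes h: "continuous_on {0<..} h" "h 0 = 0" and b: "continuous_on {0..} b" "b 0 = 0"
    and le: "\<And>t. 0 < t \<Longrightarrow> t \<le> 1 \<Longrightarrow> \<bar>h t\<bar> \<le> b t"
  shows "continuous_on {0..} h"
  unfolding continuous_on_eq_continuous_within
proof
  fix x :: real assume "x \<in> {0..}"
  show "continuous (at x within {0..}) h"
  proof (cases "x = 0")
    case True
    have "(b \<longlongrightarrow> b 0) (at 0 within {0..})" using b(1) by (auto simp: continuous_on_def)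
    moreover have "\<forall>\<^sub>F t in at 0 within {0..}. norm (h t) \<le> b t"
      unfolding eventually_at using le h(2) b(2)
      by (intro exI[of _ 1]) (auto simp: dist_real_def)
    ultimately have "(h \<longlongrightarrow> 0) (at 0 within {0..})"
      by (intro Lim_null_comparison[of h b]) (simp_all add: b(2))
    then show ?thesis by (simp add: True continuous_within h(2))
  next
    case False
    then have "isCont h x" using h(1) \<open>x \<in> {0..}\<close> by (simp add: continuous_on_eq_continuous_at)
    then show ?thesis by (rule continuous_at_imp_continuous_at_within)
  qed
qed

text \<open>With R the square root of F, sandwiching 1 \<le> F gives F = R R \<le> R F R =
  F^2.\<close>

lemma nonneg_square_ge_one:
  assumes "1 \<le> (F::'a::complex_hilbert bop)"
  shows "1 \<le> F * F"
proof -
  have "0 \<le> F" using assms cst_mono[of 0 1] by (auto intro: order_trans)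
  then obtain R where R: "adj R = R" "R * R = F" by (rule nonneg_square_root)
  have "F \<le> R * F * R" using bop_sandwich_mono[OF assms, of R] R by simp
  also have "R * F * R = F * F" by (simp add: R(2)[symmetric] mult.assoc)
  finally show ?thesis using assms by (rule order_trans[rotated])
qed

lemma abs_op_le_abs_op: "adj S * S \<le> adj T * T \<Longrightarrow> abs_op S \<le> abs_op T"
  by (rule nonneg_bop_le_of_square_le) (simp_all add: abs_op)

lemma abs_op_le: "0 \<le> R \<Longrightarrow> adj S * S \<le> R * R \<Longrightarrow> abs_op S \<le> R"
  by (rule nonneg_bop_le_of_square_le) (simp_all add: abs_op)

lemma le_abs_op: "0 \<le> R \<Longrightarrow> R * R \<le> adj S * S \<Longrightarrow> R \<le> abs_op S"
  by (rule nonneg_bop_le_of_square_le) (simp_all add: abs_op)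

text \<open>Both claims are instances of \<open>pinching_convex_of_operator_monotone\<close>, with f
  and - 1 / f as the operator monotone function. What remains is continuity at 0 of the two products
  with t.\<close>

lemma pinching_concave_mult_divide:
  assumes inf: "infinite_dimensional TYPE('l::complex_hilbert)"
    and fc: "continuous_on {0<..} f" and pos: "\<forall>t>0. f t > 0"
    and conc: "operator_concave_on TYPE('l) {0<..} (\<lambda>t. (f t)\<^sup>2)"
  shows "pinching_concave TYPE('l) (\<lambda>t. - (t * f t))" "pinching_concave TYPE('l) (\<lambda>t. t * (1 / f t))"
proof -
  note one = infinite_dimensional_nontrivial[OF inf]
  have fnn: "0 \<le> f t" if "t \<in> {0<..}" for t using pos that by (auto intro: less_imp_le)
  have mono: "op_fun f A \<le> op_fun f B" if "0 < a" "cst a \<le> A" "A \<le> B" for a and A B :: "'l bop"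
  proof -
    have B: "cst a \<le> B" using that by (meson order_trans)
    note s = spec_in_pos[OF that(1,2)] spec_in_pos[OF that(1) B]
    have "op_fun (\<lambda>t. (f t)\<^sup>2) A \<le> op_fun (\<lambda>t. (f t)\<^sup>2) B"
      by (rule operator_monotone_of_operator_concave[OF conc _ that]) simp
    then have "op_fun f A * op_fun f A \<le> op_fun f B * op_fun f B"
      by (simp add: power2_eq_square op_fun_mult[OF s(1) fc fc] op_fun_mult[OF s(2) fc fc])
    moreover have "0 \<le> op_fun f A" "0 \<le> op_fun f B"
      by (rule op_fun_nonneg[OF s(1) fc fnn] op_fun_nonneg[OF s(2) fc fnn], assumption)+
    ultimately show ?thesis by (intro nonneg_bop_le_of_square_le[of "op_fun f A"])
  qed
  \<comment> \<open>Applied to scalar operators, monotonicity bounds f near 0, so t f(t) \<le> t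
    f(1).\<close>
  have mono1: "f t \<le> f 1" if "0 < t" "t \<le> 1" for t
    using mono[OF that(1) order_refl cst_mono[OF that(2)]] unfolding op_fun_cst cst_le_cst_iff[OF one] .
  show "pinching_concave TYPE('l) (\<lambda>t. - (t * f t))"
  proof (rule pinching_convex_of_operator_monotone[OF mono fc])
    show "continuous_on {0..} (\<lambda>t. t * f t)"
      by (rule continuous_on_extend_zero[where b = "\<lambda>t. t * f 1"])
        (use pos mono1 in \<open>auto intro!: continuous_intros fc mult_left_mono simp: abs_mult less_imp_le\<close>)
  qed
  have fi: "continuous_on {0<..} (\<lambda>t. 1 / f t)"
    using pos by (intro continuous_intros fc) (auto simp: less_imp_neq[symmetric])
  have mono': "op_fun (\<lambda>t. - (1 / f t)) A \<le> op_fun (\<lambda>t. - (1 / f t)) B"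
    if "0 < a" "cst a \<le> A" "A \<le> B" for a and A B :: "'l bop"
  proof -
    have B: "cst a \<le> B" using that by (meson order_trans)
    note s = spec_in_pos[OF that(1,2)] spec_in_pos[OF that(1) B]
    have nz: "f t \<noteq> 0" if "t \<in> {0<..}" for t using pos that by auto
    have "0 \<le> op_fun f A" by (rule op_fun_nonneg[OF s(1) fc fnn])
    from inv_op_antimono[OF this mono[OF that] op_fun_inverse(1)[OF s(1) fc nz] op_fun_inverse(1)[OF s(2) fc nz]]
    have "op_fun (\<lambda>t. 1 / f t) B \<le> op_fun (\<lambda>t. 1 / f t) A"
      using op_fun_inverse(2)[OF s(1) fc nz] op_fun_inverse(2)[OF s(2) fc nz] by simp
    then show ?thesis by (simp only: op_fun_minus[OF s(1) fi] op_fun_minus[OF s(2) fi] neg_le_iff_le)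
  qed
  \<comment> \<open>A lower bound on the decay of f at 0. It gives t / f(t) \<le> sqrt (2 t) / f(1),
    the source of the majorant used below.\<close>
  have low: "t / 2 * (f 1)\<^sup>2 \<le> (f t)\<^sup>2" if t: "0 < t" "t \<le> 1" for t
  proof -
    \<comment> \<open>The weight with s + (1 - s) t / 2 = t. The second node is t / 2 since 0 is
      outside the domain of concavity; its contribution is nonnegative and is dropped.\<close>
    define s where "s = (t / 2) / (1 - t / 2)"
    have s: "t / 2 \<le> s" "0 \<le> s" "s \<le> 1" "s * (1 - t / 2) = t / 2" using t by (auto simp: s_def field_simps)
    have e: "s + (1 - s) * (t / 2) = t" using s(4) by (simp add: field_simps)
    have ec: "complex_of_real s *\<^sub>C cst 1 + complex_of_real (1 - s) *\<^sub>C cst (t / 2) = (cst t :: 'l bop)"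
      unfolding scaleC_scaleC scaleC_add_left[symmetric] of_real_mult[symmetric] of_real_add[symmetric]
      using e by simp
    have half: "0 < t / 2" using t by simp
    have "(cst (s * (f 1)\<^sup>2 + (1 - s) * (f (t / 2))\<^sup>2) :: 'l bop) \<le> cst ((f t)\<^sup>2)"
      using operator_concaveD[OF conc zero_less_one order_refl half order_refl s(2,3)]
      unfolding ec unfolding op_fun_cst scaleC_scaleC scaleC_add_left[symmetric] of_real_mult[symmetric] of_real_add[symmetric] .
    then have "s * (f 1)\<^sup>2 + (1 - s) * (f (t / 2))\<^sup>2 \<le> (f t)\<^sup>2"
      by (rule cst_le_cst_iff[OF one, THEN iffD1])
    moreover have "0 \<le> (1 - s) * (f (t / 2))\<^sup>2" using s by simp
    moreover have "t / 2 * (f 1)\<^sup>2 \<le> s * (f 1)\<^sup>2" using s(1) by (rule mult_right_mono) simp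
    ultimately show ?thesis by linarith
  qed
  have f1: "0 < f 1" using pos by simp
  have "pinching_concave TYPE('l) (\<lambda>t. - (t * - (1 / f t)))"
  proof (rule pinching_convex_of_operator_monotone[OF mono'])
    show "continuous_on {0<..} (\<lambda>t. - (1 / f t))" by (intro continuous_intros fi)
    show "continuous_on {0..} (\<lambda>t. t * - (1 / f t))"
    proof (rule continuous_on_extend_zero[where b = "\<lambda>t. sqrt 2 / f 1 * sqrt t"])
      show "continuous_on {0<..} (\<lambda>t. t * - (1 / f t))"
        by (intro continuous_on_mult continuous_on_minus fi continuous_on_id)
      show "continuous_on {0..} (\<lambda>t. sqrt 2 / f 1 * sqrt t)"
        by (intro continuous_on_mult continuous_on_const continuous_on_real_sqrt continuous_on_id)
      fix t :: real assume t: "0 < t" "t \<le> 1"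
      have ft: "0 < f t" using pos t by simp
      have "t * (t * (f 1)\<^sup>2) \<le> t * (2 * (f t)\<^sup>2)" using low[OF t] t by (intro mult_left_mono) auto
      then have "(t / f t)\<^sup>2 \<le> 2 * t / (f 1)\<^sup>2"
        using ft f1 by (simp add: power_divide field_simps power2_eq_square)
      also have "\<dots> = (sqrt 2 / f 1 * sqrt t)\<^sup>2" using t by (simp add: power_mult_distrib power_divide)
      finally have "t / f t \<le> sqrt 2 / f 1 * sqrt t" by (rule power2_le_imp_le) (use t f1 in simp)
      then show "\<bar>t * - (1 / f t)\<bar> \<le> sqrt 2 / f 1 * sqrt t" using t ft by (simp add: abs_mult)
    qed simp_all
  qed
  then show "pinching_concave TYPE('l) (\<lambda>t. t * (1 / f t))" by simp
qed

theorem corollary2p6: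
  fixes f :: "real \<Rightarrow> real"
    and \<Phi> :: "'h::complex_hilbert bop \<Rightarrow> 'k::complex_hilbert bop"
    and A :: "'h bop"
  assumes "infinite_dimensional TYPE('l::complex_hilbert)"
    and "continuous_on {0<..} f"
    and "\<forall>t>0. f t > 0"
    and "operator_concave_on TYPE('l) {0<..} (\<lambda>t. (f t)\<^sup>2)"
    and "unital_positive_map \<Phi>"
    and "positive_op A"
    and "invertible_op A"
  shows "abs_op (\<Phi> (op_fun f A) * \<Phi> A) \<le> \<Phi> (A * op_fun f A) \<and>
    abs_op (inv_op (\<Phi> (op_fun f A)) * \<Phi> A) \<ge> \<Phi> (A * inv_op (op_fun f A)) \<and>
    ((\<forall>t>0. f t \<ge> 1) \<longrightarrow>
      \<Phi> (A * inv_op (op_fun f A)) \<le> abs_op (inv_op (\<Phi> (op_fun f A)) * \<Phi> A) \<and>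
      abs_op (inv_op (\<Phi> (op_fun f A)) * \<Phi> A) \<le> abs_op (\<Phi> (op_fun f A) * \<Phi> A) \<and>
      abs_op (\<Phi> (op_fun f A) * \<Phi> A) \<le> \<Phi> (A * op_fun f A))"
proof -
  note inf = assms(1) and fc = assms(2) and pos = assms(3) and conc = assms(4) and \<Phi> = assms(5)
  have "0 \<le> A" using assms(6) by (simp add: positive_op_iff)
  then obtain m M0 where m: "0 < m" "cst m \<le> A" and M0: "m \<le> M0" "A \<le> cst M0"
    using positive_invertible_bounds[OF _ assms(7)] by blast
  \<comment> \<open>A strict m < M is needed to rescale the interval to [0, 1] for Bernstein
    polynomials.\<close>
  define M where "M = M0 + 1"
  have M: "m < M" "A \<le> cst M"
    using M0 cst_mono[of M0 M] by (auto simp: M_def intro: order_trans)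
  define S where "S = \<Phi> A"
  define F where "F = \<Phi> (op_fun f A)"
  have S: "cst m \<le> S" "S \<le> cst M"
    unfolding S_def by (intro unital_positive_map_bounds[OF \<Phi>] m M)+
  have saS: "adj S = S" using cst_le_sa(1)[OF S(1)] by (simp add: self_adjoint_def)
  note sA = spec_in_pos[OF m] and sS = spec_in_pos[OF m(1) S(1)]
  have sub: "{m..M} \<subseteq> {0<..}" using m by auto
  note fcI = continuous_on_subset[OF fc sub]
  have nz: "f t \<noteq> 0" if "t \<in> {0<..}" for t using pos that by auto
  have fi: "continuous_on {0<..} (\<lambda>t. 1 / f t)" using nz by (intro continuous_intros fc) auto
  have idc: "continuous_on {0<..} (\<lambda>t::real. t)" by (intro continuous_intros)
  have g: "continuous_on {0<..} (\<lambda>t. (f t)\<^sup>2)" by (intro continuous_intros fc)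
  have h: "continuous_on {0<..} (\<lambda>t. t * f t)" and k: "continuous_on {0<..} (\<lambda>t. t * (1 / f t))"
    by (intro continuous_on_mult idc fc fi)+
  note jensen = jensen_positive_map[OF inf _ _ \<Phi> m M(2,1), folded S_def]

  \<comment> \<open>The minimum of f on [m, M] is positive and passes through \<Phi> as a lower
    bound for F, which makes F invertible.\<close>
  have "\<exists>c\<in>{m..M}. \<forall>t\<in>{m..M}. f c \<le> f t"
    by (rule continuous_attains_inf[OF compact_Icc _ fcI]) (use M in auto)
  then obtain c where c: "c \<in> {m..M}" "\<And>t. t \<in> {m..M} \<Longrightarrow> f c \<le> f t" by blast
  have fc0: "0 < f c" using pos c(1) m(1) by auto
  have Fc: "cst (f c) \<le> F"
    unfolding F_def by (intro unital_positive_map_bounds[OF \<Phi>] op_fun_ge_cst[OF spec_in_Icc[OF m(2) M(2)] fcI] c(2))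
  have Finv: "invertible_op F" by (rule invertible_op_bounded_below[OF Fc fc0])
  have saF: "adj F = F" using cst_le_sa(1)[OF Fc] by (simp add: self_adjoint_def)
  have saI: "adj (inv_op F) = inv_op F"
    using inv_op_self_adjoint[OF _ Finv] saF by (simp add: self_adjoint_def)
  have FF0: "0 \<le> F * F" using positive_op_adj_mult[of F] by (simp add: positive_op_iff saF)

  have "F * F \<le> \<Phi> (op_fun (\<lambda>t. (f t)\<^sup>2) A)"
    unfolding F_def by (rule kadison_inequality[OF \<Phi> m(2) M(2,1) fcI])
  also have "\<dots> \<le> op_fun (\<lambda>t. (f t)\<^sup>2) S"
    by (rule jensen[OF pinching_concave_of_operator_concave[OF conc] g])
  finally have FF: "F * F \<le> op_fun (\<lambda>t. (f t)\<^sup>2) S" .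

  \<comment> \<open>Both orders of the commuting factors are recorded, so that S f(S)^2 S can be
    regrouped as (S f(S)) (f(S) S), the square of a single function of S; likewise for 1 /
    f.\<close>
  have hS: "op_fun (\<lambda>t. t * f t) S = S * op_fun f S" and kS: "op_fun (\<lambda>t. t * (1 / f t)) S = S * op_fun (\<lambda>t. 1 / f t) S"
    using op_fun_mult[OF sS idc fc] op_fun_mult[OF sS idc fi] op_fun_id[OF spec_in_sa[OF sS]] by simp_all
  have hS': "op_fun (\<lambda>t. t * f t) S = op_fun f S * S" and kS': "op_fun (\<lambda>t. t * (1 / f t)) S = op_fun (\<lambda>t. 1 / f t) S * S"
    using op_fun_mult[OF sS fc idc] op_fun_mult[OF sS fi idc] op_fun_id[OF spec_in_sa[OF sS]]
    by (simp_all add: mult.commute)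
  have gS: "op_fun (\<lambda>t. (f t)\<^sup>2) S = op_fun f S * op_fun f S"
    using op_fun_mult[OF sS fc fc] by (simp add: power2_eq_square)
  have giS: "inv_op (op_fun (\<lambda>t. (f t)\<^sup>2) S) = op_fun (\<lambda>t. 1 / f t) S * op_fun (\<lambda>t. 1 / f t) S"
    using op_fun_inverse(2)[OF sS g] op_fun_mult[OF sS fi fi] nz by (simp add: power2_eq_square)
  have hpos: "0 \<le> op_fun (\<lambda>t. t * f t) S" and kpos: "0 \<le> op_fun (\<lambda>t. t * (1 / f t)) S"
  proof -
    have *: "0 \<le> t * f t" "0 \<le> t * (1 / f t)" if "t \<in> {0<..}" for t
      using pos that by (auto simp: less_imp_le)
    from op_fun_nonneg[OF sS h *(1)] op_fun_nonneg[OF sS k *(2)]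
    show "0 \<le> op_fun (\<lambda>t. t * f t) S" "0 \<le> op_fun (\<lambda>t. t * (1 / f t)) S" by blast+
  qed

  have "abs_op (F * S) \<le> op_fun (\<lambda>t. t * f t) S"
  proof (rule abs_op_le[OF hpos])
    have "adj (F * S) * (F * S) = adj S * (F * F) * S" by (simp add: saF mult.assoc)
    also have "\<dots> \<le> adj S * op_fun (\<lambda>t. (f t)\<^sup>2) S * S" by (rule bop_sandwich_mono[OF FF])
    also have "\<dots> = op_fun (\<lambda>t. t * f t) S * op_fun (\<lambda>t. t * f t) S"
      by (subst (1) hS, subst hS') (simp add: gS saS mult.assoc)
    finally show "adj (F * S) * (F * S) \<le> op_fun (\<lambda>t. t * f t) S * op_fun (\<lambda>t. t * f t) S" .
  qed
  also have "op_fun (\<lambda>t. t * f t) S \<le> \<Phi> (op_fun (\<lambda>t. t * f t) A)"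
  proof -
    \<comment> \<open>Convexity of t f(t) is available as the pinching property of its negative, so
      Jensen's inequality is used with reversed signs.\<close>
    have "\<Phi> (op_fun (\<lambda>t. - (t * f t)) A) \<le> op_fun (\<lambda>t. - (t * f t)) S"
      by (rule jensen[OF pinching_concave_mult_divide(1)[OF inf fc pos conc]]) (intro continuous_intros h)
    then have "0 - \<Phi> (op_fun (\<lambda>t. t * f t) A) \<le> - op_fun (\<lambda>t. t * f t) S"
      using unital_positive_mapD(2)[OF \<Phi>, of 0 "op_fun (\<lambda>t. t * f t) A"] unital_positive_mapD(6)[OF \<Phi>, of 0]
      by (simp add: op_fun_minus[OF sA h] op_fun_minus[OF sS h])
    then show ?thesis by simp
  qed
  also have "op_fun (\<lambda>t. t * f t) A = A * op_fun f A"
    using op_fun_mult[OF sA idc fc] op_fun_id[OF spec_in_sa[OF sA]] by simp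
  finally have first: "abs_op (F * S) \<le> \<Phi> (A * op_fun f A)" .

  have II: "inv_op (F * F) = inv_op F * inv_op F"
    using inv_op[OF Finv] by (intro inv_op_eqI) (metis mult.assoc mult.right_neutral)+
  have adjI: "adj (inv_op F * S) * (inv_op F * S) = adj S * (inv_op F * inv_op F) * S"
    by (simp add: saI mult.assoc)
  have "A * inv_op (op_fun f A) = op_fun (\<lambda>t. t * (1 / f t)) A"
    using op_fun_inverse(2)[OF sA fc nz] op_fun_mult[OF sA idc fi] op_fun_id[OF spec_in_sa[OF sA]] by simp
  then have "\<Phi> (A * inv_op (op_fun f A)) \<le> op_fun (\<lambda>t. t * (1 / f t)) S"
    using jensen[OF pinching_concave_mult_divide(2)[OF inf fc pos conc] k] by simp
  also have "\<dots> \<le> abs_op (inv_op F * S)"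
  proof (rule le_abs_op[OF kpos])
    have "op_fun (\<lambda>t. t * (1 / f t)) S * op_fun (\<lambda>t. t * (1 / f t)) S =
        adj S * inv_op (op_fun (\<lambda>t. (f t)\<^sup>2) S) * S"
      by (subst (1) kS, subst kS') (simp add: giS saS mult.assoc)
    \<comment> \<open>Inversion reverses F^2 \<le> f(S)^2, and sandwiching with S preserves the
      result.\<close>
    also have "\<dots> \<le> adj S * inv_op (F * F) * S"
      by (intro bop_sandwich_mono inv_op_antimono FF0 FF invertible_op_mult Finv op_fun_inverse(1)[OF sS g])
        (use nz in simp)
    finally show "op_fun (\<lambda>t. t * (1 / f t)) S * op_fun (\<lambda>t. t * (1 / f t)) S \<le> adj (inv_op F * S) * (inv_op F * S)"
      unfolding adjI II .
  qed
  finally have second: "\<Phi> (A * inv_op (op_fun f A)) \<le> abs_op (inv_op F * S)" .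

  have third: "abs_op (inv_op F * S) \<le> abs_op (F * S)" if "\<forall>t>0. f t \<ge> 1"
  proof -
    \<comment> \<open>F \<ge> 1 yields F^-2 \<le> 1 \<le> F^2; sandwiching with S compares the
      squares of the two moduli.\<close>
    have "cst 1 \<le> F"
      unfolding F_def by (intro unital_positive_map_bounds[OF \<Phi>] op_fun_ge_cst[OF sA fc]) (use that in simp)
    then have F1: "1 \<le> F * F" by (intro nonneg_square_ge_one) simp
    have one: "inv_op 1 = (1 :: 'k bop)" by (rule inv_op_eqI) simp_all
    have "invertible_op (1 :: 'k bop)" unfolding invertible_op_def by (rule exI[of _ 1]) simp
    moreover have "(0 :: 'k bop) \<le> 1" using cst_mono[of 0 1] by simp
    ultimately have "inv_op (F * F) \<le> 1"
      using inv_op_antimono[OF _ F1] invertible_op_mult[OF Finv Finv] one by simp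
    then have "inv_op F * inv_op F \<le> F * F" unfolding II using F1 by (rule order_trans)
    from bop_sandwich_mono[OF this, of S]
    have "adj (inv_op F * S) * (inv_op F * S) \<le> adj (F * S) * (F * S)"
      unfolding adjI by (simp add: saF mult.assoc)
    then show ?thesis by (rule abs_op_le_abs_op)
  qed
  show ?thesis using first second third unfolding F_def S_def by blast
qed

end
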